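(* Let $L$ be an extremally disconnected compact Hausdorff space. Then the weak essential norm $\|\cdot\|_w$ has Bonsall's minimality property on the weak Calkin algebra $\mathscr{B}(C(L))/\mathscr{W}(C(L))$; that is, every algebra norm $|||\cdot|||$ on $\mathscr{B}(C(L))/\mathscr{W}(C(L))$ satisfying $|||\cdot|||\le\|\cdot\|_w$ is equal to $\|\cdot\|_w$.
   Context: Scalars are real or complex. For a Banach space $E$, $\mathscr{B}(E)$ is the algebra of bounded linear operators on $E$ and $\mathscr{W}(E)$ is the ideal of weakly compact operators (those mapping the unit ball to a relatively weakly compact set). The weak essential norm is the quotient norm $\|T\|_w=\inf\{\|T-W\|: W\in\mathscr{W}(E)\}$ on $\mathscr{B}(E)/\mathscr{W}(E)$. An algebra norm is a submultiplicative norm (completeness is not assumed). A topological space is extremally disconnected if the closure of every open set is open. *)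

theory Defs
  imports "HOL-Analysis.Analysis" "HOL-Algebra.QuotRing" "HOL-Algebra.Module"
begin

text \<open>
  For a compact space \<open>L\<close>, given as a type \<open>'l\<close>, the Banach space \<open>C(L)\<close> over the scalar
  field \<open>'k\<close> (the reals or the complex numbers) is the library type \<open>'l \<Rightarrow>\<^sub>C 'k\<close> with the
  supremum norm.  The library only provides it as a \<^emph>\<open>real\<close> normed space, so multiplication by
  scalars from \<open>'k\<close> is defined here, and \<open>'k\<close>-linearity of operators and functionals is imposed
  explicitly.
\<close>

definition scale_bcontfun ::
    "'k::real_normed_field \<Rightarrow> ('l::topological_space \<Rightarrow>\<^sub>C 'k) \<Rightarrow> ('l \<Rightarrow>\<^sub>C 'k)"
  where "scale_bcontfun c f = Bcontfun (\<lambda>x. c * apply_bcontfun f x)"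

lemma apply_scale_bcontfun [simp]:
  "apply_bcontfun (scale_bcontfun c f) x = c * apply_bcontfun f x"
proof -
  have "bounded ((\<lambda>y. c * y) ` range (apply_bcontfun f))"
    by (intro bounded_linear_image bounded_apply_bcontfun bounded_linear_mult_right)
  then have "(\<lambda>x. c * apply_bcontfun f x) \<in> bcontfun"
    by (auto simp: bcontfun_def image_image intro!: continuous_intros)
  then show ?thesis
    by (simp add: scale_bcontfun_def Bcontfun_inverse)
qed

lemma norm_scale_bcontfun_le: "norm (scale_bcontfun c f) \<le> norm c * norm f"
  by (rule norm_bound)
    (auto simp: norm_mult intro!: mult_left_mono norm_bounded)

lemma bounded_linear_scale_bcontfun: "bounded_linear (scale_bcontfun c)"
proof (rule bounded_linear_intro)
  show "norm (scale_bcontfun c f) \<le> norm f * norm c" for f :: "'a \<Rightarrow>\<^sub>C 'b"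
    using norm_scale_bcontfun_le[of c f] by (simp add: mult.commute)
qed (auto intro!: bcontfun_eqI simp: algebra_simps)

type_synonym ('l, 'k) operator = "('l \<Rightarrow>\<^sub>C 'k) \<Rightarrow>\<^sub>L ('l \<Rightarrow>\<^sub>C 'k)"

definition scale_operator ::
    "'k::real_normed_field \<Rightarrow> ('l::topological_space, 'k) operator \<Rightarrow> ('l, 'k) operator"
  where "scale_operator c T = Blinfun (\<lambda>f. scale_bcontfun c (blinfun_apply T f))"

lemma apply_scale_operator [simp]:
  "blinfun_apply (scale_operator c T) f = scale_bcontfun c (blinfun_apply T f)"
  unfolding scale_operator_def
  by (subst bounded_linear_Blinfun_apply)
    (auto intro: bounded_linear_compose[OF bounded_linear_scale_bcontfun]
      blinfun.bounded_linear_right)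

definition bounded_operators :: "('l::topological_space, 'k::real_normed_field) operator set"
  where "bounded_operators =
    {T. \<forall>c f. blinfun_apply T (scale_bcontfun c f) = scale_bcontfun c (blinfun_apply T f)}"

definition operator_algebra ::
    "('k::real_normed_field, ('l::topological_space, 'k) operator) module"
  where "operator_algebra =
    \<lparr>carrier = bounded_operators, mult = (o\<^sub>L), one = id_blinfun, zero = 0, add = (+),
     smult = scale_operator\<rparr>"

definition dual_space :: "(('l::topological_space \<Rightarrow>\<^sub>C 'k::real_normed_field) \<Rightarrow>\<^sub>L 'k) set"
  where "dual_space =
    {\<phi>. \<forall>c f. blinfun_apply \<phi> (scale_bcontfun c f) = c * blinfun_apply \<phi> f}"

definition weak_topology :: "('l::topological_space \<Rightarrow>\<^sub>C 'k::real_normed_field) topology"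
  where "weak_topology =
    topology_generated_by {blinfun_apply \<phi> -` U | \<phi> U. \<phi> \<in> dual_space \<and> open U}"

definition weakly_compact_operators ::
    "('l::topological_space, 'k::real_normed_field) operator set"
  where "weakly_compact_operators =
    {T \<in> bounded_operators.
       compactin weak_topology
         (Abstract_Topology.closure_of weak_topology (blinfun_apply T ` cball 0 1))}"

text \<open>
  The elements of the weak Calkin algebra are the cosets \<open>T + \<W>\<close>.  The ring structure is the
  library's quotient ring; a scalar multiple of a coset is formed from any representative, as
  \<^const>\<open>rcoset_mult\<close> does for products.
\<close>

definition weak_calkin ::
    "('k::real_normed_field, ('l::topological_space, 'k) operator set) module"
  where "weak_calkin =
    ring.extend (operator_algebra Quot weakly_compact_operators)
      (module.fields
        (\<lambda>c X. \<Union>T\<in>X. weakly_compact_operators +>\<^bsub>operator_algebra\<^esub> scale_operator c T))"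

text \<open>The quotient norm of a coset; see \<open>weak_essential_norm_coset\<close> below for the formula
  \<open>\<parallel>T\<parallel>\<^sub>w = inf {\<parallel>T - W\<parallel> | W \<in> \<W>}\<close>.\<close>

definition weak_essential_norm ::
    "('l::topological_space, 'k::real_normed_field) operator set \<Rightarrow> real"
  where "weak_essential_norm X = (INF S\<in>X. norm S)"

text \<open>Neither completeness nor \<open>p \<one> = 1\<close> is required of an algebra norm.\<close>

definition algebra_norm ::
    "('k::real_normed_field, 'a) module \<Rightarrow> ('a \<Rightarrow> real) \<Rightarrow> bool"
  where "algebra_norm A p \<longleftrightarrow>
    (\<forall>x\<in>carrier A. 0 \<le> p x) \<and>
    (\<forall>x\<in>carrier A. p x = 0 \<longleftrightarrow> x = \<zero>\<^bsub>A\<^esub>) \<and>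
    (\<forall>c. \<forall>x\<in>carrier A. p (c \<odot>\<^bsub>A\<^esub> x) = norm c * p x) \<and>
    (\<forall>x\<in>carrier A. \<forall>y\<in>carrier A. p (x \<oplus>\<^bsub>A\<^esub> y) \<le> p x + p y) \<and>
    (\<forall>x\<in>carrier A. \<forall>y\<in>carrier A. p (x \<otimes>\<^bsub>A\<^esub> y) \<le> p x * p y)"

definition bonsall_minimality ::
    "('k::real_normed_field, 'a) module \<Rightarrow> ('a \<Rightarrow> real) \<Rightarrow> bool"
  where "bonsall_minimality A p \<longleftrightarrow>
    (\<forall>q. algebra_norm A q \<and> (\<forall>x\<in>carrier A. q x \<le> p x) \<longrightarrow> (\<forall>x\<in>carrier A. q x = p x))"

lemma uminus_weakly_compact_operators:
  assumes "T \<in> weakly_compact_operators"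
  shows "- T \<in> weakly_compact_operators"
proof -
  have *: "scale_bcontfun c (- f) = - scale_bcontfun c f" for c :: 'b and f :: "'a \<Rightarrow>\<^sub>C 'b"
    by (auto intro!: bcontfun_eqI)
  have "blinfun_apply (- T) ` cball 0 1 = blinfun_apply T ` uminus ` cball 0 1"
    by (simp add: image_image blinfun.minus_left blinfun.minus_right)
  also have "uminus ` cball (0 :: 'a \<Rightarrow>\<^sub>C 'b) 1 = cball 0 1"
  proof
    show "cball 0 1 \<subseteq> uminus ` cball (0 :: 'a \<Rightarrow>\<^sub>C 'b) 1"
    proof
      fix f :: "'a \<Rightarrow>\<^sub>C 'b" assume "f \<in> cball 0 1"
      then show "f \<in> uminus ` cball 0 1"
        by (intro image_eqI[of _ _ "- f"]) simp_all
    qed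
  qed auto
  finally show ?thesis
    using assms by (auto simp: weakly_compact_operators_def bounded_operators_def
        blinfun.minus_left *)
qed

lemma weak_essential_norm_coset:
  "weak_essential_norm (weakly_compact_operators +>\<^bsub>operator_algebra\<^esub> T) =
     (INF W\<in>weakly_compact_operators. norm (T - W))"
proof -
  have "weakly_compact_operators +>\<^bsub>operator_algebra\<^esub> T =
      (\<lambda>W. T - W) ` weakly_compact_operators" (is "?L = ?R")
  proof
    show "?L \<subseteq> ?R"
    proof
      fix S assume "S \<in> ?L"
      then obtain W where "W \<in> weakly_compact_operators" "S = W + T"
        by (auto simp: a_r_coset_def' operator_algebra_def)
      then show "S \<in> ?R"
        by (intro image_eqI[of _ _ "- W"]) (simp_all add: uminus_weakly_compact_operators)
    qed
    show "?R \<subseteq> ?L"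
    proof
      fix S assume "S \<in> ?R"
      then obtain W where "W \<in> weakly_compact_operators" "S = - W + T"
        by auto
      then show "S \<in> ?L"
        using uminus_weakly_compact_operators[of W]
        by (auto simp: a_r_coset_def' operator_algebra_def)
    qed
  qed
  then show ?thesis
    by (simp add: weak_essential_norm_def image_image)
qed

lemma carrier_weak_calkin:
  "carrier weak_calkin =
     (\<lambda>T. weakly_compact_operators +>\<^bsub>operator_algebra\<^esub> T) ` bounded_operators"
  by (auto simp: weak_calkin_def FactRing_def A_RCOSETS_def' a_r_coset_def'
      ring.extend_def module.fields_def operator_algebra_def)

end

theory Submission
  imports Defs
begin

text \<open>
  Let \<open>T\<close> be an operator on \<open>C(L)\<close> and let \<open>c < \<parallel>T\<parallel>\<^sub>w\<close>. The point is to find, for every small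
  \<open>\<epsilon> > 0\<close>, operators \<open>P\<close> and \<open>V\<close> such that \<open>P\<close> is an idempotent of norm at most one that is
  not weakly compact, \<open>\<parallel>V\<parallel> \<le> 1 / (c - \<epsilon>)\<close> and \<open>\<parallel>P - V T P\<parallel> \<le> \<epsilon> / (c - \<epsilon>)\<close>
  (\<open>almost_factorization\<close>). An algebra norm \<open>q \<le> \<parallel>\<cdot>\<parallel>\<^sub>w\<close> then has \<open>q(P) \<ge> 1\<close>, since \<open>P\<close> is a
  nonzero idempotent modulo \<open>\<W>\<close>, and \<open>q(P) \<le> 1\<close>, so that \<open>1 \<le> q(V) q(T) q(P) + q(P - V T P) \<le>
  (q(T) + \<epsilon>) / (c - \<epsilon>)\<close>; letting \<open>\<epsilon> \<rightarrow> 0\<close> and \<open>c \<rightarrow> \<parallel>T\<parallel>\<^sub>w\<close> gives \<open>q(T) \<ge> \<parallel>T\<parallel>\<^sub>w\<close>.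

  Behind \<open>P\<close> and \<open>V\<close> are functions \<open>f\<^sub>k\<close> in the unit ball, supported in disjoint clopen sets
  \<open>B\<^sub>k\<close>, and points \<open>x\<^sub>k\<close> with \<open>\<bar>T f\<^sub>k (x\<^sub>k)\<bar> > c - \<epsilon>\<close> at which \<open>T\<close> almost ignores the closure
  of the union of the other \<open>B\<^sub>j\<close> (\<open>almost_diagonal_sequence\<close>). As \<open>L\<close> is extremally
  disconnected, every bounded sequence \<open>a\<close> gives a continuous function equal to \<open>a\<^sub>k f\<^sub>k\<close> on
  each \<open>B\<^sub>k\<close> (\<open>patching\<close>); the images of \<open>P\<close> and \<open>V\<close> lie in this copy of \<open>\<ell>\<^sub>\<infinity>\<close>. The operator
  \<open>P\<close> samples its argument where \<open>f\<^sub>k\<close> attains its norm, and \<open>V\<close> samples at \<open>x\<^sub>k\<close>.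

  The sequence comes from a formula for the distance to \<open>\<W>\<close>. Suppose that \<open>\<parallel>T f\<parallel> \<le> \<rho>(\<bar>f\<bar>) + c
  \<parallel>f\<parallel>\<close> for a positive functional \<open>\<rho>\<close>. On the diagonal of \<open>C(L) \<times> C(L)\<close> the operator \<open>T\<close> is
  then dominated by the seminorm \<open>\<rho>(\<bar>f\<bar>) + c \<parallel>g\<parallel>\<close>; a Hahn-Banach extension, which exists
  because \<open>C(L, \<real>)\<close> is Dedekind complete, splits \<open>T\<close> into an operator \<open>W\<close> with \<open>\<parallel>W f\<parallel> \<le>
  \<rho>(\<bar>f\<bar>)\<close> and a remainder of norm at most \<open>c\<close>. As \<open>W\<close> is continuous for the seminorm of
  \<open>L\<^sub>2(\<rho>)\<close>, it is weakly compact, so \<open>\<parallel>T\<parallel>\<^sub>w \<le> c\<close>. Hence if \<open>c < \<parallel>T\<parallel>\<^sub>w\<close>, no such \<open>\<rho>\<close> exists.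
  Taking for \<open>\<rho>\<close> large multiples of the sum of the total variations of the measures \<open>f \<mapsto> T f
  (x\<^sub>i)\<close> found so far yields, step by step, functions on which \<open>T\<close> is large at a new point and
  which all earlier measures almost annihilate. Two combinatorial arguments,
  \<open>disjoint_refinement\<close> and \<open>rosenthal_subsequence\<close>, make the supports disjoint and the
  interaction between them small.
\<close>

section \<open>Extremally disconnected spaces and vector-valued Hahn-Banach extension\<close>

text \<open>
  The space is given as a type; the parameter only carries this type into the locale.
\<close>

locale stonean =
  fixes space_type :: "'l::t2_space itself"
  assumes compact_UNIV: "compact (UNIV :: 'l set)"
    and open_closure: "\<And>U :: 'l set. open U \<Longrightarrow> open (closure U)"
begin

lemma bounded_range_continuous:
  fixes f :: "'l \<Rightarrow> 'b::metric_space"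
  assumes "continuous_on UNIV f"
  shows "bounded (range f)"
  using compact_continuous_image[OF assms compact_UNIV] compact_imp_bounded by blast

lemma apply_Bcontfun:
  fixes f :: "'l \<Rightarrow> 'b::metric_space"
  assumes "continuous_on UNIV f"
  shows "apply_bcontfun (Bcontfun f) = f"
  using assms bounded_range_continuous[OF assms] by (simp add: Bcontfun_inverse bcontfun_def)

text \<open>
  For \<open>L\<close> extremally disconnected, \<open>C(L, \<real>)\<close> is Dedekind complete. The pointwise supremum of
  the family is only lower semicontinuous; its regularization at \<open>x\<close> is the supremum of the
  \<open>t\<close> for which \<open>x\<close> lies in the closure of the open set where some member exceeds \<open>t\<close>. Since
  these closures are clopen, the regularization is continuous.
\<close>

lemma least_upper_bound_exists:
  fixes F :: "('l \<Rightarrow> real) set"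
  assumes "F \<noteq> {}" and cont: "\<And>f. f \<in> F \<Longrightarrow> continuous_on UNIV f"
    and bound: "\<And>f x. f \<in> F \<Longrightarrow> f x \<le> M"
  obtains s where "continuous_on UNIV s" and "\<And>f x. f \<in> F \<Longrightarrow> f x \<le> s x"
    and "\<And>k x. continuous_on UNIV k \<Longrightarrow> (\<And>f y. f \<in> F \<Longrightarrow> f y \<le> k y) \<Longrightarrow> s x \<le> k x"
proof -
  define C where "C t = closure (\<Union>f\<in>F. {x. t < f x})" for t
  define s where "s x = Sup {t. x \<in> C t}" for x
  have "open (\<Union>f\<in>F. {x. t < f x})" for t
    using cont by (intro open_UN ballI open_Collect_less) auto
  then have openC: "open (C t)" for t
    unfolding C_def by (rule open_closure)
  have closedC: "closed (C t)" for t
    by (simp add: C_def)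
  have anti: "C t \<subseteq> C u" if "u \<le> t" for t u
    unfolding C_def using that by (intro closure_mono) force
  have C_le: "t \<le> M" if "x \<in> C t" for x t
  proof (rule ccontr)
    assume "\<not> t \<le> M"
    then have "\<not> t < f x" if "f \<in> F" for f x
      using bound[OF that, of x] by simp
    then have "(\<Union>f\<in>F. {x. t < f x}) = {}" by auto
    with that show False by (simp add: C_def)
  qed
  have mem: "x \<in> C t" if "f \<in> F" "t < f x" for f t x
    unfolding C_def by (rule subsetD[OF closure_subset]) (use that in auto)
  obtain f0 where f0: "f0 \<in> F" using assms(1) by blast
  have ne: "{t. x \<in> C t} \<noteq> {}" for x
    using mem[OF f0, of "f0 x - 1" x] by auto
  have bdd: "bdd_above {t. x \<in> C t}" for x
    using C_le by (auto intro!: bdd_aboveI[of _ M])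
  have gt: "t < s x \<longleftrightarrow> (\<exists>u>t. x \<in> C u)" for t x
    unfolding s_def less_cSup_iff[OF ne bdd] by auto
  have lt: "s x < t \<longleftrightarrow> (\<exists>u<t. x \<notin> C u)" for t x
  proof
    assume "s x < t"
    then obtain u where "s x < u" "u < t" using dense by blast
    then show "\<exists>u<t. x \<notin> C u"
      using cSup_upper[OF _ bdd, of u x] by (auto simp: s_def)
  next
    assume "\<exists>u<t. x \<notin> C u"
    then obtain u where u: "u < t" "x \<notin> C u" by blast
    have "s x \<le> u"
      unfolding s_def
    proof (rule cSup_least[OF ne])
      fix t assume "t \<in> {t. x \<in> C t}"
      then have "\<not> u \<le> t" using u(2) anti[of u t] by blast
      then show "t \<le> u" by simp
    qed
    with u show "s x < t" by simp
  qed
  show thesis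
  proof
    show "continuous_on UNIV s"
      unfolding continuous_on_def
    proof (intro ballI order_tendstoI)
      fix x a assume "a < s x"
      then obtain u where "u > a" "x \<in> C u" using gt by blast
      then show "\<forall>\<^sub>F y in at x. a < s y"
        unfolding eventually_at_topological using openC[of u] gt[of a] by (intro exI[of _ "C u"]) blast
    next
      fix x a assume "s x < a"
      then obtain u where "u < a" "x \<notin> C u" using lt by blast
      then show "\<forall>\<^sub>F y in at x. s y < a"
        unfolding eventually_at_topological using closedC[of u] lt[of _ a]
        by (intro exI[of _ "- C u"]) (blast intro: open_Compl)
    qed
    show "f x \<le> s x" if "f \<in> F" for f x
    proof (rule ccontr)
      assume "\<not> f x \<le> s x"
      then have "s x < f x" by simp
      then obtain u where "u < f x" "x \<notin> C u" using lt by blast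
      then show False using mem that by blast
    qed
    show "s x \<le> k x" if k: "continuous_on UNIV k" "\<And>f y. f \<in> F \<Longrightarrow> f y \<le> k y" for k x
      unfolding s_def
    proof (rule cSup_least[OF ne], safe)
      fix t assume "x \<in> C t"
      moreover have "C t \<subseteq> {y. t \<le> k y}"
        unfolding C_def
      proof (rule closure_minimal)
        show "closed {y. t \<le> k y}"
          using k(1) by (intro closed_Collect_le) auto
        show "(\<Union>f\<in>F. {x. t < f x}) \<subseteq> {y. t \<le> k y}"
        proof safe
          fix f y assume "f \<in> F" "t < f y"
          then show "t \<le> k y" using k(2)[of f y] by simp
        qed
      qed
      ultimately show "t \<le> k x" by auto
    qed
  qed
qed

text \<open>
  The Hahn-Banach theorem for maps into \<open>C(L, \<real>)\<close>. A partially defined linear map is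
  represented by its graph, a subspace of the product; domination alone makes such a subspace
  single-valued, as \<open>p 0 = 0\<close>. Zorn's lemma gives a maximal dominated graph, and Dedekind
  completeness provides the value at one further vector.
\<close>

lemma dominated_extension_exists:
  fixes p :: "'v::real_vector \<Rightarrow> real" and G :: "('v \<times> ('l \<Rightarrow>\<^sub>C real)) set"
  assumes p_add: "\<And>u v. p (u + v) \<le> p u + p v"
    and p_scale: "\<And>t v. 0 \<le> t \<Longrightarrow> p (t *\<^sub>R v) = t * p v"
    and G: "subspace G" and dom: "\<And>v y x. (v, y) \<in> G \<Longrightarrow> apply_bcontfun y x \<le> p v"
  obtains U where "linear U" and "\<And>v x. apply_bcontfun (U v) x \<le> p v"
    and "\<And>v y. (v, y) \<in> G \<Longrightarrow> U v = y"
proof -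
  define \<S> where "\<S> = {H. subspace H \<and> G \<subseteq> H \<and> (\<forall>(v, y)\<in>H. \<forall>x. apply_bcontfun y x \<le> p v)}"
  have "\<exists>H\<in>\<S>. \<forall>X\<in>\<S>. H \<subseteq> X \<longrightarrow> X = H"
  proof (rule subset_Zorn_nonempty)
    show "\<S> \<noteq> {}" using G dom by (auto simp: \<S>_def)
    fix \<C> assume ne: "\<C> \<noteq> {}" and "subset.chain \<S> \<C>"
    then have sub: "\<C> \<subseteq> \<S>" and chain: "\<And>X Y. X \<in> \<C> \<Longrightarrow> Y \<in> \<C> \<Longrightarrow> X \<subseteq> Y \<or> Y \<subseteq> X"
      by (auto simp: subset_chain_def)
    have subsp: "subspace H" "G \<subseteq> H" if "H \<in> \<C>" for H
      using that sub by (auto simp: \<S>_def)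
    have "subspace (\<Union>\<C>)"
      unfolding subspace_def
    proof (intro conjI ballI allI)
      show "0 \<in> \<Union>\<C>" using ne subsp subspace_0 by blast
      fix x assume x: "x \<in> \<Union>\<C>"
      then show "c *\<^sub>R x \<in> \<Union>\<C>" for c using subsp subspace_scale by blast
      fix y assume "y \<in> \<Union>\<C>"
      with x obtain X Y where "X \<in> \<C>" "Y \<in> \<C>" "x \<in> X" "y \<in> Y" by blast
      then show "x + y \<in> \<Union>\<C>" using chain[of X Y] subsp subspace_add by blast
    qed
    moreover have "G \<subseteq> \<Union>\<C>" using ne subsp by blast
    moreover have "\<forall>(v, y)\<in>\<Union>\<C>. \<forall>x. apply_bcontfun y x \<le> p v"
      using sub unfolding \<S>_def by blast
    ultimately show "\<Union>\<C> \<in> \<S>" by (simp add: \<S>_def)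
  qed
  then obtain H where "H \<in> \<S>" and max: "\<And>X. X \<in> \<S> \<Longrightarrow> H \<subseteq> X \<Longrightarrow> X = H" by blast
  then have H: "subspace H" "G \<subseteq> H" and Hdom: "\<And>v y x. (v, y) \<in> H \<Longrightarrow> apply_bcontfun y x \<le> p v"
    by (auto simp: \<S>_def)
  have H0: "(0, 0) \<in> H" using subspace_0[OF H(1)] by (simp add: zero_prod_def)
  have H_add: "(v + w, y + z) \<in> H" if "(v, y) \<in> H" "(w, z) \<in> H" for v w y z
    using subspace_add[OF H(1) that] by simp
  have H_scale: "(t *\<^sub>R v, t *\<^sub>R y) \<in> H" if "(v, y) \<in> H" for v y t
    using subspace_scale[OF H(1) that] by simp
  have total: "\<exists>y. (v0, y) \<in> H" for v0
  proof (rule ccontr)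
    assume no: "\<nexists>y. (v0, y) \<in> H"
    \<comment> \<open>The value at \<open>v0\<close> has to lie between all \<open>y - p (v - v0)\<close> and all \<open>p (w + v0) - z\<close>.\<close>
    define F where "F = {\<lambda>x. apply_bcontfun y x - p (v - v0) | v y. (v, y) \<in> H}"
    have cross: "apply_bcontfun y x - p (v - v0) \<le> p (w + v0) - apply_bcontfun z x"
      if "(v, y) \<in> H" "(w, z) \<in> H" for v y w z x
      using Hdom[OF H_add[OF that], of x] p_add[of "v - v0" "w + v0"] by simp
    have "F \<noteq> {}" using H0 by (auto simp: F_def)
    moreover have "continuous_on UNIV f" if "f \<in> F" for f
      using that by (auto simp: F_def intro!: continuous_intros)
    moreover have "f x \<le> p v0" if "f \<in> F" for f x
      using that cross[OF _ H0] by (auto simp: F_def)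
    ultimately obtain s where s: "continuous_on UNIV s" "\<And>f x. f \<in> F \<Longrightarrow> f x \<le> s x"
      "\<And>k x. continuous_on UNIV k \<Longrightarrow> (\<And>f y. f \<in> F \<Longrightarrow> f y \<le> k y) \<Longrightarrow> s x \<le> k x"
      using least_upper_bound_exists[of F "p v0"] by metis
    have lower: "apply_bcontfun y x - p (v - v0) \<le> s x" if "(v, y) \<in> H" for v y x
    proof -
      have "(\<lambda>x. apply_bcontfun y x - p (v - v0)) \<in> F"
        unfolding F_def using that by blast
      from s(2)[OF this] show ?thesis .
    qed
    have upper: "s x \<le> p (w + v0) - apply_bcontfun z x" if "(w, z) \<in> H" for w z x
      using that by (intro s(3)) (auto simp: F_def intro!: continuous_intros cross)
    define e where "e = (v0, Bcontfun s)"
    define H' where "H' = span (insert e H)"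
    have H'_iff: "h \<in> H' \<longleftrightarrow> (\<exists>t. h - t *\<^sub>R e \<in> H)" for h
      by (simp add: H'_def span_insert span_eq_iff[THEN iffD2, OF H(1)])
    have "H \<subseteq> H'" by (auto simp: H'_def intro: span_base)
    moreover have "apply_bcontfun y x \<le> p v" if vy: "(v, y) \<in> H'" for v y x
    proof -
      obtain t where t: "(v - t *\<^sub>R v0, y - t *\<^sub>R Bcontfun s) \<in> H"
        using vy by (auto simp: H'_iff e_def)
      consider "t = 0" | "t > 0" | "t < 0" by linarith
      then show ?thesis
      proof cases
        case 1
        then show ?thesis using Hdom t by simp
      next
        case 2
        then have "s x \<le> p ((1/t) *\<^sub>R (v - t *\<^sub>R v0) + v0) - apply_bcontfun ((1/t) *\<^sub>R (y - t *\<^sub>R Bcontfun s)) x"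
          by (intro upper H_scale t)
        also have "(1/t) *\<^sub>R (v - t *\<^sub>R v0) + v0 = (1/t) *\<^sub>R v"
          using 2 by (simp add: algebra_simps)
        finally show ?thesis
          using 2 by (simp add: p_scale apply_Bcontfun[OF s(1)] field_simps)
      next
        case 3
        define r where "r = - t"
        have r: "r > 0" "t = - r" using 3 by (auto simp: r_def)
        have "apply_bcontfun ((1/r) *\<^sub>R (y - t *\<^sub>R Bcontfun s)) x - p ((1/r) *\<^sub>R (v - t *\<^sub>R v0) - v0) \<le> s x"
          by (intro lower H_scale t)
        also have "(1/r) *\<^sub>R (v - t *\<^sub>R v0) - v0 = (1/r) *\<^sub>R v"
          using r by (simp add: algebra_simps)
        finally show ?thesis
          using r by (simp add: p_scale apply_Bcontfun[OF s(1)] field_simps)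
      qed
    qed
    ultimately have "H' \<in> \<S>" using H by (auto simp: \<S>_def H'_def)
    then have "H' = H" using max \<open>H \<subseteq> H'\<close> by blast
    moreover have "e \<in> H'" by (simp add: H'_def span_base)
    ultimately show False using no by (auto simp: e_def)
  qed
  have p0: "p 0 = 0" using p_scale[of 0 0] by simp
  have unique: "y = z" if "(v, y) \<in> H" "(v, z) \<in> H" for v y z
  proof (rule bcontfun_eqI)
    fix x
    have "(0, y - z) \<in> H" "(0, z - y) \<in> H"
      using subspace_diff[OF H(1) that] subspace_diff[OF H(1) that(2,1)] by simp_all
    from this[THEN Hdom, of x] show "apply_bcontfun y x = apply_bcontfun z x"
      by (simp add: p0)
  qed
  define U where "U v = (SOME y. (v, y) \<in> H)" for v
  have U: "(v, U v) \<in> H" for v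
    unfolding U_def using total[of v] by (rule someI_ex)
  show thesis
  proof
    show "linear U"
      by (intro linearI unique[OF U] H_add[OF U U] H_scale[OF U])
    show "apply_bcontfun (U v) x \<le> p v" for v x
      by (rule Hdom[OF U])
    show "U v = y" if "(v, y) \<in> G" for v y
      using that H(2) by (intro unique[OF U]) auto
  qed
qed

end

section \<open>The weak topology and the ideal of weakly compact operators\<close>

definition point_evaluation ::
    "'l::topological_space \<Rightarrow> ('l \<Rightarrow>\<^sub>C 'k::real_normed_field) \<Rightarrow>\<^sub>L 'k"
  where "point_evaluation x = Blinfun (\<lambda>f. apply_bcontfun f x)"

lemma apply_point_evaluation [simp]: "blinfun_apply (point_evaluation x) f = apply_bcontfun f x"
  unfolding point_evaluation_def
  by (subst bounded_linear_Blinfun_apply)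
    (auto intro!: bounded_linear_intro[where K = 1] simp: norm_bounded)

lemma point_evaluation_in_dual_space: "point_evaluation x \<in> dual_space"
  by (simp add: dual_space_def)

lemma norm_point_evaluation_le: "norm (point_evaluation x) \<le> 1"
  by (rule norm_blinfun_bound) (simp_all add: norm_bounded)

lemma topspace_weak_topology [simp]: "topspace weak_topology = UNIV"
  unfolding weak_topology_def topology_generated_by_topspace
  using point_evaluation_in_dual_space by (blast intro: open_UNIV)

lemma continuous_map_weak_topology:
  assumes "\<phi> \<in> dual_space"
  shows "continuous_map weak_topology euclidean (blinfun_apply \<phi>)"
  unfolding continuous_map_def
proof (intro conjI allI impI)
  fix U assume "openin euclidean (U :: 'b set)"
  then have "openin weak_topology (blinfun_apply \<phi> -` U)"
    unfolding weak_topology_def using assms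
    by (intro topology_generated_by_Basis) auto
  then show "openin weak_topology {x \<in> topspace weak_topology. blinfun_apply \<phi> x \<in> U}"
    by (simp add: vimage_def)
qed simp

lemma continuous_map_into_weak_topology:
  fixes f :: "'a \<Rightarrow> ('b::topological_space \<Rightarrow>\<^sub>C 'c::real_normed_field)"
  assumes "\<And>\<phi>. \<phi> \<in> dual_space \<Longrightarrow> continuous_map X euclidean (\<lambda>x. blinfun_apply \<phi> (f x))"
  shows "continuous_map X weak_topology f"
  unfolding weak_topology_def continuous_on_generated_topo_iff
proof (intro conjI allI impI)
  fix V :: "('b \<Rightarrow>\<^sub>C 'c) set" assume "V \<in> {blinfun_apply \<phi> -` U |\<phi> U. \<phi> \<in> dual_space \<and> open U}"
  then obtain \<phi> U where "V = blinfun_apply \<phi> -` U" "\<phi> \<in> dual_space" "open U" by blast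
  then show "openin X (f -` V \<inter> topspace X)"
    using assms[of \<phi>] by (auto simp: continuous_map_def vimage_def Collect_conj_eq Int_commute)
next
  show "f ` topspace X \<subseteq> \<Union> {blinfun_apply \<phi> -` U |\<phi> U. \<phi> \<in> dual_space \<and> open U}"
    using topspace_weak_topology[where 'a = 'b and 'b = 'c]
    unfolding weak_topology_def topology_generated_by_topspace by (metis subset_UNIV)
qed

text \<open>
  Point evaluations belong to the dual space and separate functions.
\<close>

lemma Hausdorff_space_weak_topology: "Hausdorff_space weak_topology"
  unfolding Hausdorff_space_def
proof (intro allI impI)
  fix f g :: "'a \<Rightarrow>\<^sub>C 'b" assume "f \<in> topspace weak_topology \<and> g \<in> topspace weak_topology \<and> f \<noteq> g"
  then obtain x where "apply_bcontfun f x \<noteq> apply_bcontfun g x" by (metis bcontfun_eqI)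
  then obtain U V where UV: "open U" "open V" "apply_bcontfun f x \<in> U" "apply_bcontfun g x \<in> V" "U \<inter> V = {}"
    by (meson hausdorff)
  have "openin weak_topology (blinfun_apply (point_evaluation x :: ('a \<Rightarrow>\<^sub>C 'b) \<Rightarrow>\<^sub>L 'b) -` W)" if "open W" for W
    using continuous_map_weak_topology[OF point_evaluation_in_dual_space] that
    by (auto simp: continuous_map_def vimage_def)
  then show "\<exists>U V. openin weak_topology U \<and> openin weak_topology V \<and> f \<in> U \<and> g \<in> V \<and> disjnt U V"
    using UV
    by (intro exI[of _ "blinfun_apply (point_evaluation x :: ('a \<Rightarrow>\<^sub>C 'b) \<Rightarrow>\<^sub>L 'b) -` U"]
          exI[of _ "blinfun_apply (point_evaluation x :: ('a \<Rightarrow>\<^sub>C 'b) \<Rightarrow>\<^sub>L 'b) -` V"])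
      (auto simp: disjnt_def)
qed

text \<open>
  As the weak topology is Hausdorff, the closure of the image of the ball can be replaced by
  any compact superset; this is what makes the ideal properties below direct.
\<close>

lemma weakly_compact_operators_iff:
  "T \<in> weakly_compact_operators \<longleftrightarrow>
     T \<in> bounded_operators \<and> (\<exists>K. compactin weak_topology K \<and> blinfun_apply T ` cball 0 1 \<subseteq> K)"
    (is "?L \<longleftrightarrow> ?R")
proof
  assume ?L
  then show ?R
    unfolding weakly_compact_operators_def
    using closure_of_subset[of "blinfun_apply T ` cball 0 1" weak_topology] by auto
next
  assume ?R
  then obtain K where K: "T \<in> bounded_operators" "compactin weak_topology K"
    "blinfun_apply T ` cball 0 1 \<subseteq> K" by blast
  then have "closedin weak_topology K"
    using compactin_imp_closedin Hausdorff_space_weak_topology by blast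
  then have "weak_topology closure_of (blinfun_apply T ` cball 0 1) \<subseteq> K"
    by (rule closure_of_minimal[OF K(3)])
  then show ?L
    using K closed_compactin[OF K(2)] by (auto simp: weakly_compact_operators_def)
qed

lemma scale_bcontfun_simps:
  "scale_bcontfun c (f + g) = scale_bcontfun c f + scale_bcontfun c g"
  "scale_bcontfun c (- f) = - scale_bcontfun c f"
  "scale_bcontfun c 0 = 0"
  "scale_bcontfun c (f - g) = scale_bcontfun c f - scale_bcontfun c g"
  "scale_bcontfun c (scale_bcontfun d f) = scale_bcontfun (c * d) f"
  by (auto intro!: bcontfun_eqI simp: algebra_simps)

lemma bounded_operators_closed:
  "0 \<in> bounded_operators" "id_blinfun \<in> bounded_operators"
  "S \<in> bounded_operators \<Longrightarrow> T \<in> bounded_operators \<Longrightarrow> S + T \<in> bounded_operators"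
  "T \<in> bounded_operators \<Longrightarrow> - T \<in> bounded_operators"
  "S \<in> bounded_operators \<Longrightarrow> T \<in> bounded_operators \<Longrightarrow> S - T \<in> bounded_operators"
  "S \<in> bounded_operators \<Longrightarrow> T \<in> bounded_operators \<Longrightarrow> S o\<^sub>L T \<in> bounded_operators"
  by (auto simp: bounded_operators_def scale_bcontfun_simps blinfun.add_left blinfun.minus_left
      blinfun.diff_left)

lemma compose_in_dual_space:
  "\<phi> \<in> dual_space \<Longrightarrow> T \<in> bounded_operators \<Longrightarrow> \<phi> o\<^sub>L T \<in> dual_space"
  by (simp add: dual_space_def bounded_operators_def)

lemma continuous_map_weak_bounded_operator:
  assumes "T \<in> bounded_operators"
  shows "continuous_map weak_topology weak_topology (blinfun_apply T)"
proof (rule continuous_map_into_weak_topology)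
  fix \<phi> :: "('a \<Rightarrow>\<^sub>C 'b) \<Rightarrow>\<^sub>L 'b" assume "\<phi> \<in> dual_space"
  from continuous_map_weak_topology[OF compose_in_dual_space[OF this assms]]
  show "continuous_map weak_topology euclidean (\<lambda>x. blinfun_apply \<phi> (blinfun_apply T x))"
    by (simp add: blinfun_apply_blinfun_compose[abs_def])
qed

lemma weakly_compact_operators_zero: "0 \<in> weakly_compact_operators"
  unfolding weakly_compact_operators_iff
  by (auto simp: bounded_operators_closed intro!: exI[of _ "{0}"])

lemma weakly_compact_operators_add:
  assumes "S \<in> weakly_compact_operators" "T \<in> weakly_compact_operators"
  shows "S + T \<in> weakly_compact_operators"
proof -
  obtain K1 K2 where K: "compactin weak_topology K1" "blinfun_apply S ` cball 0 1 \<subseteq> K1"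
    "compactin weak_topology K2" "blinfun_apply T ` cball 0 1 \<subseteq> K2"
    using assms unfolding weakly_compact_operators_iff by blast
  have "continuous_map (prod_topology weak_topology weak_topology) weak_topology
      (\<lambda>p. fst p + snd p :: 'a \<Rightarrow>\<^sub>C 'b)"
  proof (rule continuous_map_into_weak_topology)
    fix \<phi> :: "('a \<Rightarrow>\<^sub>C 'b) \<Rightarrow>\<^sub>L 'b" assume "\<phi> \<in> dual_space"
    note * = continuous_map_weak_topology[OF this]
    have "continuous_map (prod_topology weak_topology weak_topology) euclidean
        (\<lambda>p. blinfun_apply \<phi> (fst p) + blinfun_apply \<phi> (snd p))"
      using continuous_map_compose[OF continuous_map_fst *] continuous_map_compose[OF continuous_map_snd *]
      by (intro continuous_map_add) (simp_all add: o_def)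
    then show "continuous_map (prod_topology weak_topology weak_topology) euclidean
        (\<lambda>p. blinfun_apply \<phi> (fst p + snd p))"
      by (simp add: blinfun.add_right)
  qed
  from image_compactin[OF _ this, of "K1 \<times> K2"] K
  have "compactin weak_topology ((\<lambda>p. fst p + snd p) ` (K1 \<times> K2))"
    by (simp add: compactin_Times)
  moreover have "blinfun_apply (S + T) ` cball 0 1 \<subseteq> (\<lambda>p. fst p + snd p) ` (K1 \<times> K2)"
  proof
    fix y assume "y \<in> blinfun_apply (S + T) ` cball 0 1"
    then obtain f where "f \<in> cball 0 1" "y = blinfun_apply S f + blinfun_apply T f"
      by (auto simp: blinfun.add_left)
    then show "y \<in> (\<lambda>p. fst p + snd p) ` (K1 \<times> K2)"
      using K by (intro image_eqI[of _ _ "(blinfun_apply S f, blinfun_apply T f)"]) auto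
  qed
  ultimately show ?thesis
    using assms unfolding weakly_compact_operators_iff by (blast intro: bounded_operators_closed)
qed

lemma weakly_compact_operators_compose_left:
  assumes "S \<in> bounded_operators" "T \<in> weakly_compact_operators"
  shows "S o\<^sub>L T \<in> weakly_compact_operators"
proof -
  obtain K where K: "compactin weak_topology K" "blinfun_apply T ` cball 0 1 \<subseteq> K"
    using assms unfolding weakly_compact_operators_iff by blast
  have "compactin weak_topology (blinfun_apply S ` K)"
    by (rule image_compactin[OF K(1) continuous_map_weak_bounded_operator[OF assms(1)]])
  moreover have "blinfun_apply (S o\<^sub>L T) ` cball 0 1 \<subseteq> blinfun_apply S ` K"
    using K(2) by auto
  ultimately show ?thesis
    using assms unfolding weakly_compact_operators_iff by (blast intro: bounded_operators_closed)
qed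

lemma weakly_compact_operators_compose_right:
  assumes "S \<in> bounded_operators" "T \<in> weakly_compact_operators"
  shows "T o\<^sub>L S \<in> weakly_compact_operators"
proof -
  obtain K where K: "compactin weak_topology K" "blinfun_apply T ` cball 0 1 \<subseteq> K"
    using assms unfolding weakly_compact_operators_iff by blast
  define t where "t = norm S + 1"
  have t: "t > 0" "norm S \<le> t" by (simp_all add: t_def add_nonneg_pos)
  have "continuous_map weak_topology weak_topology ((*\<^sub>R) t :: ('a \<Rightarrow>\<^sub>C 'b) \<Rightarrow> _)"
  proof (rule continuous_map_into_weak_topology)
    fix \<phi> :: "('a \<Rightarrow>\<^sub>C 'b) \<Rightarrow>\<^sub>L 'b" assume "\<phi> \<in> dual_space"
    from continuous_map_compose[OF continuous_map_weak_topology[OF this], of euclidean "(*\<^sub>R) t"]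
    show "continuous_map weak_topology euclidean (\<lambda>x. blinfun_apply \<phi> (t *\<^sub>R x))"
      by (simp add: o_def blinfun.scaleR_right continuous_intros)
  qed
  from image_compactin[OF K(1) this]
  have "compactin weak_topology ((*\<^sub>R) t ` K)" .
  moreover have "blinfun_apply (T o\<^sub>L S) ` cball 0 1 \<subseteq> (*\<^sub>R) t ` K"
  proof
    fix y assume "y \<in> blinfun_apply (T o\<^sub>L S) ` cball 0 1"
    then obtain f where f: "norm f \<le> 1" "y = blinfun_apply T (blinfun_apply S f)" by auto
    have "norm (blinfun_apply S f) \<le> norm S * norm f" by (rule norm_blinfun)
    also have "\<dots> \<le> t * 1" using f t by (intro mult_mono) auto
    finally have "norm ((1/t) *\<^sub>R blinfun_apply S f) \<le> 1" using t by (simp add: field_simps)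
    then have "blinfun_apply T ((1/t) *\<^sub>R blinfun_apply S f) \<in> K" using K(2) by auto
    moreover have "y = t *\<^sub>R blinfun_apply T ((1/t) *\<^sub>R blinfun_apply S f)"
      using f t by (simp add: blinfun.scaleR_right)
    ultimately show "y \<in> (*\<^sub>R) t ` K" by blast
  qed
  ultimately show ?thesis
    using assms unfolding weakly_compact_operators_iff by (blast intro: bounded_operators_closed)
qed

lemma ring_operator_algebra:
  "ring (operator_algebra :: ('k::real_normed_field, ('l::topological_space, 'k) operator) module)"
proof (rule ringI)
  show "abelian_group (operator_algebra :: ('k, ('l, 'k) operator) module)"
  proof (rule abelian_groupI)
    fix T :: "('l, 'k) operator" assume "T \<in> carrier operator_algebra"
    then show "\<exists>S\<in>carrier operator_algebra. S \<oplus>\<^bsub>operator_algebra\<^esub> T = \<zero>\<^bsub>operator_algebra\<^esub>"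
      by (intro bexI[of _ "- T"]) (auto simp: operator_algebra_def bounded_operators_closed)
  qed (auto simp: operator_algebra_def bounded_operators_closed add_ac)
  show "Group.monoid (operator_algebra :: ('k, ('l, 'k) operator) module)"
    by (rule monoidI) (auto simp: operator_algebra_def bounded_operators_closed 
        intro!: blinfun_eqI)
qed (auto simp: operator_algebra_def blinfun.add_left blinfun.add_right intro!: blinfun_eqI)

lemma ideal_weakly_compact_operators:
  "ideal weakly_compact_operators
     (operator_algebra :: ('k::real_normed_field, ('l::topological_space, 'k) operator) module)"
proof (rule idealI[OF ring_operator_algebra])
  interpret ring "operator_algebra :: ('k, ('l, 'k) operator) module"
    by (rule ring_operator_algebra)
  have minus: "\<ominus>\<^bsub>operator_algebra\<^esub> T = - T" if "T \<in> bounded_operators" for T :: "('l, 'k) operator"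
    by (rule minus_equality) (use that in \<open>auto simp: operator_algebra_def bounded_operators_closed\<close>)
  have sub: "weakly_compact_operators \<subseteq> (bounded_operators :: ('l, 'k) operator set)"
    by (auto simp: weakly_compact_operators_def)
  show "subgroup weakly_compact_operators (add_monoid (operator_algebra :: ('k, ('l, 'k) operator) module))"
  proof (rule group.subgroupI)
    show "Group.group (add_monoid (operator_algebra :: ('k, ('l, 'k) operator) module))"
      by (rule a_group)
    show "inv\<^bsub>add_monoid operator_algebra\<^esub> T \<in> weakly_compact_operators"
      if "T \<in> weakly_compact_operators" for T :: "('l, 'k) operator"
      using minus[of T] that sub uminus_weakly_compact_operators[OF that]
      by (auto simp: a_inv_def)
    show "weakly_compact_operators \<noteq> ({} :: ('l, 'k) operator set)"
      using weakly_compact_operators_zero by blast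
  qed (use sub in \<open>auto simp: operator_algebra_def weakly_compact_operators_add\<close>)
qed (auto simp: operator_algebra_def weakly_compact_operators_compose_left
    weakly_compact_operators_compose_right)

section \<open>A Hilbertian criterion for weak compactness\<close>

text \<open>
  The uniform limit of continuous functions is continuous on an arbitrary topological domain.
\<close>

lemma Cauchy_bcontfun_converges:
  fixes u :: "nat \<Rightarrow> ('l::topological_space \<Rightarrow>\<^sub>C 'b::complete_space)"
  assumes "Cauchy u"
  obtains y where "u \<longlonglongrightarrow> y"
proof -
  obtain g where "uniform_limit UNIV u g sequentially"
    using uniformly_convergent_eq_cauchy[of "\<lambda>_. True" u] assms
    unfolding Cauchy_def uniform_limit_sequentially_iff
    by (metis dist_fun_lt_imp_dist_val_lt)
  from uniform_limit_bcontfunE[OF this sequentially_bot] that show thesis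
    by metis
qed

text \<open>
  A form of Tychonoff's theorem. The weak closure of the image of the ball sits inside the
  product of one copy of the scalar field for each functional, where its closure \<open>Z\<close> is
  compact. So only points of \<open>Z\<close> that do not come from \<open>C(L)\<close> could destroy compactness; the
  hypothesis \<open>represented\<close> excludes them.
\<close>

lemma weakly_compactI:
  fixes T :: "('l::topological_space, 'k::{real_normed_field, heine_borel}) operator"
  assumes T: "T \<in> bounded_operators"
    and represented: "\<And>z. (\<And>F \<epsilon>. finite F \<Longrightarrow> F \<subseteq> dual_space \<Longrightarrow> \<epsilon> > 0 \<Longrightarrow>
        \<exists>f\<in>cball 0 1. \<forall>\<phi>\<in>F. norm (blinfun_apply \<phi> (blinfun_apply T f) - z \<phi>) \<le> \<epsilon>) \<Longrightarrow>
      \<exists>y. \<forall>\<phi>\<in>dual_space. blinfun_apply \<phi> y = z \<phi>"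
  shows "T \<in> weakly_compact_operators"
proof -
  define P :: "((('l \<Rightarrow>\<^sub>C 'k) \<Rightarrow>\<^sub>L 'k) \<Rightarrow> 'k) topology"
    where "P = product_topology (\<lambda>_. euclidean) dual_space"
  define e :: "('l \<Rightarrow>\<^sub>C 'k) \<Rightarrow> (('l \<Rightarrow>\<^sub>C 'k) \<Rightarrow>\<^sub>L 'k) \<Rightarrow> 'k"
    where "e y = restrict (\<lambda>\<phi>. blinfun_apply \<phi> y) dual_space" for y
  define Z where "Z = P closure_of (e ` blinfun_apply T ` cball 0 1)"
  define B where "B = PiE (dual_space :: (('l \<Rightarrow>\<^sub>C 'k) \<Rightarrow>\<^sub>L 'k) set) (\<lambda>\<phi>. cball (0 :: 'k) (norm \<phi> * norm T))"
  have "compactin P B"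
    unfolding P_def B_def by (simp add: compactin_PiE)
  moreover have "closedin P B"
    unfolding P_def B_def by (simp add: closedin_product_topology)
  moreover have "e (blinfun_apply T f) \<in> B" if "f \<in> cball 0 1" for f
  proof -
    have "norm (blinfun_apply \<phi> (blinfun_apply T f)) \<le> norm \<phi> * norm T" for \<phi> :: "('l \<Rightarrow>\<^sub>C 'k) \<Rightarrow>\<^sub>L 'k"
    proof -
      have "norm (blinfun_apply \<phi> (blinfun_apply T f)) \<le> norm \<phi> * norm (blinfun_apply T f)"
        by (rule norm_blinfun)
      also have "norm (blinfun_apply T f) \<le> norm T * norm f"
        by (rule norm_blinfun)
      also have "norm T * norm f \<le> norm T * 1"
        using that by (intro mult_left_mono) auto
      finally show ?thesis by (simp add: mult_left_mono)
    qed
    then show ?thesis by (auto simp: e_def B_def)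
  qed
  ultimately have "Z \<subseteq> B"
    unfolding Z_def by (intro closure_of_minimal) auto
  with \<open>compactin P B\<close> have Z_compact: "compactin P Z"
    by (rule closed_compactin) (simp add: Z_def)
  have "\<exists>y. e y = z" if z: "z \<in> Z" for z
  proof -
    have "\<exists>f\<in>cball 0 1. \<forall>\<phi>\<in>F. norm (blinfun_apply \<phi> (blinfun_apply T f) - z \<phi>) \<le> \<epsilon>"
      if F: "finite F" "F \<subseteq> dual_space" and "\<epsilon> > 0" for F \<epsilon>
    proof -
      let ?U = "PiE dual_space (\<lambda>\<phi>. if \<phi> \<in> F then ball (z \<phi>) \<epsilon> else UNIV)"
      have "{\<phi> \<in> dual_space. (if \<phi> \<in> F then ball (z \<phi>) \<epsilon> else UNIV) \<noteq> UNIV} \<subseteq> F"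
        by auto
      then have "openin P ?U"
        unfolding P_def openin_PiE_gen using F finite_subset by auto
      moreover have "z \<in> ?U"
        using z \<open>\<epsilon> > 0\<close> \<open>Z \<subseteq> B\<close> by (auto simp: B_def PiE_iff)
      ultimately obtain f where f: "f \<in> cball 0 1" "e (blinfun_apply T f) \<in> ?U"
        using z unfolding Z_def in_closure_of by blast
      have "norm (blinfun_apply \<phi> (blinfun_apply T f) - z \<phi>) \<le> \<epsilon>" if "\<phi> \<in> F" for \<phi>
      proof -
        have "blinfun_apply \<phi> (blinfun_apply T f) \<in> ball (z \<phi>) \<epsilon>"
          using f(2) that F(2) by (force simp: e_def PiE_iff)
        then show ?thesis by (simp add: dist_norm norm_minus_commute)
      qed
      with f(1) show ?thesis by blast
    qed
    then obtain y where "\<forall>\<phi>\<in>dual_space. blinfun_apply \<phi> y = z \<phi>"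
      using represented[of z] by blast
    moreover have "z \<in> extensional dual_space"
      using z \<open>Z \<subseteq> B\<close> by (auto simp: B_def PiE_iff)
    ultimately have "e y = z"
      by (auto simp: e_def extensional_def)
    then show ?thesis ..
  qed
  then obtain g where g: "\<And>z. z \<in> Z \<Longrightarrow> e (g z) = z" by metis
  have e_apply: "blinfun_apply \<phi> y = e y \<phi>" if "\<phi> \<in> dual_space" for \<phi> y
    using that by (simp add: e_def)
  have "continuous_map (subtopology P Z) weak_topology g"
  proof (rule continuous_map_into_weak_topology)
    fix \<phi> :: "('l \<Rightarrow>\<^sub>C 'k) \<Rightarrow>\<^sub>L 'k" assume \<phi>: "\<phi> \<in> dual_space"
    have "continuous_map (subtopology P Z) euclidean (\<lambda>z. z \<phi>)"
      unfolding P_def using \<phi>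
      by (intro continuous_map_from_subtopology continuous_map_product_projection)
    then show "continuous_map (subtopology P Z) euclidean (\<lambda>z. blinfun_apply \<phi> (g z))"
      by (rule continuous_map_eq) (simp add: e_apply[OF \<phi>] g)
  qed
  moreover have "compactin (subtopology P Z) Z"
    using Z_compact by (simp add: compactin_subtopology)
  ultimately have "compactin weak_topology (g ` Z)"
    by (rule image_compactin[rotated])
  moreover have "blinfun_apply T ` cball 0 1 \<subseteq> g ` Z"
  proof
    fix y assume y: "y \<in> blinfun_apply T ` cball 0 1"
    have "e ` blinfun_apply T ` cball 0 1 \<subseteq> Z"
      unfolding Z_def by (rule closure_of_subset) (auto simp: P_def e_def)
    with y have "e y \<in> Z" by blast
    from g[OF this] have "e (g (e y)) \<phi> = e y \<phi>" for \<phi>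
      by simp
    then have "g (e y) = y"
      using e_apply[OF point_evaluation_in_dual_space] by (intro bcontfun_eqI) (metis apply_point_evaluation)
    with \<open>e y \<in> Z\<close> show "y \<in> g ` Z" by force
  qed
  ultimately show ?thesis
    using T by (auto simp: weakly_compact_operators_iff)
qed

text \<open>
  If \<open>r\<close> is the square of a Hilbert seminorm, nearly minimal elements of a convex set are
  close to each other by the parallelogram law. For a filter base of convex sets, the infima
  of \<open>r\<close> increase to a supremum \<open>D\<close>, and elements with \<open>r\<close> close to \<open>D\<close> in smaller and smaller
  sets form a Cauchy sequence that asymptotically belongs to every member. This plays the role
  of weak compactness of the unit ball of the Hilbert space obtained by completion.
\<close>

lemma asymptotic_minimizers:
  fixes r :: "'v::real_vector \<Rightarrow> real"
  assumes nonneg: "\<And>f. 0 \<le> r f"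
    and parallelogram: "\<And>f g. r (f + g) + r (f - g) = 2 * r f + 2 * r g"
    and half: "\<And>f. r ((1/2) *\<^sub>R f) = r f / 4"
    and ne: "\<A> \<noteq> {}"
    and inter: "\<And>A A'. A \<in> \<A> \<Longrightarrow> A' \<in> \<A> \<Longrightarrow> \<exists>A''\<in>\<A>. A'' \<subseteq> A \<inter> A'"
    and nonempty: "\<And>A. A \<in> \<A> \<Longrightarrow> A \<noteq> {}"
    and midpoint: "\<And>A f g. A \<in> \<A> \<Longrightarrow> f \<in> A \<Longrightarrow> g \<in> A \<Longrightarrow> (1/2) *\<^sub>R (f + g) \<in> A"
    and bounded: "\<And>A f. A \<in> \<A> \<Longrightarrow> f \<in> A \<Longrightarrow> r f \<le> B"
  obtains h where "\<And>n m. n \<le> m \<Longrightarrow> r (h m - h n) \<le> 8 / real (Suc n)"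
    and "\<And>A n. A \<in> \<A> \<Longrightarrow> \<exists>f\<in>A. r (f - h n) \<le> 8 / real (Suc n)"
proof -
  define d where "d A = (INF f\<in>A. r f)" for A
  define D where "D = (SUP A\<in>\<A>. d A)"
  have bdd: "bdd_below (r ` A)" for A
    using nonneg by (auto intro: bdd_belowI[of _ 0])
  have d_le: "d A \<le> r f" if "f \<in> A" for A f
    unfolding d_def by (rule cINF_lower[OF bdd that])
  have d_B: "d A \<le> B" if "A \<in> \<A>" for A
    using nonempty[OF that] d_le bounded[OF that] by (meson ex_in_conv order_trans)
  have bddD: "bdd_above (d ` \<A>)"
    using d_B by (auto intro!: bdd_aboveI[of _ B])
  have d_D: "d A \<le> D" if "A \<in> \<A>" for A
    unfolding D_def by (rule cSUP_upper[OF that bddD])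
  have near: "\<exists>f\<in>A. r f < D + 1 / real (Suc n)" if "A \<in> \<A>" for A n
  proof -
    have "(INF f\<in>A. r f) < D + 1 / real (Suc n)"
      using d_D[OF that] by (auto simp: d_def intro: le_less_trans)
    then show ?thesis
      using cINF_less_iff[OF nonempty[OF that] bdd] by blast
  qed
  have "\<exists>A\<in>\<A>. D - 1 / real (Suc n) < d A" for n
    using less_cSUP_iff[OF ne bddD, of "D - 1 / real (Suc n)"] by (simp add: D_def)
  then obtain A where A: "\<And>n. A n \<in> \<A>" "\<And>n. D - 1 / real (Suc n) < d (A n)" by metis
  \<comment> \<open>The midpoint stays in \<open>A n\<close>, so \<open>r\<close> is at least \<open>D - 1 / Suc n\<close> there, which forces \<open>r (f - g)\<close> to be small.\<close>
  have close: "r (f - g) \<le> 8 / real (Suc n)"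
    if "f \<in> A n" "g \<in> A n" "r f \<le> D + 1 / real (Suc n)" "r g \<le> D + 1 / real (Suc n)" for f g n
  proof -
    define e where "e = 1 / real (Suc n)"
    have "D - e \<le> r ((1/2) *\<^sub>R (f + g))"
      using d_le[OF midpoint[OF A(1) that(1,2)]] A(2)[of n] by (simp add: e_def)
    also have "\<dots> = r (f + g) / 4" by (rule half)
    finally have "r (f - g) \<le> 8 * e"
      using parallelogram[of f g] that(3,4) unfolding e_def[symmetric] by linarith
    then show ?thesis by (simp add: e_def)
  qed
  have "\<exists>C\<in>\<A>. C \<subseteq> (\<Inter>i\<le>n. A i)" for n
  proof (induction n)
    case 0
    then show ?case using A(1) by auto
  next
    case (Suc n)
    then obtain C where "C \<in> \<A>" "C \<subseteq> (\<Inter>i\<le>n. A i)" by blast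
    with inter[OF this(1) A(1)[of "Suc n"]] show ?case
      by (auto simp: atMost_Suc)
  qed
  then obtain C where C: "\<And>n. C n \<in> \<A>" "\<And>n. C n \<subseteq> (\<Inter>i\<le>n. A i)" by metis
  obtain h where h: "\<And>n. h n \<in> C n" "\<And>n. r (h n) < D + 1 / real (Suc n)"
  proof -
    have "\<forall>n. \<exists>f. f \<in> C n \<and> r f < D + 1 / real (Suc n)" using near[OF C(1)] by blast
    then show thesis using that by metis
  qed
  have mem: "h m \<in> A n" if "n \<le> m" for n m
    using h(1)[of m] C(2)[of m] that by blast
  have mono: "D + 1 / real (Suc m) \<le> D + 1 / real (Suc n)" if "n \<le> m" for n m
    using that by (simp add: frac_le)
  show thesis
  proof
    show "r (h m - h n) \<le> 8 / real (Suc n)" if "n \<le> m" for n m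
      using h(2)[of n] h(2)[of m] mono[OF that] by (intro close mem that order_refl) auto
    show "\<exists>f\<in>A'. r (f - h n) \<le> 8 / real (Suc n)" if A': "A' \<in> \<A>" for A' n
    proof -
      obtain A'' where A'': "A'' \<in> \<A>" "A'' \<subseteq> A' \<inter> A n"
        using inter[OF A' A(1)] by blast
      obtain f where "f \<in> A''" "r f < D + 1 / real (Suc n)" using near[OF A''(1)] by blast
      then show ?thesis
        using A''(2) h(2)[of n] by (intro bexI[of _ f] close mem) auto
    qed
  qed
qed

text \<open>
  An operator that is continuous for a Hilbert seminorm factors through a reflexive space and
  is therefore weakly compact. Concretely, a point \<open>z\<close> of the weak-star closure of the image
  determines the filter base of the convex sets of those \<open>f\<close> in the ball whose images
  approximate \<open>z\<close> at finitely many functionals, and the images of its asymptotic minimizers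
  converge in norm to a function that represents \<open>z\<close>.
\<close>

lemma weakly_compact_of_quadratic_domination:
  fixes T :: "('l::topological_space, 'k::{real_normed_field, heine_borel}) operator"
    and r :: "('l \<Rightarrow>\<^sub>C 'k) \<Rightarrow> real"
  assumes T: "T \<in> bounded_operators"
    and nonneg: "\<And>f. 0 \<le> r f"
    and parallelogram: "\<And>f g. r (f + g) + r (f - g) = 2 * r f + 2 * r g"
    and half: "\<And>f. r ((1/2) *\<^sub>R f) = r f / 4"
    and bounded: "\<And>f. f \<in> cball 0 1 \<Longrightarrow> r f \<le> B"
    and dom: "\<And>\<epsilon>. \<epsilon> > 0 \<Longrightarrow> \<exists>\<delta>>0. \<forall>f. r f < \<delta> \<longrightarrow> norm (blinfun_apply T f) < \<epsilon>"
  shows "T \<in> weakly_compact_operators"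
proof (rule weakly_compactI[OF T])
  fix z :: "(('l \<Rightarrow>\<^sub>C 'k) \<Rightarrow>\<^sub>L 'k) \<Rightarrow> 'k"
  assume z: "\<And>F \<epsilon>. finite F \<Longrightarrow> F \<subseteq> dual_space \<Longrightarrow> \<epsilon> > 0 \<Longrightarrow>
      \<exists>f\<in>cball 0 1. \<forall>\<phi>\<in>F. norm (blinfun_apply \<phi> (blinfun_apply T f) - z \<phi>) \<le> \<epsilon>"
  define A where "A F \<epsilon> = {f \<in> cball 0 1. \<forall>\<phi>\<in>F. norm (blinfun_apply \<phi> (blinfun_apply T f) - z \<phi>) \<le> \<epsilon>}"
    for F \<epsilon>
  define \<A> where "\<A> = {A F \<epsilon> | F \<epsilon>. finite F \<and> F \<subseteq> dual_space \<and> \<epsilon> > 0}"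
  obtain h where h: "\<And>n m. n \<le> m \<Longrightarrow> r (h m - h n) \<le> 8 / real (Suc n)"
    "\<And>A n. A \<in> \<A> \<Longrightarrow> \<exists>f\<in>A. r (f - h n) \<le> 8 / real (Suc n)"
  proof (rule asymptotic_minimizers[where \<A> = \<A> and r = r and B = B])
    show "\<A> \<noteq> {}" unfolding \<A>_def by (blast intro: zero_less_one)
    show "\<exists>A''\<in>\<A>. A'' \<subseteq> A1 \<inter> A2" if A12: "A1 \<in> \<A>" "A2 \<in> \<A>" for A1 A2
    proof -
      obtain F1 \<epsilon>1 F2 \<epsilon>2 where
        1: "A1 = A F1 \<epsilon>1" "finite F1" "F1 \<subseteq> dual_space" "\<epsilon>1 > 0" and
        2: "A2 = A F2 \<epsilon>2" "finite F2" "F2 \<subseteq> dual_space" "\<epsilon>2 > 0"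
        using A12 unfolding \<A>_def by blast
      then have "finite (F1 \<union> F2)" "F1 \<union> F2 \<subseteq> dual_space" "min \<epsilon>1 \<epsilon>2 > 0" by auto
      then have "A (F1 \<union> F2) (min \<epsilon>1 \<epsilon>2) \<in> \<A>" unfolding \<A>_def by blast
      moreover have "A (F1 \<union> F2) (min \<epsilon>1 \<epsilon>2) \<subseteq> A1 \<inter> A2" unfolding 1 2 A_def by auto
      ultimately show ?thesis by blast
    qed
    show "A' \<noteq> {}" if "A' \<in> \<A>" for A'
      using that z unfolding \<A>_def A_def by blast
    show "r f \<le> B" if "A' \<in> \<A>" "f \<in> A'" for A' f
      using that bounded unfolding \<A>_def A_def by blast
    show "(1/2) *\<^sub>R (f + g) \<in> A'" if fg: "A' \<in> \<A>" "f \<in> A'" "g \<in> A'" for A' f g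
    proof -
      obtain F \<epsilon> where F: "A' = A F \<epsilon>" using fg(1) unfolding \<A>_def by blast
      have "norm ((1/2) *\<^sub>R (f + g)) \<le> 1"
        using fg norm_triangle_ineq[of f g] by (auto simp: F A_def)
      moreover have "norm (blinfun_apply \<phi> (blinfun_apply T ((1/2) *\<^sub>R (f + g))) - z \<phi>) \<le> \<epsilon>"
        if "\<phi> \<in> F" for \<phi>
      proof -
        have "blinfun_apply \<phi> (blinfun_apply T ((1/2) *\<^sub>R (f + g))) - z \<phi> =
          (1/2) *\<^sub>R ((blinfun_apply \<phi> (blinfun_apply T f) - z \<phi>) + (blinfun_apply \<phi> (blinfun_apply T g) - z \<phi>))"
          by (simp add: blinfun.scaleR_right blinfun.add_right scaleR_conv_of_real field_simps)
        also have "norm \<dots> \<le> (1/2) * (\<epsilon> + \<epsilon>)"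
          unfolding norm_scaleR using \<open>f \<in> A'\<close> \<open>g \<in> A'\<close> that
          by (intro mult_mono norm_triangle_le add_mono) (auto simp: F A_def)
        finally show ?thesis by simp
      qed
      ultimately show ?thesis by (simp add: F A_def)
    qed
  qed (use nonneg parallelogram half in auto)
  have lim: "\<exists>N. \<forall>n\<ge>N. 8 / real (Suc n) < \<delta>" if "\<delta> > 0" for \<delta>
  proof -
    have "(\<lambda>n. 8 * inverse (real (Suc n))) \<longlonglongrightarrow> 8 * 0"
      by (intro tendsto_intros LIMSEQ_inverse_real_of_nat)
    then have "\<forall>\<^sub>F n in sequentially. 8 * inverse (real (Suc n)) < \<delta>"
      using that by (intro order_tendstoD(2)) auto
    then show ?thesis by (simp add: eventually_sequentially divide_inverse)
  qed
  have "Cauchy (\<lambda>n. blinfun_apply T (h n))"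
  proof (rule CauchyI')
    fix \<epsilon> :: real assume "\<epsilon> > 0"
    then obtain \<delta> where \<delta>: "\<delta> > 0" "\<And>f. r f < \<delta> \<Longrightarrow> norm (blinfun_apply T f) < \<epsilon>" using dom by blast
    obtain N where N: "\<And>n. n \<ge> N \<Longrightarrow> 8 / real (Suc n) < \<delta>" using lim[OF \<delta>(1)] by blast
    have "dist (blinfun_apply T (h m)) (blinfun_apply T (h n)) < \<epsilon>" if "m \<ge> N" "m < n" for m n
      using \<delta>(2)[of "h n - h m"] h(1)[of m n] N[OF that(1)] that(2)
      by (simp add: dist_norm norm_minus_commute blinfun.diff_right)
    then show "\<exists>M. \<forall>m\<ge>M. \<forall>n>m. dist (blinfun_apply T (h m)) (blinfun_apply T (h n)) < \<epsilon>" by blast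
  qed
  then obtain y where y: "(\<lambda>n. blinfun_apply T (h n)) \<longlonglongrightarrow> y"
    by (rule Cauchy_bcontfun_converges)
  have "blinfun_apply \<phi> y = z \<phi>" if \<phi>: "\<phi> \<in> dual_space" for \<phi>
  proof -
    have "norm (blinfun_apply \<phi> y - z \<phi>) \<le> \<epsilon>" if "\<epsilon> > 0" for \<epsilon>
    proof -
      have "A {\<phi>} \<epsilon> \<in> \<A>" using \<phi> that unfolding \<A>_def by blast
      then obtain f where f: "\<And>n. f n \<in> A {\<phi>} \<epsilon>" "\<And>n. r (f n - h n) \<le> 8 / real (Suc n)"
        using h(2) by metis
      have "(\<lambda>n. blinfun_apply T (f n) - blinfun_apply T (h n)) \<longlonglongrightarrow> 0"
      proof (rule LIMSEQ_I)
        fix e :: real assume "e > 0"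
        then obtain \<delta> where \<delta>: "\<delta> > 0" "\<And>f. r f < \<delta> \<Longrightarrow> norm (blinfun_apply T f) < e" using dom by blast
        obtain N where N: "\<And>n. n \<ge> N \<Longrightarrow> 8 / real (Suc n) < \<delta>" using lim[OF \<delta>(1)] by blast
        have "norm (blinfun_apply T (f n) - blinfun_apply T (h n) - 0) < e" if "n \<ge> N" for n
          using \<delta>(2)[of "f n - h n"] f(2)[of n] N[OF that] by (simp add: blinfun.diff_right)
        then show "\<exists>N. \<forall>n\<ge>N. norm (blinfun_apply T (f n) - blinfun_apply T (h n) - 0) < e" by blast
      qed
      from tendsto_add[OF this y] have "(\<lambda>n. blinfun_apply T (f n)) \<longlonglongrightarrow> y" by simp
      then have "(\<lambda>n. norm (blinfun_apply \<phi> (blinfun_apply T (f n)) - z \<phi>)) \<longlonglongrightarrow> norm (blinfun_apply \<phi> y - z \<phi>)"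
        by (intro tendsto_intros)
      moreover have "\<forall>n. norm (blinfun_apply \<phi> (blinfun_apply T (f n)) - z \<phi>) \<le> \<epsilon>"
        using f(1) by (auto simp: A_def)
      ultimately show ?thesis by (intro LIMSEQ_le_const2) auto
    qed
    from field_le_epsilon[of "norm (blinfun_apply \<phi> y - z \<phi>)" 0] this show ?thesis by simp
  qed
  then show "\<exists>y. \<forall>\<phi>\<in>dual_space. blinfun_apply \<phi> y = z \<phi>" by blast
qed

section \<open>Positive functionals and total variation\<close>

text \<open>
  Only the values on nonnegative continuous functions matter: such a \<open>\<rho>\<close> is the restriction of
  a positive linear functional to the positive cone, that is, integration against a positive
  measure.
\<close>

definition positive_functional :: "(('l::topological_space \<Rightarrow> real) \<Rightarrow> real) \<Rightarrow> bool"
  where "positive_functional \<rho> \<longleftrightarrow>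
    (\<forall>u w. continuous_on UNIV u \<longrightarrow> continuous_on UNIV w \<longrightarrow> (\<forall>x. 0 \<le> u x) \<longrightarrow> (\<forall>x. 0 \<le> w x) \<longrightarrow>
      \<rho> (\<lambda>x. u x + w x) = \<rho> u + \<rho> w) \<and>
    (\<forall>u w. continuous_on UNIV u \<longrightarrow> continuous_on UNIV w \<longrightarrow> (\<forall>x. 0 \<le> u x) \<longrightarrow> (\<forall>x. u x \<le> w x) \<longrightarrow>
      \<rho> u \<le> \<rho> w) \<and>
    (\<forall>t u. continuous_on UNIV u \<longrightarrow> (\<forall>x. 0 \<le> u x) \<longrightarrow> 0 \<le> t \<longrightarrow> \<rho> (\<lambda>x. t * u x) = t * \<rho> u)"

lemma positive_functionalD:
  assumes "positive_functional \<rho>"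
    and "continuous_on UNIV u" "\<And>x. 0 \<le> u x"
  shows "continuous_on UNIV w \<Longrightarrow> (\<And>x. 0 \<le> w x) \<Longrightarrow> \<rho> (\<lambda>x. u x + w x) = \<rho> u + \<rho> w"
    and "continuous_on UNIV w \<Longrightarrow> (\<And>x. u x \<le> w x) \<Longrightarrow> \<rho> u \<le> \<rho> w"
    and "0 \<le> t \<Longrightarrow> \<rho> (\<lambda>x. t * u x) = t * \<rho> u"
    and "0 \<le> \<rho> u"
proof -
  note * = assms(1)[unfolded positive_functional_def]
  show "\<rho> (\<lambda>x. u x + w x) = \<rho> u + \<rho> w" if "continuous_on UNIV w" "\<And>x. 0 \<le> w x"
    using * assms(2,3) that by simp
  show mono: "\<rho> u \<le> \<rho> w" if "continuous_on UNIV w" "\<And>x. u x \<le> w x" for w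
    using * assms(2,3) that by simp
  show scale: "\<rho> (\<lambda>x. t * u x) = t * \<rho> u" if "0 \<le> t" for t
    using * assms(2,3) that by simp
  have "\<rho> (\<lambda>x. 0) = 0" using scale[of 0] by simp
  moreover have "\<rho> (\<lambda>x. 0) \<le> \<rho> u"
    using * assms(2,3) by simp
  ultimately show "0 \<le> \<rho> u" by simp
qed

lemma positive_functional_zero: "positive_functional (\<lambda>u. 0)"
  by (simp add: positive_functional_def)

lemma positive_functional_add:
  "positive_functional \<rho> \<Longrightarrow> positive_functional \<mu> \<Longrightarrow> positive_functional (\<lambda>u. \<rho> u + \<mu> u)"
  unfolding positive_functional_def by (simp add: algebra_simps add_mono)

lemma positive_functional_scale:
  "positive_functional \<rho> \<Longrightarrow> 0 \<le> c \<Longrightarrow> positive_functional (\<lambda>u. c * \<rho> u)"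
  unfolding positive_functional_def by (simp add: algebra_simps mult_left_mono)

lemma real_normed_field_phase:
  fixes z :: "'k::real_normed_field"
  obtains \<theta> where "norm \<theta> = 1" "\<theta> * z = of_real (norm z)"
proof (cases "z = 0")
  case True
  then show thesis using that[of 1] by simp
next
  case False
  then show thesis
    using that[of "of_real (norm z) / z"] by (simp add: norm_divide)
qed

text \<open>
  Integration against the total variation of the measure that represents \<open>\<mu>\<close>.
\<close>

definition variation ::
    "(('l::topological_space \<Rightarrow>\<^sub>C 'k::real_normed_field) \<Rightarrow>\<^sub>L 'k) \<Rightarrow> ('l \<Rightarrow> real) \<Rightarrow> real"
  where "variation \<mu> u = (SUP g\<in>{g. \<forall>x. norm (apply_bcontfun g x) \<le> u x}. norm (blinfun_apply \<mu> g))"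

lemma variation_le:
  assumes "\<And>x. 0 \<le> u x" and "\<And>g. (\<And>x. norm (apply_bcontfun g x) \<le> u x) \<Longrightarrow> norm (blinfun_apply \<mu> g) \<le> b"
  shows "variation \<mu> u \<le> b"
  unfolding variation_def
proof (rule cSUP_least)
  have "0 \<in> {g. \<forall>x. norm (apply_bcontfun g x) \<le> u x}" using assms(1) by simp
  then show "{g. \<forall>x. norm (apply_bcontfun g x) \<le> u x} \<noteq> {}" by blast
qed (use assms(2) in auto)

lemma variation_le_norm:
  fixes \<mu> :: "('l::topological_space \<Rightarrow>\<^sub>C 'k::real_normed_field) \<Rightarrow>\<^sub>L 'k"
  assumes "\<And>x. 0 \<le> u x" "\<And>x. u x \<le> M"
  shows "variation \<mu> u \<le> norm \<mu> * M"
proof (rule variation_le[OF assms(1)])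
  fix g :: "'l \<Rightarrow>\<^sub>C 'k" assume "\<And>x. norm (apply_bcontfun g x) \<le> u x"
  then have "norm g \<le> M" using assms(2) by (meson norm_bound order_trans)
  then show "norm (blinfun_apply \<mu> g) \<le> norm \<mu> * M"
    using norm_blinfun[of \<mu> g] by (meson mult_left_mono norm_ge_zero order_trans)
qed

context stonean
begin

lemma continuous_bounded_above:
  fixes u :: "'l \<Rightarrow> real"
  assumes "continuous_on UNIV u"
  obtains M where "\<And>x. u x \<le> M"
  using bounded_imp_bdd_above[OF bounded_range_continuous[OF assms]] unfolding bdd_above_def by auto

lemma norm_le_variation:
  fixes \<mu> :: "('l \<Rightarrow>\<^sub>C 'k::real_normed_field) \<Rightarrow>\<^sub>L 'k"
  assumes "continuous_on UNIV u" and "\<And>x. norm (apply_bcontfun g x) \<le> u x"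
  shows "norm (blinfun_apply \<mu> g) \<le> variation \<mu> u"
proof -
  obtain M where M: "\<And>x. u x \<le> M" using continuous_bounded_above[OF assms(1)] by blast
  have "norm (blinfun_apply \<mu> g) \<le> norm \<mu> * M" if "\<And>x. norm (apply_bcontfun g x) \<le> u x" for g :: "'l \<Rightarrow>\<^sub>C 'k"
  proof -
    have "norm g \<le> M" using M that by (meson norm_bound order_trans)
    then show ?thesis
      using norm_blinfun[of \<mu> g] by (meson mult_left_mono norm_ge_zero order_trans)
  qed
  then have "bdd_above ((\<lambda>g. norm (blinfun_apply \<mu> g)) ` {g. \<forall>x. norm (apply_bcontfun g x) \<le> u x})"
    by (intro bdd_aboveI[of _ "norm \<mu> * M"]) blast
  then show ?thesis
    unfolding variation_def by (rule cSUP_upper[rotated]) (use assms(2) in simp)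
qed

text \<open>
  Two test functions can be multiplied by phases so that \<open>\<mu>\<close> takes nonnegative real values on
  both, and then they add up.
\<close>

lemma variation_superadditive:
  fixes \<mu> :: "('l \<Rightarrow>\<^sub>C 'k::real_normed_field) \<Rightarrow>\<^sub>L 'k"
  assumes \<mu>: "\<mu> \<in> dual_space"
    and u: "continuous_on UNIV u" "\<And>x. 0 \<le> u x" and w: "continuous_on UNIV w" "\<And>x. 0 \<le> w x"
  shows "variation \<mu> u + variation \<mu> w \<le> variation \<mu> (\<lambda>x. u x + w x)"
proof -
  have *: "norm (blinfun_apply \<mu> f) + norm (blinfun_apply \<mu> g) \<le> variation \<mu> (\<lambda>x. u x + w x)"
    if f: "\<And>x. norm (apply_bcontfun f x) \<le> u x" and g: "\<And>x. norm (apply_bcontfun g x) \<le> w x" for f g :: "'l \<Rightarrow>\<^sub>C 'k"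
  proof -
    obtain \<alpha> where \<alpha>: "norm \<alpha> = 1" "\<alpha> * blinfun_apply \<mu> f = of_real (norm (blinfun_apply \<mu> f))"
      by (rule real_normed_field_phase)
    obtain \<beta> where \<beta>: "norm \<beta> = 1" "\<beta> * blinfun_apply \<mu> g = of_real (norm (blinfun_apply \<mu> g))"
      by (rule real_normed_field_phase)
    have "norm (blinfun_apply \<mu> (scale_bcontfun \<alpha> f + scale_bcontfun \<beta> g)) \<le> variation \<mu> (\<lambda>x. u x + w x)"
      using f g \<alpha>(1) \<beta>(1)
      by (intro norm_le_variation continuous_intros u w) (auto simp: norm_mult intro!: norm_triangle_le add_mono)
    moreover have "blinfun_apply \<mu> (scale_bcontfun \<alpha> f + scale_bcontfun \<beta> g) =
        of_real (norm (blinfun_apply \<mu> f) + norm (blinfun_apply \<mu> g))"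
      using \<mu> \<alpha>(2) \<beta>(2) by (simp add: dual_space_def blinfun.add_right)
    ultimately show ?thesis by (simp del: of_real_add)
  qed
  have "variation \<mu> u \<le> variation \<mu> (\<lambda>x. u x + w x) - variation \<mu> w"
  proof (rule variation_le[OF u(2)])
    fix f :: "'l \<Rightarrow>\<^sub>C 'k" assume f: "\<And>x. norm (apply_bcontfun f x) \<le> u x"
    have "variation \<mu> w \<le> variation \<mu> (\<lambda>x. u x + w x) - norm (blinfun_apply \<mu> f)"
    proof (rule variation_le[OF w(2)])
      fix g :: "'l \<Rightarrow>\<^sub>C 'k" assume g: "\<And>x. norm (apply_bcontfun g x) \<le> w x"
      show "norm (blinfun_apply \<mu> g) \<le> variation \<mu> (\<lambda>x. u x + w x) - norm (blinfun_apply \<mu> f)"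
        using *[OF f g] by simp
    qed
    then show "norm (blinfun_apply \<mu> f) \<le> variation \<mu> (\<lambda>x. u x + w x) - variation \<mu> w" by simp
  qed
  then show ?thesis by simp
qed

text \<open>
  A function bounded by \<open>u + w\<close> is split proportionally to \<open>u\<close> and \<open>w\<close>. The quotient \<open>u / (u +
  w)\<close> need not be continuous at zeros of the denominator; adding a small constant \<open>\<epsilon>\<close> repairs
  this at the price of a third part of norm at most \<open>\<epsilon>\<close>.
\<close>

lemma variation_subadditive:
  fixes \<mu> :: "('l \<Rightarrow>\<^sub>C 'k::real_normed_field) \<Rightarrow>\<^sub>L 'k"
  assumes u: "continuous_on UNIV u" "\<And>x. 0 \<le> u x" and w: "continuous_on UNIV w" "\<And>x. 0 \<le> w x"
  shows "variation \<mu> (\<lambda>x. u x + w x) \<le> variation \<mu> u + variation \<mu> w"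
proof (rule variation_le)
  show "0 \<le> u x + w x" for x using u w by (simp add: add_nonneg_nonneg)
  fix g :: "'l \<Rightarrow>\<^sub>C 'k" assume g: "\<And>x. norm (apply_bcontfun g x) \<le> u x + w x"
  have "norm (blinfun_apply \<mu> g) \<le> variation \<mu> u + variation \<mu> w + e" if "e > 0" for e
  proof -
    define \<epsilon> where "\<epsilon> = e / (norm \<mu> + 1)"
    have "norm \<mu> + 1 > 0" by (simp add: add_nonneg_pos)
    then have \<epsilon>: "\<epsilon> > 0" "norm \<mu> * \<epsilon> \<le> e" using that by (simp_all add: \<epsilon>_def field_simps)
    have pos: "u x + w x + \<epsilon> > 0" for x
      using u(2)[of x] w(2)[of x] \<epsilon>(1) by linarith
    have nz: "of_real (u x) + of_real (w x) + of_real \<epsilon> \<noteq> (0 :: 'k)" for x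
      using pos[of x] by (simp flip: of_real_add)
    define part where "part v = Bcontfun (\<lambda>x. of_real (v x / (u x + w x + \<epsilon>)) * apply_bcontfun g x)" for v
    have part: "apply_bcontfun (part v) x = of_real (v x / (u x + w x + \<epsilon>)) * apply_bcontfun g x"
      if "continuous_on UNIV v" for v x
      unfolding part_def using that pos
      by (subst apply_Bcontfun) (auto intro!: continuous_intros u w simp: nz)
    have norm_part: "norm (apply_bcontfun (part v) x) \<le> v x"
      if "continuous_on UNIV v" "\<And>x. 0 \<le> v x" for v x
    proof -
      have "norm (apply_bcontfun (part v) x) = v x / (u x + w x + \<epsilon>) * norm (apply_bcontfun g x)"
        using that(2)[of x] pos[of x] by (simp add: part[OF that(1)] norm_mult del: of_real_divide)
      also have "\<dots> \<le> v x / (u x + w x + \<epsilon>) * (u x + w x + \<epsilon>)"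
        using that(2)[of x] pos[of x] g[of x] \<epsilon>(1) by (intro mult_left_mono) auto
      also have "\<dots> = v x" using pos[of x] by simp
      finally show ?thesis .
    qed
    have g_eq: "g = part u + part w + part (\<lambda>_. \<epsilon>)"
    proof (rule bcontfun_eqI)
      fix x
      have "apply_bcontfun g x =
          of_real (u x / (u x + w x + \<epsilon>) + w x / (u x + w x + \<epsilon>) + \<epsilon> / (u x + w x + \<epsilon>)) * apply_bcontfun g x"
        using pos[of x] by (simp flip: add_divide_distrib)
      also have "\<dots> = apply_bcontfun (part u + part w + part (\<lambda>_. \<epsilon>)) x"
        using u w by (simp add: part distrib_right del: of_real_divide)
      finally show "apply_bcontfun g x = apply_bcontfun (part u + part w + part (\<lambda>_. \<epsilon>)) x" .
    qed
    have "norm (blinfun_apply \<mu> (part u)) \<le> variation \<mu> u"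
      by (intro norm_le_variation norm_part u)
    moreover have "norm (blinfun_apply \<mu> (part w)) \<le> variation \<mu> w"
      by (intro norm_le_variation norm_part w)
    moreover have "norm (blinfun_apply \<mu> (part (\<lambda>_. \<epsilon>))) \<le> e"
    proof -
      have "norm (part (\<lambda>_. \<epsilon>)) \<le> \<epsilon>"
        using norm_part[of "\<lambda>_. \<epsilon>"] \<epsilon>(1) by (intro norm_bound) simp
      then show ?thesis
        using norm_blinfun[of \<mu> "part (\<lambda>_. \<epsilon>)"] \<epsilon>(2) by (meson mult_left_mono norm_ge_zero order_trans)
    qed
    ultimately show ?thesis
      by (subst g_eq) (auto simp: blinfun.add_right intro!: norm_triangle_le add_mono)
  qed
  then show "norm (blinfun_apply \<mu> g) \<le> variation \<mu> u + variation \<mu> w"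
    by (rule field_le_epsilon)
qed

lemma positive_functional_variation:
  fixes \<mu> :: "('l \<Rightarrow>\<^sub>C 'k::real_normed_field) \<Rightarrow>\<^sub>L 'k"
  assumes "\<mu> \<in> dual_space"
  shows "positive_functional (variation \<mu>)"
  unfolding positive_functional_def
proof (intro conjI allI impI)
  show "variation \<mu> (\<lambda>x. u x + w x) = variation \<mu> u + variation \<mu> w"
    if "continuous_on UNIV u" "continuous_on UNIV w" "\<forall>x. 0 \<le> u x" "\<forall>x. 0 \<le> w x" for u w
    using that variation_superadditive[OF assms, of u w] variation_subadditive[of u w \<mu>]
    by (intro antisym) auto
  show "variation \<mu> u \<le> variation \<mu> w"
    if "continuous_on UNIV u" "continuous_on UNIV w" "\<forall>x. 0 \<le> u x" "\<forall>x. u x \<le> w x" for u w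
    using that by (intro variation_le norm_le_variation) (auto intro: order_trans)
  have le: "variation \<mu> (\<lambda>x. t * u x) \<le> t * variation \<mu> u"
    if u: "continuous_on UNIV u" "\<forall>x. 0 \<le> u x" and t: "0 < t" for t u
  proof (rule variation_le)
    fix g :: "'l \<Rightarrow>\<^sub>C 'k" assume g: "\<And>x. norm (apply_bcontfun g x) \<le> t * u x"
    have "norm (blinfun_apply \<mu> ((1/t) *\<^sub>R g)) \<le> variation \<mu> u"
      using g t by (intro norm_le_variation u(1)) (simp add: field_simps)
    then show "norm (blinfun_apply \<mu> g) \<le> t * variation \<mu> u"
      using t by (simp add: blinfun.scaleR_right field_simps)
  qed (use u t in simp)
  show "variation \<mu> (\<lambda>x. t * u x) = t * variation \<mu> u"
    if u: "continuous_on UNIV u" "\<forall>x. 0 \<le> u x" and "0 \<le> t" for t u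
  proof (cases "t = 0")
    case True
    have "variation \<mu> (\<lambda>x. 0) \<le> norm \<mu> * 0" by (rule variation_le_norm) auto
    moreover have "norm (blinfun_apply \<mu> 0) \<le> variation \<mu> (\<lambda>x. 0)" by (rule norm_le_variation) auto
    ultimately show ?thesis using True by simp
  next
    case False
    then have t: "t > 0" using that by simp
    have "variation \<mu> (\<lambda>x. (1/t) * (t * u x)) \<le> (1/t) * variation \<mu> (\<lambda>x. t * u x)"
      using u t by (intro le) (auto intro!: continuous_intros)
    then show ?thesis
      using le[OF u t] t by (simp add: field_simps)
  qed
qed

text \<open>
  The seminorm \<open>\<rho>(\<bar>f\<bar>)\<close> is of type \<open>L\<^sub>1\<close>, but it is controlled on all of \<open>C(L)\<close> by the Hilbert
  seminorm of \<open>L\<^sub>2(\<rho>)\<close> because \<open>\<rho>(1)\<close> is finite.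
\<close>

lemma weakly_compact_of_positive_domination:
  fixes T :: "('l, 'k::{real_normed_field, euclidean_space}) operator"
  assumes T: "T \<in> bounded_operators" and \<rho>: "positive_functional \<rho>"
    and dom: "\<And>f. norm (blinfun_apply T f) \<le> \<rho> (\<lambda>x. norm (apply_bcontfun f x))"
  shows "T \<in> weakly_compact_operators"
proof (rule weakly_compact_of_quadratic_domination[OF T, where r = "\<lambda>f. \<rho> (\<lambda>x. (norm (apply_bcontfun f x))\<^sup>2)"
      and B = "\<rho> (\<lambda>x. 1)"])
  note [continuous_intros] = continuous_on_apply_bcontfun
  note D = positive_functionalD[OF \<rho>]
  show "0 \<le> \<rho> (\<lambda>x. (norm (apply_bcontfun f x))\<^sup>2)" for f :: "'l \<Rightarrow>\<^sub>C 'k"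
    by (rule D(4)) (auto intro!: continuous_intros)
  show "\<rho> (\<lambda>x. (norm (apply_bcontfun (f + g) x))\<^sup>2) + \<rho> (\<lambda>x. (norm (apply_bcontfun (f - g) x))\<^sup>2) =
    2 * \<rho> (\<lambda>x. (norm (apply_bcontfun f x))\<^sup>2) + 2 * \<rho> (\<lambda>x. (norm (apply_bcontfun g x))\<^sup>2)"
    for f g :: "'l \<Rightarrow>\<^sub>C 'k"
  proof -
    have "\<rho> (\<lambda>x. (norm (apply_bcontfun (f + g) x))\<^sup>2) + \<rho> (\<lambda>x. (norm (apply_bcontfun (f - g) x))\<^sup>2) =
        \<rho> (\<lambda>x. (norm (apply_bcontfun (f + g) x))\<^sup>2 + (norm (apply_bcontfun (f - g) x))\<^sup>2)"
      by (subst D(1)) (auto intro!: continuous_intros)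
    also have "(\<lambda>x. (norm (apply_bcontfun (f + g) x))\<^sup>2 + (norm (apply_bcontfun (f - g) x))\<^sup>2) =
        (\<lambda>x. 2 * (norm (apply_bcontfun f x))\<^sup>2 + 2 * (norm (apply_bcontfun g x))\<^sup>2)"
      by (simp add: power2_norm_eq_inner inner_simps inner_commute fun_eq_iff)
    also have "\<rho> \<dots> = \<rho> (\<lambda>x. 2 * (norm (apply_bcontfun f x))\<^sup>2) + \<rho> (\<lambda>x. 2 * (norm (apply_bcontfun g x))\<^sup>2)"
      by (intro D(1)) (auto intro!: continuous_intros)
    also have "\<dots> = 2 * \<rho> (\<lambda>x. (norm (apply_bcontfun f x))\<^sup>2) + 2 * \<rho> (\<lambda>x. (norm (apply_bcontfun g x))\<^sup>2)"
      by (subst (1 2) D(3)) (auto intro!: continuous_intros)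
    finally show ?thesis .
  qed
  show "\<rho> (\<lambda>x. (norm (apply_bcontfun ((1/2) *\<^sub>R f) x))\<^sup>2) = \<rho> (\<lambda>x. (norm (apply_bcontfun f x))\<^sup>2) / 4"
    for f :: "'l \<Rightarrow>\<^sub>C 'k"
  proof -
    have "(\<lambda>x. (norm (apply_bcontfun ((1/2) *\<^sub>R f) x))\<^sup>2) = (\<lambda>x. (1/4) * (norm (apply_bcontfun f x))\<^sup>2)"
      by (simp add: fun_eq_iff power_divide)
    then show ?thesis by (simp only:) (subst D(3), auto intro!: continuous_intros)
  qed
  show "\<rho> (\<lambda>x. (norm (apply_bcontfun f x))\<^sup>2) \<le> \<rho> (\<lambda>x. 1)" if "f \<in> cball 0 1" for f :: "'l \<Rightarrow>\<^sub>C 'k"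
    using that norm_bounded[of f]
    by (intro D(2)) (auto intro!: continuous_intros simp: power_le_one_iff intro: order_trans)
  show "\<exists>\<delta>>0. \<forall>f. \<rho> (\<lambda>x. (norm (apply_bcontfun f x))\<^sup>2) < \<delta> \<longrightarrow> norm (blinfun_apply T f) < \<epsilon>"
    if "\<epsilon> > 0" for \<epsilon>
  proof -
    \<comment> \<open>The parameter in the inequality \<open>a \<le> t / 2 + a\<^sup>2 / (2 t)\<close>, to be integrated against \<open>\<rho>\<close>.\<close>
    define t where "t = \<epsilon> / (\<rho> (\<lambda>x. 1) + 1)"
    have one: "0 \<le> \<rho> (\<lambda>x. 1)" by (rule D(4)) auto
    then have t: "t > 0" "\<rho> (\<lambda>x. 1) * t \<le> \<epsilon>"
      using that by (simp_all add: t_def field_simps add_nonneg_pos)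
    have "norm (blinfun_apply T f) < \<epsilon>" if f: "\<rho> (\<lambda>x. (norm (apply_bcontfun f x))\<^sup>2) < \<epsilon> * t" for f
    proof -
      have "norm (apply_bcontfun f x) \<le> (t/2) * 1 + (1/(2*t)) * (norm (apply_bcontfun f x))\<^sup>2" for x
      proof -
        have "2 * t * norm (apply_bcontfun f x) \<le> t\<^sup>2 + (norm (apply_bcontfun f x))\<^sup>2"
          by (rule sum_squares_bound)
        then show ?thesis using t(1) by (simp add: field_simps power2_eq_square)
      qed
      then have "\<rho> (\<lambda>x. norm (apply_bcontfun f x)) \<le>
          \<rho> (\<lambda>x. (t/2) * 1 + (1/(2*t)) * (norm (apply_bcontfun f x))\<^sup>2)"
        using t(1) by (intro D(2)) (auto intro!: continuous_intros)
      also have "\<dots> = \<rho> (\<lambda>x. (t/2) * 1) + \<rho> (\<lambda>x. (1/(2*t)) * (norm (apply_bcontfun f x))\<^sup>2)"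
        using t(1) by (intro D(1)) (auto intro!: continuous_intros)
      also have "\<dots> = (t/2) * \<rho> (\<lambda>x. 1) + (1/(2*t)) * \<rho> (\<lambda>x. (norm (apply_bcontfun f x))\<^sup>2)"
        using t(1) by (subst (1 2) D(3)) (auto intro!: continuous_intros)
      also have "\<dots> < \<epsilon>/2 + \<epsilon>/2"
      proof (rule add_le_less_mono)
        show "(t/2) * \<rho> (\<lambda>x. 1) \<le> \<epsilon>/2" using t(2) by (simp add: mult.commute)
        show "(1/(2*t)) * \<rho> (\<lambda>x. (norm (apply_bcontfun f x))\<^sup>2) < \<epsilon>/2"
          using f t(1) by (simp add: field_simps)
      qed
      finally show ?thesis using dom[of f] by simp
    qed
    moreover have "\<epsilon> * t > 0" using that t(1) by simp
    ultimately show ?thesis by blast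
  qed
qed

end

section \<open>The distance to the weakly compact operators\<close>

lemma bounded_operatorI:
  fixes w :: "('l::topological_space \<Rightarrow>\<^sub>C 'k::real_normed_field) \<Rightarrow> ('l \<Rightarrow>\<^sub>C 'k)"
  assumes add: "\<And>f g. w (f + g) = w f + w g"
    and scale: "\<And>c f. w (scale_bcontfun c f) = scale_bcontfun c (w f)"
    and bound: "\<And>f. norm (w f) \<le> B * norm f"
  shows "blinfun_apply (Blinfun w) = w" and "Blinfun w \<in> bounded_operators"
proof -
  have scaleR: "r *\<^sub>R f = scale_bcontfun (of_real r) f" for r and f :: "'l \<Rightarrow>\<^sub>C 'k"
    by (rule bcontfun_eqI) (simp add: scaleR_conv_of_real)
  have "bounded_linear w"
    by (rule bounded_linear_intro[where K = B]) (simp_all add: add scale scaleR bound mult.commute[of _ B])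
  then show "blinfun_apply (Blinfun w) = w"
    by (rule bounded_linear_Blinfun_apply)
  then show "Blinfun w \<in> bounded_operators"
    by (simp add: bounded_operators_def scale)
qed

context stonean
begin

text \<open>
  The decomposition of \<open>T\<close> at the level of real parts: since \<open>U (f, g) = U (f, 0) + U (0, g)\<close>,
  the map \<open>f \<mapsto> U (f, 0)\<close> is bounded by \<open>\<rho>(\<bar>f\<bar>)\<close>, the map \<open>g \<mapsto> U (0, g)\<close> by \<open>c \<parallel>g\<parallel>\<close>, and they
  add up to the real part of \<open>T\<close>.
\<close>

lemma real_part_extension:
  fixes T :: "('l, 'k::real_normed_field) operator" and re :: "'k \<Rightarrow> real"
  assumes re: "bounded_linear re" "\<And>z. re z \<le> norm z"
    and \<rho>: "positive_functional \<rho>" and c: "0 \<le> c"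
    and dom: "\<And>f. norm (blinfun_apply T f) \<le> \<rho> (\<lambda>x. norm (apply_bcontfun f x)) + c * norm f"
  obtains U :: "('l \<Rightarrow>\<^sub>C 'k) \<times> ('l \<Rightarrow>\<^sub>C 'k) \<Rightarrow> ('l \<Rightarrow>\<^sub>C real)"
  where "linear U"
    and "\<And>f g x. apply_bcontfun (U (f, g)) x \<le> \<rho> (\<lambda>x. norm (apply_bcontfun f x)) + c * norm g"
    and "\<And>f x. apply_bcontfun (U (f, f)) x = re (apply_bcontfun (blinfun_apply T f) x)"
proof -
  note D = positive_functionalD[OF \<rho>]
  interpret re: bounded_linear re by (rule re(1))
  define p where "p = (\<lambda>(f :: 'l \<Rightarrow>\<^sub>C 'k, g :: 'l \<Rightarrow>\<^sub>C 'k). \<rho> (\<lambda>x. norm (apply_bcontfun f x)) + c * norm g)"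
  define reT where "reT f = Bcontfun (\<lambda>x. re (apply_bcontfun (blinfun_apply T f) x))" for f
  define G where "G = range (\<lambda>f. ((f, f), reT f))"
  have reT: "apply_bcontfun (reT f) x = re (apply_bcontfun (blinfun_apply T f) x)" for f x
    unfolding reT_def by (subst apply_Bcontfun) (auto intro!: re.continuous_on)
  obtain U where U: "linear U" "\<And>v x. apply_bcontfun (U v) x \<le> p v" "\<And>v y. (v, y) \<in> G \<Longrightarrow> U v = y"
  proof (rule dominated_extension_exists[of p G])
    show "p (u + v) \<le> p u + p v" for u v
    proof -
      obtain f g f' g' where uv: "u = (f, g)" "v = (f', g')" by (cases u, cases v)
      have "\<rho> (\<lambda>x. norm (apply_bcontfun (f + f') x)) \<le>
          \<rho> (\<lambda>x. norm (apply_bcontfun f x) + norm (apply_bcontfun f' x))"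
        by (intro D(2)) (auto intro!: continuous_intros norm_triangle_ineq)
      also have "\<dots> = \<rho> (\<lambda>x. norm (apply_bcontfun f x)) + \<rho> (\<lambda>x. norm (apply_bcontfun f' x))"
        by (intro D(1)) (auto intro!: continuous_intros)
      finally have "\<rho> (\<lambda>x. norm (apply_bcontfun (f + f') x)) \<le> \<dots>" .
      moreover have "c * norm (g + g') \<le> c * norm g + c * norm g'"
        using c mult_left_mono[OF norm_triangle_ineq[of g g'] c] by (simp add: distrib_left)
      ultimately show ?thesis by (simp add: p_def uv)
    qed
    show "p (t *\<^sub>R v) = t * p v" if "0 \<le> t" for t v
    proof -
      obtain f g where v: "v = (f, g)" by (cases v)
      have "\<rho> (\<lambda>x. t * norm (apply_bcontfun f x)) = t * \<rho> (\<lambda>x. norm (apply_bcontfun f x))"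
        using that by (intro D(3)) (auto intro!: continuous_intros)
      then show ?thesis using that by (simp add: p_def v algebra_simps)
    qed
    have "linear (\<lambda>f. ((f, f), reT f))"
      by (intro linearI) (auto intro!: bcontfun_eqI simp: reT blinfun.add_right blinfun.scaleR_right
          re.add re.scaleR)
    then show "subspace G" unfolding G_def by (intro linear_subspace_image subspace_UNIV)
    show "apply_bcontfun y x \<le> p v" if "(v, y) \<in> G" for v y x
    proof -
      obtain f where f: "v = (f, f)" "y = reT f" using \<open>(v, y) \<in> G\<close> by (auto simp: G_def)
      have "apply_bcontfun y x \<le> norm (apply_bcontfun (blinfun_apply T f) x)"
        by (simp add: f reT re(2))
      also have "\<dots> \<le> norm (blinfun_apply T f)" by (rule norm_bounded)
      also have "\<dots> \<le> p v" using dom[of f] by (simp add: p_def f)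
      finally show ?thesis .
    qed
  qed blast
  show thesis
  proof (rule that[OF U(1)])
    show "apply_bcontfun (U (f, g)) x \<le> \<rho> (\<lambda>x. norm (apply_bcontfun f x)) + c * norm g" for f g x
      using U(2)[of "(f, g)" x] by (simp add: p_def)
    show "apply_bcontfun (U (f, f)) x = re (apply_bcontfun (blinfun_apply T f) x)" for f x
      using U(3)[of "(f, f)" "reT f"] by (simp add: G_def reT)
  qed
qed

text \<open>
  The property of the scalar field that is proved separately for the real and the complex
  numbers; all that follows from it treats both fields alike.
\<close>

definition dominated_decompositions :: "'k::real_normed_field itself \<Rightarrow> bool"
  where "dominated_decompositions _ \<longleftrightarrow>
    (\<forall>T\<in>(bounded_operators :: ('l, 'k) operator set). \<forall>\<rho> c. positive_functional \<rho> \<longrightarrow> 0 \<le> c \<longrightarrow>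
      (\<forall>f. norm (blinfun_apply T f) \<le> \<rho> (\<lambda>x. norm (apply_bcontfun f x)) + c * norm f) \<longrightarrow>
      (\<exists>W\<in>bounded_operators. \<forall>f. norm (blinfun_apply W f) \<le> \<rho> (\<lambda>x. norm (apply_bcontfun f x)) \<and>
        norm (blinfun_apply T f - blinfun_apply W f) \<le> c * norm f))"

lemma positive_functional_le_norm:
  assumes \<rho>: "positive_functional \<rho>"
  shows "\<rho> (\<lambda>x::'l. norm (apply_bcontfun f x)) \<le> \<rho> (\<lambda>x. 1) * norm f"
proof -
  note D = positive_functionalD[OF \<rho>]
  have "\<rho> (\<lambda>x. norm (apply_bcontfun f x)) \<le> \<rho> (\<lambda>x. norm f * 1)"
    by (intro D(2)) (auto intro!: continuous_intros norm_bounded)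
  also have "\<dots> = norm f * \<rho> (\<lambda>x. 1)" by (rule D(3)) auto
  finally show ?thesis by (simp add: mult.commute)
qed

lemma dominated_decompositions_real: "dominated_decompositions TYPE(real)"
  unfolding dominated_decompositions_def
proof (intro ballI allI impI)
  fix T :: "('l, real) operator" and \<rho> c
  assume T: "T \<in> bounded_operators" and \<rho>: "positive_functional \<rho>" and c: "0 \<le> c"
    and dom: "\<forall>f. norm (blinfun_apply T f) \<le> \<rho> (\<lambda>x. norm (apply_bcontfun f x)) + c * norm f"
  obtain U where U: "linear U"
    "\<And>f g x. apply_bcontfun (U (f, g)) x \<le> \<rho> (\<lambda>x. norm (apply_bcontfun f x)) + c * norm g"
    "\<And>f x. apply_bcontfun (U (f, f)) x = apply_bcontfun (blinfun_apply T f) x"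
    by (rule real_part_extension[OF bounded_linear_ident _ \<rho> c, of T]) (use dom in auto)
  interpret U: linear U by (rule U(1))
  define w where "w f = U (f, 0)" for f
  have bound: "norm (U (f, g)) \<le> \<rho> (\<lambda>x. norm (apply_bcontfun f x)) + c * norm g" for f g
  proof (rule norm_bound)
    fix x
    have "apply_bcontfun (U (- f, - g)) x = - apply_bcontfun (U (f, g)) x"
      using U.neg[of "(f, g)"] by simp
    then show "norm (apply_bcontfun (U (f, g)) x) \<le> \<rho> (\<lambda>x. norm (apply_bcontfun f x)) + c * norm g"
      using U(2)[of f g x] U(2)[of "- f" "- g" x] by (simp add: abs_le_iff)
  qed
  have w_bound: "norm (w f) \<le> \<rho> (\<lambda>x. norm (apply_bcontfun f x))" for f
    using bound[of f 0] by (simp add: w_def)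
  have scale: "scale_bcontfun r f = r *\<^sub>R f" for r and f :: "'l \<Rightarrow>\<^sub>C real"
    by (rule bcontfun_eqI) simp
  have add: "w (f + g) = w f + w g" for f g
    using U.add[of "(f, 0)" "(g, 0)"] by (simp add: w_def)
  have hom: "w (scale_bcontfun r f) = scale_bcontfun r (w f)" for r f
    using U.scale[of r "(f, 0)"] by (simp add: w_def scale)
  have "norm (w f) \<le> \<rho> (\<lambda>x. 1) * norm f" for f
    using w_bound[of f] positive_functional_le_norm[OF \<rho>, of f] by linarith
  note W = bounded_operatorI[OF add hom this]
  have "norm (blinfun_apply T f - w f) \<le> c * norm f" for f
  proof -
    have "blinfun_apply T f = U (f, f)" by (rule bcontfun_eqI) (simp add: U(3))
    also have "\<dots> = w f + U (0, f)" using U.add[of "(f, 0)" "(0, f)"] by (simp add: w_def)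
    finally show ?thesis
      using bound[of 0 f] positive_functionalD(3)[OF \<rho>, of "\<lambda>x. 0" 0] by simp
  qed
  with w_bound W show "\<exists>W\<in>bounded_operators. \<forall>f.
      norm (blinfun_apply W f) \<le> \<rho> (\<lambda>x. norm (apply_bcontfun f x)) \<and>
      norm (blinfun_apply T f - blinfun_apply W f) \<le> c * norm f"
    by (intro bexI[OF _ W(2)]) simp
qed

text \<open>
  A complex-linear map is recovered from its real part \<open>V\<close> as \<open>V f - \<i> V (\<i> f)\<close>. At a fixed
  point a suitable phase makes the value real and nonnegative, so that a bound invariant under
  phases carries over.
\<close>

lemma complexification_bound:
  fixes V :: "('l \<Rightarrow>\<^sub>C complex) \<Rightarrow> ('l \<Rightarrow>\<^sub>C real)"
  assumes V: "linear V" and bound: "\<And>f. apply_bcontfun (V f) x \<le> N f"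
    and N: "\<And>\<theta> f. norm \<theta> = 1 \<Longrightarrow> N (scale_bcontfun \<theta> f) = N f"
  shows "norm (Complex (apply_bcontfun (V f) x) (- apply_bcontfun (V (scale_bcontfun \<i> f)) x)) \<le> N f"
proof -
  let ?z = "Complex (apply_bcontfun (V f) x) (- apply_bcontfun (V (scale_bcontfun \<i> f)) x)"
  obtain \<theta> where \<theta>: "norm \<theta> = 1" "\<theta> * ?z = of_real (norm ?z)"
    by (rule real_normed_field_phase)
  have "scale_bcontfun \<theta> f = Re \<theta> *\<^sub>R f + Im \<theta> *\<^sub>R scale_bcontfun \<i> f"
    by (rule bcontfun_eqI) (simp add: complex_eq_iff)
  then have "V (scale_bcontfun \<theta> f) = Re \<theta> *\<^sub>R V f + Im \<theta> *\<^sub>R V (scale_bcontfun \<i> f)"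
    using V by (simp add: linear_add linear_scale)
  then have "apply_bcontfun (V (scale_bcontfun \<theta> f)) x = Re (\<theta> * ?z)"
    by simp
  also have "\<dots> = norm ?z" by (subst \<theta>(2)) simp
  finally show ?thesis
    using bound[of "scale_bcontfun \<theta> f"] N[OF \<theta>(1), of f] by simp
qed

lemma dominated_decompositions_complex: "dominated_decompositions TYPE(complex)"
  unfolding dominated_decompositions_def
proof (intro ballI allI impI)
  fix T :: "('l, complex) operator" and \<rho> c
  assume T: "T \<in> bounded_operators" and \<rho>: "positive_functional \<rho>" and c: "0 \<le> c"
    and dom: "\<forall>f. norm (blinfun_apply T f) \<le> \<rho> (\<lambda>x. norm (apply_bcontfun f x)) + c * norm f"
  obtain U where U: "linear U"
    "\<And>f g x. apply_bcontfun (U (f, g)) x \<le> \<rho> (\<lambda>x. norm (apply_bcontfun f x)) + c * norm g"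
    "\<And>f x. apply_bcontfun (U (f, f)) x = Re (apply_bcontfun (blinfun_apply T f) x)"
    using real_part_extension[OF bounded_linear_Re complex_Re_le_cmod \<rho> c, of T] dom by auto
  have U_add: "U (f + f', g + g') = U (f, g) + U (f', g')" for f f' g g'
    using linear_add[OF U(1), of "(f, g)" "(f', g')"] by simp
  have U_scale: "U (r *\<^sub>R f, r *\<^sub>R g) = r *\<^sub>R U (f, g)" for r f g
    using linear_scale[OF U(1), of r "(f, g)"] by simp
  define C where "C V f = Bcontfun (\<lambda>x. Complex (apply_bcontfun (V f) x)
      (- apply_bcontfun (V (scale_bcontfun \<i> f)) x))"
    for V :: "('l \<Rightarrow>\<^sub>C complex) \<Rightarrow> ('l \<Rightarrow>\<^sub>C real)" and f
  have C: "apply_bcontfun (C V f) x = Complex (apply_bcontfun (V f) x)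
      (- apply_bcontfun (V (scale_bcontfun \<i> f)) x)" for V f x
    unfolding C_def Complex_eq by (subst apply_Bcontfun) (auto intro!: continuous_intros)
  define w where "w = C (\<lambda>f. U (f, 0))"
  define v where "v = C (\<lambda>f. U (0, f))"
  have lin1: "linear (\<lambda>f. U (f, 0))"
    using U_add[of _ _ 0 0] U_scale[of _ _ 0] by (intro linearI) auto
  have lin2: "linear (\<lambda>f. U (0, f))"
    using U_add[of 0 0] U_scale[of _ 0] by (intro linearI) auto
  have \<rho>0: "\<rho> (\<lambda>x. 0) = 0"
    using positive_functionalD(3)[OF \<rho>, of "\<lambda>x. 0" 0] by simp
  have w_bound: "norm (w f) \<le> \<rho> (\<lambda>x. norm (apply_bcontfun f x))" for f
  proof (rule norm_bound)
    show "norm (apply_bcontfun (w f) x) \<le> \<rho> (\<lambda>x. norm (apply_bcontfun f x))" for x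
      unfolding w_def C
      by (rule complexification_bound[OF lin1]) (use U(2)[of _ 0] in \<open>auto simp: norm_mult\<close>)
  qed
  have v_bound: "norm (v f) \<le> c * norm f" for f
  proof (rule norm_bound)
    have norm_scale: "norm (scale_bcontfun \<theta> f) = norm f" if "norm \<theta> = 1" for \<theta> and f :: "'l \<Rightarrow>\<^sub>C complex"
    proof (rule antisym)
      show "norm (scale_bcontfun \<theta> f) \<le> norm f"
        using norm_scale_bcontfun_le[of \<theta> f] that by simp
      have "norm (scale_bcontfun (inverse \<theta>) (scale_bcontfun \<theta> f)) \<le> norm (scale_bcontfun \<theta> f)"
        using norm_scale_bcontfun_le[of "inverse \<theta>" "scale_bcontfun \<theta> f"] that by (simp add: norm_inverse)
      moreover have "scale_bcontfun (inverse \<theta>) (scale_bcontfun \<theta> f) = f"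
        using that by (intro bcontfun_eqI) (auto simp: field_simps)
      ultimately show "norm f \<le> norm (scale_bcontfun \<theta> f)" by simp
    qed
    show "norm (apply_bcontfun (v f) x) \<le> c * norm f" for x
      unfolding v_def C
      by (rule complexification_bound[OF lin2]) (use U(2)[of 0] in \<open>auto simp: norm_scale \<rho>0\<close>)
  qed
  have add: "w (f + g) = w f + w g" for f g
    using linear_add[OF lin1]
    by (intro bcontfun_eqI) (simp add: w_def C scale_bcontfun_simps complex_eq_iff)
  have hom: "w (scale_bcontfun z f) = scale_bcontfun z (w f)" for z f
  proof (rule bcontfun_eqI)
    fix x
    have "scale_bcontfun z f = Re z *\<^sub>R f + Im z *\<^sub>R scale_bcontfun \<i> f"
      "scale_bcontfun \<i> (scale_bcontfun z f) = Re z *\<^sub>R scale_bcontfun \<i> f - Im z *\<^sub>R f"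
      by (auto intro!: bcontfun_eqI simp: complex_eq_iff)
    then have "U (scale_bcontfun z f, 0) = Re z *\<^sub>R U (f, 0) + Im z *\<^sub>R U (scale_bcontfun \<i> f, 0)"
      "U (scale_bcontfun \<i> (scale_bcontfun z f), 0) = Re z *\<^sub>R U (scale_bcontfun \<i> f, 0) - Im z *\<^sub>R U (f, 0)"
      using lin1 by (simp_all add: linear_add[OF lin1] linear_diff[OF lin1] linear_scale[OF lin1])
    then show "apply_bcontfun (w (scale_bcontfun z f)) x = apply_bcontfun (scale_bcontfun z (w f)) x"
      by (simp add: w_def C complex_eq_iff)
  qed
  have "norm (w f) \<le> \<rho> (\<lambda>x. 1) * norm f" for f
    using w_bound[of f] positive_functional_le_norm[OF \<rho>, of f] by linarith
  note W = bounded_operatorI[OF add hom this]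
  have "norm (blinfun_apply T f - w f) \<le> c * norm f" for f
  proof -
    have "blinfun_apply T (scale_bcontfun \<i> f) = scale_bcontfun \<i> (blinfun_apply T f)"
      using T by (simp add: bounded_operators_def)
    then have "apply_bcontfun (blinfun_apply T f) x = apply_bcontfun (w f + v f) x" for x
      using U(3)[of f x] U(3)[of "scale_bcontfun \<i> f" x] U_add[of f 0 0 f]
        U_add[of "scale_bcontfun \<i> f" 0 0 "scale_bcontfun \<i> f"]
      by (simp add: w_def v_def C complex_eq_iff)
    then have "blinfun_apply T f = w f + v f" by (rule bcontfun_eqI)
    then show ?thesis using v_bound[of f] by simp
  qed
  with w_bound W show "\<exists>W\<in>bounded_operators. \<forall>f.
      norm (blinfun_apply W f) \<le> \<rho> (\<lambda>x. norm (apply_bcontfun f x)) \<and>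
      norm (blinfun_apply T f - blinfun_apply W f) \<le> c * norm f"
    by (intro bexI[OF _ W(2)]) simp
qed

text \<open>
  The distance formula in contrapositive form: an operator farther than \<open>c\<close> from \<open>\<W>\<close> cannot be
  dominated by \<open>\<rho>(\<bar>f\<bar>) + c \<parallel>f\<parallel>\<close> for any positive functional.
\<close>

lemma exceeds_positive_functional:
  fixes T :: "('l, 'k::{real_normed_field, euclidean_space}) operator"
  assumes dec: "dominated_decompositions TYPE('k)" and T: "T \<in> bounded_operators" and c: "0 \<le> c"
    and far: "\<forall>W\<in>weakly_compact_operators. c < norm (T - W)"
    and \<rho>: "positive_functional \<rho>"
  obtains f where "\<rho> (\<lambda>x. norm (apply_bcontfun f x)) + c * norm f < norm (blinfun_apply T f)"
proof -
  have "\<exists>f. \<rho> (\<lambda>x. norm (apply_bcontfun f x)) + c * norm f < norm (blinfun_apply T f)"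
  proof (rule ccontr)
    assume "\<not> ?thesis"
    then have "\<forall>f. norm (blinfun_apply T f) \<le> \<rho> (\<lambda>x. norm (apply_bcontfun f x)) + c * norm f"
      by (simp add: not_less)
    then obtain W where W: "W \<in> bounded_operators"
      "\<And>f. norm (blinfun_apply W f) \<le> \<rho> (\<lambda>x. norm (apply_bcontfun f x))"
      "\<And>f. norm (blinfun_apply T f - blinfun_apply W f) \<le> c * norm f"
      using dec T \<rho> c unfolding dominated_decompositions_def by blast
    have "W \<in> weakly_compact_operators"
      by (rule weakly_compact_of_positive_domination[OF W(1) \<rho> W(2)])
    moreover have "norm (T - W) \<le> c"
      using W(3) c by (intro norm_blinfun_bound) (simp_all add: blinfun.diff_left)
    ultimately show False using far by force
  qed
  with that show thesis by blast
qed

end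

section \<open>Finitely additive set functions\<close>

lemma additive_set_function:
  fixes \<nu> :: "'a set \<Rightarrow> real"
  assumes alg: "Sigma_Algebra.algebra UNIV \<A>"
    and nonneg: "\<And>A. A \<in> \<A> \<Longrightarrow> 0 \<le> \<nu> A"
    and additive: "\<And>A B. A \<in> \<A> \<Longrightarrow> B \<in> \<A> \<Longrightarrow> A \<inter> B = {} \<Longrightarrow> \<nu> (A \<union> B) = \<nu> A + \<nu> B"
  shows "\<nu> {} = 0"
    and "A \<in> \<A> \<Longrightarrow> B \<in> \<A> \<Longrightarrow> A \<subseteq> B \<Longrightarrow> \<nu> A \<le> \<nu> B"
    and "A \<in> \<A> \<Longrightarrow> B \<in> \<A> \<Longrightarrow> \<nu> (A \<union> B) \<le> \<nu> A + \<nu> B"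
    and "finite F \<Longrightarrow> (\<And>i. i \<in> F \<Longrightarrow> S i \<in> \<A>) \<Longrightarrow> \<nu> (\<Union>i\<in>F. S i) \<le> (\<Sum>i\<in>F. \<nu> (S i))"
    and "finite F \<Longrightarrow> (\<And>i. i \<in> F \<Longrightarrow> S i \<in> \<A>) \<Longrightarrow> disjoint_family_on S F \<Longrightarrow>
      \<nu> (\<Union>i\<in>F. S i) = (\<Sum>i\<in>F. \<nu> (S i))"
proof -
  interpret Sigma_Algebra.algebra UNIV \<A> by (rule alg)
  show empty: "\<nu> {} = 0" using additive[of "{}" "{}"] by simp
  show mono: "\<nu> A \<le> \<nu> B" if "A \<in> \<A>" "B \<in> \<A>" "A \<subseteq> B" for A B
    using additive[of A "B - A"] nonneg[of "B - A"] that by (simp add: Diff Un_absorb1)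
  show sub: "\<nu> (A \<union> B) \<le> \<nu> A + \<nu> B" if "A \<in> \<A>" "B \<in> \<A>" for A B
  proof -
    have "\<nu> (A \<union> (B - A)) = \<nu> A + \<nu> (B - A)" using that by (intro additive) auto
    moreover have "\<nu> (B - A) \<le> \<nu> B" using that by (intro mono) auto
    ultimately show ?thesis by simp
  qed
  show "\<nu> (\<Union>i\<in>F. S i) \<le> (\<Sum>i\<in>F. \<nu> (S i))" if "finite F" "\<And>i. i \<in> F \<Longrightarrow> S i \<in> \<A>"
    using that
  proof (induction F rule: finite_induct)
    case (insert a F)
    have "\<nu> (S a \<union> (\<Union>i\<in>F. S i)) \<le> \<nu> (S a) + \<nu> (\<Union>i\<in>F. S i)"
      using insert by (intro sub finite_UN) auto
    with insert show ?case by simp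
  qed (simp add: empty)
  show "\<nu> (\<Union>i\<in>F. S i) = (\<Sum>i\<in>F. \<nu> (S i))"
    if "finite F" "\<And>i. i \<in> F \<Longrightarrow> S i \<in> \<A>" "disjoint_family_on S F"
    using that
  proof (induction F rule: finite_induct)
    case (insert a F)
    have "\<nu> (S a \<union> (\<Union>i\<in>F. S i)) = \<nu> (S a) + \<nu> (\<Union>i\<in>F. S i)"
      using insert by (intro additive finite_UN) (auto simp: disjoint_family_on_def)
    with insert show ?case by (simp add: disjoint_family_on_insert)
  qed (simp add: empty)
qed

text \<open>
  Choose \<open>K\<close> indices from \<open>M\<close> and remove from each \<open>A i\<close> the later sets among them. The
  resulting sets are disjoint, and as the total masses are bounded by \<open>C < K \<delta>\<close>, every \<open>\<nu> m\<close>
  gives mass at most \<open>\<delta>\<close> to one of them. By the pigeonhole principle one of these sets serves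
  infinitely many \<open>m\<close>; it can be split off the remainder \<open>R\<close> at a small loss for all these
  \<open>m\<close>.
\<close>

lemma disjoint_refinement_step:
  fixes \<nu> :: "nat \<Rightarrow> 'a set \<Rightarrow> real"
  assumes alg: "Sigma_Algebra.algebra UNIV \<A>"
    and nonneg: "\<And>n A. A \<in> \<A> \<Longrightarrow> 0 \<le> \<nu> n A"
    and additive: "\<And>n A B. A \<in> \<A> \<Longrightarrow> B \<in> \<A> \<Longrightarrow> A \<inter> B = {} \<Longrightarrow> \<nu> n (A \<union> B) = \<nu> n A + \<nu> n B"
    and bound: "\<And>n. \<nu> n UNIV \<le> C"
    and A: "\<And>n. A n \<in> \<A>" and small: "\<And>i n. i < n \<Longrightarrow> \<nu> i (A n) \<le> \<epsilon> * (1/2) ^ Suc n"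
    and \<epsilon>: "\<epsilon> > 0" and \<delta>: "\<delta> > 0" and R: "R \<in> \<A>" and M: "infinite M"
  shows "\<exists>i\<in>M. \<exists>B\<in>\<A>. \<exists>M'\<subseteq>M. B \<subseteq> R \<inter> A i \<and> \<nu> i (A i - B) \<le> \<nu> i (- R) + \<epsilon> \<and>
    infinite M' \<and> (\<forall>m\<in>M'. \<nu> m B \<le> \<delta>)"
proof -
  interpret Sigma_Algebra.algebra UNIV \<A> by (rule alg)
  note N = additive_set_function[OF alg, of "\<nu> n" for n, OF nonneg additive]
  define K where "K = nat \<lceil>C / \<delta>\<rceil> + 1"
  have "C / \<delta> \<le> real (nat \<lceil>C / \<delta>\<rceil>)" by linarith
  then have "C / \<delta> < real K" by (simp add: K_def)
  then have K: "C < real K * \<delta>" using \<delta> by (simp add: field_simps)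
  obtain F where F: "finite F" "card F = K" "F \<subseteq> M"
    using infinite_arbitrarily_large[OF M] by blast
  define B where "B i = (A i \<inter> R) - (\<Union>j\<in>{j\<in>F. i < j}. A j)" for i
  have B: "B i \<in> \<A>" for i
    unfolding B_def using F(1) A R by (intro Diff Int finite_UN) auto
  have disj: "disjoint_family_on B F"
    unfolding disjoint_family_on_def
  proof (intro ballI impI)
    fix i j assume "i \<in> F" "j \<in> F" "i \<noteq> j"
    then show "B i \<inter> B j = {}" by (cases "i < j") (auto simp: B_def)
  qed
  have "\<exists>i\<in>F. \<nu> m (B i) \<le> \<delta>" for m
  proof (rule ccontr)
    assume "\<not> ?thesis"
    then have "(\<Sum>i\<in>F. \<delta>) \<le> (\<Sum>i\<in>F. \<nu> m (B i))"
      by (intro sum_mono) force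
    also have "\<dots> = \<nu> m (\<Union>i\<in>F. B i)"
      using F(1) B disj by (simp add: N(5))
    also have "\<dots> \<le> \<nu> m UNIV"
      using F(1) B by (intro N(2) finite_UN) auto
    also have "\<dots> \<le> C" by (rule bound)
    finally show False using K F(2) by simp
  qed
  then have "M = (\<Union>i\<in>F. {m\<in>M. \<nu> m (B i) \<le> \<delta>})" by blast
  with M F(1) obtain i where i: "i \<in> F" "infinite {m\<in>M. \<nu> m (B i) \<le> \<delta>}"
    by (metis (no_types, lifting) finite_UN_I)
  show ?thesis
  proof (intro bexI exI conjI)
    show "i \<in> M" using i(1) F(3) by blast
    show "B i \<in> \<A>" by (rule B)
    show "B i \<subseteq> R \<inter> A i" by (auto simp: B_def)
    have "A i - B i \<subseteq> - R \<union> (\<Union>j\<in>{j\<in>F. i < j}. A j)" by (auto simp: B_def)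
    then have "\<nu> i (A i - B i) \<le> \<nu> i (- R \<union> (\<Union>j\<in>{j\<in>F. i < j}. A j))"
      using A B R F(1) compl_sets[OF R] by (intro N(2) Diff Un finite_UN) (auto simp: Compl_eq_Diff_UNIV)
    also have "\<dots> \<le> \<nu> i (- R) + \<nu> i (\<Union>j\<in>{j\<in>F. i < j}. A j)"
      using A R F(1) compl_sets[OF R] by (intro N(3) finite_UN) (auto simp: Compl_eq_Diff_UNIV)
    also have "\<nu> i (\<Union>j\<in>{j\<in>F. i < j}. A j) \<le> (\<Sum>j\<in>{j\<in>F. i < j}. \<nu> i (A j))"
      using A F(1) by (intro N(4)) auto
    also have "\<dots> \<le> (\<Sum>j\<in>{j\<in>F. i < j}. \<epsilon> * (1/2) ^ Suc j)"
      by (intro sum_mono small) auto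
    also have "\<dots> = \<epsilon> * (\<Sum>j\<in>{j\<in>F. i < j}. (1/2) ^ Suc j)"
      by (simp add: sum_distrib_left)
    also have "\<dots> \<le> \<epsilon> * 1"
    proof (rule mult_left_mono)
      have "(\<Sum>j\<in>{j\<in>F. i < j}. (1/2) ^ Suc j) \<le> (\<Sum>j. (1/2 :: real) ^ Suc j)"
        using F(1) power_half_series by (intro sum_le_suminf sums_summable[OF power_half_series]) auto
      then show "(\<Sum>j\<in>{j\<in>F. i < j}. (1/2) ^ Suc j) \<le> (1 :: real)"
        using power_half_series by (simp add: sums_iff)
    qed (use \<epsilon> in simp)
    finally show "\<nu> i (A i - B i) \<le> \<nu> i (- R) + \<epsilon>" by simp
    show "infinite {m\<in>M. \<nu> m (B i) \<le> \<delta>}" by (rule i(2))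
  qed auto
qed

text \<open>
  The smallness hypothesis concerns later sets and earlier set functions only, and one cannot
  subtract from \<open>A i\<close> the union of all later sets, which may fail to belong to the algebra. So
  the disjoint sets are split off one by one, keeping a remainder \<open>R\<close> and an infinite set \<open>M\<close>
  of indices whose set functions have lost little mass outside \<open>R\<close>.
\<close>

lemma disjoint_refinement:
  fixes \<nu> :: "nat \<Rightarrow> 'a set \<Rightarrow> real"
  assumes alg: "Sigma_Algebra.algebra UNIV \<A>"
    and nonneg: "\<And>n A. A \<in> \<A> \<Longrightarrow> 0 \<le> \<nu> n A"
    and additive: "\<And>n A B. A \<in> \<A> \<Longrightarrow> B \<in> \<A> \<Longrightarrow> A \<inter> B = {} \<Longrightarrow> \<nu> n (A \<union> B) = \<nu> n A + \<nu> n B"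
    and bound: "\<And>n. \<nu> n UNIV \<le> C"
    and A: "\<And>n. A n \<in> \<A>" and small: "\<And>i n. i < n \<Longrightarrow> \<nu> i (A n) \<le> \<epsilon> * (1/2) ^ Suc n"
    and \<epsilon>: "\<epsilon> > 0"
  shows "\<exists>(m :: nat \<Rightarrow> nat) B. disjoint_family B \<and>
    (\<forall>k. B k \<in> \<A> \<and> B k \<subseteq> A (m k) \<and> \<nu> (m k) (A (m k) - B k) \<le> 2 * \<epsilon>)"
proof -
  interpret Sigma_Algebra.algebra UNIV \<A> by (rule alg)
  note N = additive_set_function[OF alg, of "\<nu> n" for n, OF nonneg additive]
  define P where "P n = (\<lambda>(R, M). R \<in> \<A> \<and> infinite M \<and>
      (\<forall>m\<in>M. \<nu> m (- R) \<le> \<epsilon> * (1 - (1/2) ^ n)))" for n :: nat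
  define Q where "Q n = (\<lambda>(R, M :: nat set) (R', M' :: nat set). \<exists>i B. B \<in> \<A> \<and> B \<subseteq> R \<inter> A i \<and> R' = R - B \<and>
      \<nu> i (A i - B) \<le> 2 * \<epsilon>)" for n :: nat
  have "\<exists>s. \<forall>n. P n (s n) \<and> Q n (s n) (s (Suc n))"
  proof (rule dependent_nat_choice)
    have "P 0 (UNIV, UNIV)" using top by (simp add: P_def N(1))
    then show "\<exists>x. P 0 x" by blast
    fix s n assume "P n s"
    then obtain R M where s: "s = (R, M)" "R \<in> \<A>" "infinite M"
        and R: "\<And>m. m \<in> M \<Longrightarrow> \<nu> m (- R) \<le> \<epsilon> * (1 - (1/2) ^ n)"
      by (cases s) (auto simp: P_def)
    have pos: "\<epsilon> * (1/2) ^ Suc n > 0" using \<epsilon> by simp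
    have "\<exists>i\<in>M. \<exists>B\<in>\<A>. \<exists>M'\<subseteq>M. B \<subseteq> R \<inter> A i \<and> \<nu> i (A i - B) \<le> \<nu> i (- R) + \<epsilon> \<and>
        infinite M' \<and> (\<forall>m\<in>M'. \<nu> m B \<le> \<epsilon> * (1/2) ^ Suc n)"
      by (rule disjoint_refinement_step[of \<A> \<nu> C])
        (fact alg nonneg additive bound A small \<epsilon> pos s(2,3))+
    then obtain i B M' where i: "i \<in> M" "B \<in> \<A>" "B \<subseteq> R \<inter> A i" "\<nu> i (A i - B) \<le> \<nu> i (- R) + \<epsilon>"
      "M' \<subseteq> M" "infinite M'" "\<And>m. m \<in> M' \<Longrightarrow> \<nu> m B \<le> \<epsilon> * (1/2) ^ Suc n"
      by blast
    have "\<nu> m (- (R - B)) \<le> \<epsilon> * (1 - (1/2) ^ Suc n)" if "m \<in> M'" for m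
    proof -
      have "- (R - B) = - R \<union> B" by auto
      then have "\<nu> m (- (R - B)) \<le> \<nu> m (- R) + \<nu> m B"
        using i(2) compl_sets[OF s(2)] by (auto simp: Compl_eq_Diff_UNIV intro!: N(3))
      also have "\<dots> \<le> \<epsilon> * (1 - (1/2) ^ n) + \<epsilon> * (1/2) ^ Suc n"
        using R[of m] i(5,7) that by (intro add_mono) auto
      finally show ?thesis by (simp add: algebra_simps)
    qed
    then have "P (Suc n) (R - B, M')" using s i by (auto simp: P_def)
    moreover have "\<epsilon> * (1 - (1/2) ^ n) \<le> \<epsilon>" using \<epsilon> by (simp add: algebra_simps)
    then have "Q n s (R - B, M')"
      using i(2,3,4) R[OF i(1)] by (force simp: Q_def s)
    ultimately show "\<exists>y. P (Suc n) y \<and> Q n s y" by blast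
  qed
  then obtain s where s: "\<And>n. P n (s n)" "\<And>n. Q n (s n) (s (Suc n))" by blast
  define R where "R n = fst (s n)" for n
  have "\<exists>i B. B \<in> \<A> \<and> B \<subseteq> R n \<inter> A i \<and> R (Suc n) = R n - B \<and> \<nu> i (A i - B) \<le> 2 * \<epsilon>" for n
    using s(2)[of n] by (simp add: Q_def R_def split_beta)
  then obtain m B where mB: "\<And>n. B n \<in> \<A>" "\<And>n. B n \<subseteq> R n \<inter> A (m n)" "\<And>n. R (Suc n) = R n - B n"
    "\<And>n. \<nu> (m n) (A (m n) - B n) \<le> 2 * \<epsilon>"
    by metis
  have decr: "R k \<subseteq> R n" if "n \<le> k" for n k
    using that mB(3) by (induction rule: dec_induct) auto
  have lt: "B n \<inter> B k = {}" if "n < k" for n k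
    using mB(2)[of k] mB(3)[of n] decr[of "Suc n" k] that by auto
  have "disjoint_family B"
    unfolding disjoint_family_on_def using lt by (metis Int_commute linorder_neqE_nat)
  with mB show ?thesis by (intro exI[of _ m] exI[of _ B]) auto
qed

text \<open>
  Rosenthal's lemma. Split the current infinite index set into infinitely many infinite
  pieces. If every piece \<open>N p\<close> fails at some \<open>k p\<close>, the set of the \<open>k p\<close> meets \<open>N p\<close> in \<open>k p\<close>
  only, so its mass under \<open>\<beta> (k p)\<close> is smaller by \<open>\<epsilon>\<close> than that of the whole index set. As the
  masses are bounded, this happens only finitely often.
\<close>

lemma rosenthal_subsequence:
  fixes \<beta> :: "nat \<Rightarrow> nat set \<Rightarrow> real"
  assumes nonneg: "\<And>k M. 0 \<le> \<beta> k M"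
    and additive: "\<And>k M N. M \<inter> N = {} \<Longrightarrow> \<beta> k (M \<union> N) = \<beta> k M + \<beta> k N"
    and bound: "\<And>k. \<beta> k UNIV \<le> C" and \<epsilon>: "\<epsilon> > 0"
  obtains M where "infinite M" "\<And>k. k \<in> M \<Longrightarrow> \<beta> k (M - {k}) \<le> \<epsilon>"
proof -
  have mono: "\<beta> k M \<le> \<beta> k N" if "M \<subseteq> N" for k M N
    using additive[of M "N - M" k] nonneg[of k "N - M"] that by (simp add: Un_absorb1)
  have main: "\<exists>M. infinite M \<and> (\<forall>k\<in>M. \<beta> k (M - {k}) \<le> \<epsilon>)"
    if "infinite M0" "\<And>k. k \<in> M0 \<Longrightarrow> \<beta> k M0 \<le> real n * \<epsilon>" for n M0
    using that
  proof (induction n arbitrary: M0)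
    case 0
    have "\<beta> k (M0 - {k}) \<le> \<epsilon>" if "k \<in> M0" for k
      using mono[of "M0 - {k}" M0 k] 0(2)[OF that] \<epsilon> by auto
    with 0(1) show ?case by blast
  next
    case (Suc n)
    define N where "N p = (\<lambda>q. enumerate M0 (prod_encode (p, q))) ` UNIV" for p
    have inj: "inj (enumerate M0)"
      using strict_mono_enumerate[OF Suc(2)] strict_mono_imp_inj_on by blast
    have N_sub: "N p \<subseteq> M0" for p
      using enumerate_in_set[OF Suc(2)] by (auto simp: N_def)
    have N_inf: "infinite (N p)" for p
    proof -
      have "inj (\<lambda>q. enumerate M0 (prod_encode (p, q)))"
        by (auto intro!: injI dest!: injD[OF inj])
      then show ?thesis unfolding N_def by (rule range_inj_infinite)
    qed
    have N_disj: "p = p'" if "k \<in> N p" "k \<in> N p'" for p p' k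
      using that by (auto simp: N_def dest!: injD[OF inj])
    show ?case
    proof (cases "\<exists>p. \<forall>k\<in>N p. \<beta> k (N p - {k}) \<le> \<epsilon>")
      case True
      then show ?thesis using N_inf by blast
    next
      case False
      then have "\<forall>p. \<exists>k. k \<in> N p \<and> \<epsilon> < \<beta> k (N p - {k})" by (meson not_le)
      then obtain k where k: "\<And>p. k p \<in> N p" "\<And>p. \<epsilon> < \<beta> (k p) (N p - {k p})" by metis
      have "inj k" using k(1) N_disj by (metis injI)
      then have "infinite (range k)" by (rule range_inj_infinite)
      moreover have "\<beta> (k p) (range k) \<le> real n * \<epsilon>" for p
      proof -
        have "range k \<inter> (N p - {k p}) = {}" using k(1) N_disj by blast
        then have "\<beta> (k p) (range k) + \<beta> (k p) (N p - {k p}) = \<beta> (k p) (range k \<union> (N p - {k p}))"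
          by (simp add: additive)
        also have "\<dots> \<le> \<beta> (k p) M0"
          using k(1) N_sub by (intro mono) blast
        also have "\<dots> \<le> real (Suc n) * \<epsilon>"
          using k(1) N_sub by (intro Suc(3)) blast
        finally show ?thesis using k(2)[of p] by (simp add: algebra_simps)
      qed
      ultimately show ?thesis using Suc.IH[of "range k"] by blast
    qed
  qed
  obtain n where n: "C / \<epsilon> \<le> real n" using real_arch_simple by blast
  have "\<beta> k UNIV \<le> real n * \<epsilon>" for k
    using bound[of k] n \<epsilon> by (simp add: field_simps)
  from main[OF infinite_UNIV_nat this] that show thesis by blast
qed

section \<open>Disjoint supports on which an operator is almost diagonal\<close>

definition clopen :: "'l::topological_space set \<Rightarrow> bool"
  where "clopen A \<longleftrightarrow> open A \<and> closed A"

lemma algebra_clopen: "Sigma_Algebra.algebra UNIV (Collect clopen)"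
  by (simp add: algebra_iff_Un clopen_def open_Un closed_Un Compl_eq_Diff_UNIV[symmetric]
      open_Compl closed_Compl)

lemma continuous_on_indicator_clopen:
  assumes "clopen A"
  shows "continuous_on UNIV (indicator A :: _ \<Rightarrow> real)"
proof -
  have "continuous_on UNIV (\<lambda>x. if x \<in> A then 1 else 0 :: real)"
    using continuous_on_If[of A "- A" "\<lambda>_. 1 :: real" "\<lambda>_. 0" "\<lambda>x. x \<in> A"] assms
    by (simp add: clopen_def closed_Compl)
  moreover have "(indicator A :: _ \<Rightarrow> real) = (\<lambda>x. if x \<in> A then 1 else 0)"
    by (auto simp: indicator_def)
  ultimately show ?thesis by simp
qed

context stonean
begin

lemma clopen_closure: "open U \<Longrightarrow> clopen (closure (U :: 'l set))"
  by (simp add: clopen_def open_closure)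

lemma disjoint_closures:
  fixes U V :: "'l set"
  assumes "open U" "open V" "U \<inter> V = {}"
  shows "closure U \<inter> closure V = {}"
proof -
  have "closure V \<subseteq> - U" using assms by (intro closure_minimal) auto
  then have "U \<subseteq> - closure V" by blast
  moreover have "closed (- closure V)" using open_closure[OF assms(2)] by (simp add: closed_Compl)
  ultimately have "closure U \<subseteq> - closure V" by (intro closure_minimal)
  then show ?thesis by blast
qed

definition cut :: "'l set \<Rightarrow> ('l \<Rightarrow>\<^sub>C 'k::real_normed_field) \<Rightarrow> ('l \<Rightarrow>\<^sub>C 'k)"
  where "cut A f = Bcontfun (\<lambda>x. of_real (indicator A x) * apply_bcontfun f x)"

lemma apply_cut:
  assumes "clopen A"
  shows "apply_bcontfun (cut A f) x = (if x \<in> A then apply_bcontfun f x else 0)"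
  unfolding cut_def
  by (subst apply_Bcontfun) (auto intro!: continuous_intros continuous_on_indicator_clopen[OF assms])

lemma clopen_variation:
  fixes \<mu> :: "('l \<Rightarrow>\<^sub>C 'k::real_normed_field) \<Rightarrow>\<^sub>L 'k"
  assumes "\<mu> \<in> dual_space"
  shows "clopen A \<Longrightarrow> 0 \<le> variation \<mu> (indicator A)"
    and "clopen A \<Longrightarrow> clopen B \<Longrightarrow> A \<inter> B = {} \<Longrightarrow>
      variation \<mu> (indicator (A \<union> B)) = variation \<mu> (indicator A) + variation \<mu> (indicator B)"
    and "variation \<mu> (indicator A) \<le> norm \<mu>"
proof -
  note D = positive_functionalD[OF positive_functional_variation[OF assms]]
  show "0 \<le> variation \<mu> (indicator A)" if "clopen A"
    by (rule D(4)) (use that in \<open>auto intro: continuous_on_indicator_clopen\<close>)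
  show "variation \<mu> (indicator (A \<union> B)) = variation \<mu> (indicator A) + variation \<mu> (indicator B)"
    if "clopen A" "clopen B" "A \<inter> B = {}"
  proof -
    have "(indicator (A \<union> B) :: 'l \<Rightarrow> real) = (\<lambda>x. indicator A x + indicator B x)"
      using that(3) by (auto simp: indicator_def fun_eq_iff)
    then show ?thesis
      using that by (simp only:) (rule D(1), auto intro: continuous_on_indicator_clopen)
  qed
  have "variation \<mu> (indicator A) \<le> norm \<mu> * 1" by (rule variation_le_norm) (auto simp: indicator_def)
  then show "variation \<mu> (indicator A) \<le> norm \<mu>" by simp
qed

text \<open>
  Apply the distance formula to a multiple \<open>K \<rho>\<close> so large that \<open>\<parallel>T\<parallel> \<le> K e\<close>, and normalize the
  function obtained.
\<close>

lemma concentrated_function: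
  fixes T :: "('l, 'k::{real_normed_field, euclidean_space}) operator"
  assumes dec: "dominated_decompositions TYPE('k)" and T: "T \<in> bounded_operators" and c: "0 \<le> c"
    and far: "\<forall>W\<in>weakly_compact_operators. c < norm (T - W)"
    and \<rho>: "positive_functional \<rho>" and e: "e > 0"
  obtains h x where "norm h \<le> 1" "\<rho> (\<lambda>z. norm (apply_bcontfun h z)) \<le> e"
    "c < norm (apply_bcontfun (blinfun_apply T h) x)"
proof -
  define K where "K = (norm T + 1) / e"
  have K: "K > 0" using e by (simp add: K_def add_nonneg_pos)
  obtain f where f: "K * \<rho> (\<lambda>x. norm (apply_bcontfun f x)) + c * norm f < norm (blinfun_apply T f)"
    using exceeds_positive_functional[OF dec T c far positive_functional_scale[OF \<rho>, of K]] K by auto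
  have nonneg: "0 \<le> \<rho> (\<lambda>x. norm (apply_bcontfun f x))"
    by (rule positive_functionalD(4)[OF \<rho>]) (auto intro!: continuous_intros)
  have "f \<noteq> 0" using f mult_nonneg_nonneg[OF less_imp_le[OF K] nonneg] by auto
  then have pos: "norm f > 0" by simp
  define h where "h = (1 / norm f) *\<^sub>R f"
  have "\<rho> (\<lambda>z. norm (apply_bcontfun h z)) = \<rho> (\<lambda>z. (1 / norm f) * norm (apply_bcontfun f z))"
    by (simp add: h_def)
  also have "\<dots> = (1 / norm f) * \<rho> (\<lambda>z. norm (apply_bcontfun f z))"
    by (rule positive_functionalD(3)[OF \<rho>]) (auto intro!: continuous_intros)
  finally have \<rho>h: "norm f * \<rho> (\<lambda>z. norm (apply_bcontfun h z)) = \<rho> (\<lambda>z. norm (apply_bcontfun f z))"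
    using pos by simp
  have f_le: "norm (blinfun_apply T f) \<le> norm T * norm f" by (rule norm_blinfun)
  have "K * \<rho> (\<lambda>z. norm (apply_bcontfun f z)) \<le> norm T * norm f"
    using f f_le mult_nonneg_nonneg[OF c norm_ge_zero[of f]] by linarith
  then have "norm f * (K * \<rho> (\<lambda>z. norm (apply_bcontfun h z))) \<le> norm f * norm T"
    by (simp add: \<rho>h[symmetric] ac_simps)
  then have "K * \<rho> (\<lambda>z. norm (apply_bcontfun h z)) \<le> norm T" using pos by simp
  also have "\<dots> \<le> K * e" using e by (simp add: K_def)
  finally have small: "\<rho> (\<lambda>z. norm (apply_bcontfun h z)) \<le> e" using K by simp
  have "norm f * c < norm f * norm (blinfun_apply T h)"
  proof -
    have "norm f * c < norm (blinfun_apply T f)"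
      using f mult_nonneg_nonneg[OF less_imp_le[OF K] nonneg] by (simp add: mult.commute)
    also have "\<dots> = norm f * norm (blinfun_apply T h)"
      using pos by (simp add: h_def blinfun.scaleR_right)
    finally show ?thesis .
  qed
  then have "c < norm (blinfun_apply T h)" using pos by simp
  then obtain x where "c < norm (apply_bcontfun (blinfun_apply T h) x)"
    by (meson norm_bound not_le)
  moreover have "norm h \<le> 1" using pos by (simp add: h_def)
  ultimately show thesis using small that by blast
qed

text \<open>
  The state of the recursion carries the functional to be avoided next, namely the sum of the
  variations found so far.
\<close>

lemma concentrated_sequence:
  fixes T :: "('l, 'k::{real_normed_field, euclidean_space}) operator" and e :: "nat \<Rightarrow> real"
  assumes dec: "dominated_decompositions TYPE('k)" and T: "T \<in> bounded_operators" and c: "0 \<le> c"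
    and far: "\<forall>W\<in>weakly_compact_operators. c < norm (T - W)"
    and e: "\<And>n. e n > 0"
  obtains h x where "\<And>n. norm (h n) \<le> 1" "\<And>n. c < norm (apply_bcontfun (blinfun_apply T (h n)) (x n))"
    "\<And>i n. i < n \<Longrightarrow> variation (point_evaluation (x i) o\<^sub>L T) (\<lambda>z. norm (apply_bcontfun (h n) z)) \<le> e n"
proof -
  define \<mu> :: "'l \<Rightarrow> ('l \<Rightarrow>\<^sub>C 'k) \<Rightarrow>\<^sub>L 'k" where "\<mu> x = point_evaluation x o\<^sub>L T" for x
  have \<mu>: "positive_functional (variation (\<mu> x))" for x
    unfolding \<mu>_def
    by (intro positive_functional_variation compose_in_dual_space point_evaluation_in_dual_space T)
  define P :: "nat \<Rightarrow> (('l \<Rightarrow> real) \<Rightarrow> real) \<times> ('l \<Rightarrow>\<^sub>C 'k) \<times> 'l \<Rightarrow> bool"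
    where "P n = (\<lambda>(\<rho>, h, x). positive_functional \<rho> \<and> norm h \<le> 1 \<and>
      c < norm (apply_bcontfun (blinfun_apply T h) x) \<and> \<rho> (\<lambda>z. norm (apply_bcontfun h z)) \<le> e n)" for n
  define Q :: "nat \<Rightarrow> (('l \<Rightarrow> real) \<Rightarrow> real) \<times> ('l \<Rightarrow>\<^sub>C 'k) \<times> 'l \<Rightarrow> (('l \<Rightarrow> real) \<Rightarrow> real) \<times> ('l \<Rightarrow>\<^sub>C 'k) \<times> 'l \<Rightarrow> bool"
    where "Q n = (\<lambda>(\<rho>, h, x) (\<rho>', _). \<rho>' = (\<lambda>u. \<rho> u + variation (\<mu> x) u))" for n
  have ex: "\<exists>h x. P n (\<rho>, h, x)" if \<rho>: "positive_functional \<rho>" for n \<rho>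
  proof -
    obtain h x where "norm h \<le> 1" "\<rho> (\<lambda>z. norm (apply_bcontfun h z)) \<le> e n"
      "c < norm (apply_bcontfun (blinfun_apply T h) x)"
      using concentrated_function[OF dec T c far \<rho> e[of n]] by blast
    with \<rho> show ?thesis unfolding P_def by blast
  qed
  have "\<exists>s. \<forall>n. P n (s n) \<and> Q n (s n) (s (Suc n))"
  proof (rule dependent_nat_choice)
    show "\<exists>s. P 0 s" using ex[OF positive_functional_zero] by blast
    fix s n assume "P n s"
    then obtain \<rho> h x where s: "s = (\<rho>, h, x)" "positive_functional \<rho>" by (cases s) (auto simp: P_def)
    obtain h' x' where "P (Suc n) (\<lambda>u. \<rho> u + variation (\<mu> x) u, h', x')"
      using ex[OF positive_functional_add[OF s(2) \<mu>]] by blast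
    then show "\<exists>s'. P (Suc n) s' \<and> Q n s s'" by (auto simp: Q_def s(1))
  qed
  then obtain s where s: "\<And>n. P n (s n)" "\<And>n. Q n (s n) (s (Suc n))" by blast
  define \<rho> where "\<rho> n = fst (s n)" for n
  define h where "h n = fst (snd (s n))" for n
  define x where "x n = snd (snd (s n))" for n
  have P: "positive_functional (\<rho> n)" "norm (h n) \<le> 1"
    "c < norm (apply_bcontfun (blinfun_apply T (h n)) (x n))" "\<rho> n (\<lambda>z. norm (apply_bcontfun (h n) z)) \<le> e n" for n
    using s(1)[of n] by (auto simp: P_def \<rho>_def h_def x_def split_beta)
  have Q: "\<rho> (Suc n) = (\<lambda>u. \<rho> n u + variation (\<mu> (x n)) u)" for n
    using s(2)[of n] by (auto simp: Q_def \<rho>_def x_def split_beta)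
  have dominates: "variation (\<mu> (x i)) u \<le> \<rho> n u"
    if "i < n" "continuous_on UNIV u" "\<And>z. 0 \<le> u z" for i n u
    using that(1)
  proof (induction n)
    case (Suc n)
    have "0 \<le> \<rho> n u" "0 \<le> variation (\<mu> (x n)) u"
      using positive_functionalD(4) P(1) \<mu> that(2,3) by blast+
    with Suc show ?case by (cases "i = n") (auto simp: Q)
  qed simp
  show thesis
  proof (rule that[of h x])
    fix i n :: nat assume "i < n"
    then have "variation (\<mu> (x i)) (\<lambda>z. norm (apply_bcontfun (h n) z)) \<le> \<rho> n (\<lambda>z. norm (apply_bcontfun (h n) z))"
      by (rule dominates) (auto intro!: continuous_intros)
    also have "\<dots> \<le> e n" by (rule P(4))
    finally show "variation (point_evaluation (x i) o\<^sub>L T) (\<lambda>z. norm (apply_bcontfun (h n) z)) \<le> e n"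
      by (simp add: \<mu>_def)
  qed (rule P(2), rule P(3))
qed

text \<open>
  The functions \<open>h n\<close> of a concentrated sequence are cut down to the clopen closures \<open>A n\<close> of
  the sets where they exceed a small \<open>\<eta>\<close>: this changes them by at most \<open>\<eta>\<close>, while an earlier
  measure that is small on \<open>\<bar>h n\<bar>\<close> is small on \<open>A n\<close>. Disjoint refinement replaces the \<open>A n\<close>
  by disjoint clopen sets. Finally Rosenthal's lemma is applied to the set functions \<open>M \<mapsto> \<bar>\<mu>
  k\<bar>(closure (\<Union>j\<in>M. B j))\<close>, which are finitely additive because disjoint open sets have
  disjoint closures.
\<close>

lemma almost_diagonal_sequence:
  fixes T :: "('l, 'k::{real_normed_field, euclidean_space}) operator"
  assumes dec: "dominated_decompositions TYPE('k)" and T: "T \<in> bounded_operators" and c: "0 \<le> c"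
    and far: "\<forall>W\<in>weakly_compact_operators. c < norm (T - W)"
    and \<epsilon>: "\<epsilon> > 0"
  obtains B :: "nat \<Rightarrow> 'l set" and f :: "nat \<Rightarrow> 'l \<Rightarrow>\<^sub>C 'k" and x :: "nat \<Rightarrow> 'l"
  where "\<And>k. clopen (B k)" "disjoint_family B" "\<And>k. norm (f k) \<le> 1"
    "\<And>k z. z \<notin> B k \<Longrightarrow> apply_bcontfun (f k) z = 0"
    "\<And>k. c - \<epsilon> < norm (apply_bcontfun (blinfun_apply T (f k)) (x k))"
    "\<And>k. \<forall>g. (\<forall>z. norm (apply_bcontfun g z) \<le> indicator (closure (\<Union>j\<in>- {k}. B j)) z) \<longrightarrow>
      norm (apply_bcontfun (blinfun_apply T g) (x k)) \<le> \<epsilon>"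
proof -
  define \<eta> where "\<eta> = \<epsilon> / (2 * (norm T + 1))"
  have \<eta>: "\<eta> > 0" "norm T * \<eta> \<le> \<epsilon> / 2"
  proof -
    have pos: "norm T + 1 > 0" by (simp add: add_nonneg_pos)
    then show "\<eta> > 0" using \<epsilon> by (simp add: \<eta>_def)
    then have "norm T * \<eta> \<le> (norm T + 1) * \<eta>" by (intro mult_right_mono) auto
    also have "N * (\<epsilon> / (2 * N)) = \<epsilon> / 2" if "N > 0" for N :: real
      using that by simp
    from this[OF pos] have "(norm T + 1) * \<eta> = \<epsilon> / 2" by (simp only: \<eta>_def)
    finally show "norm T * \<eta> \<le> \<epsilon> / 2" .
  qed
  \<comment> \<open>Cutting down to \<open>A n\<close> costs \<open>\<epsilon> / 2\<close>, and so does the refinement, whose loss is \<open>2 * \<delta>\<close>.\<close>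
  define \<delta> where "\<delta> = \<epsilon> / 4"
  have \<delta>: "\<delta> > 0" using \<epsilon> by (simp add: \<delta>_def)
  \<comment> \<open>The factor \<open>\<eta>\<close> pays for passing from \<open>\<bar>h n\<bar>\<close> to the indicator of the set where \<open>\<bar>h n\<bar> \<ge> \<eta>\<close>.\<close>
  define e where "e n = \<eta> * (\<delta> * (1/2) ^ Suc n)" for n
  have "e n > 0" for n using \<eta> \<delta> by (simp add: e_def)
  then obtain h x where hx: "\<And>n. norm (h n) \<le> 1"
    "\<And>n. c < norm (apply_bcontfun (blinfun_apply T (h n)) (x n))"
    "\<And>i n. i < n \<Longrightarrow> variation (point_evaluation (x i) o\<^sub>L T) (\<lambda>z. norm (apply_bcontfun (h n) z)) \<le> e n"
    using concentrated_sequence[OF dec T c far, of e] by metis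
  define \<mu> :: "nat \<Rightarrow> ('l \<Rightarrow>\<^sub>C 'k) \<Rightarrow>\<^sub>L 'k" where "\<mu> n = point_evaluation (x n) o\<^sub>L T" for n
  define \<nu> where "\<nu> n A = variation (\<mu> n) (indicator A)" for n and A :: "'l set"
  have dual: "\<mu> n \<in> dual_space" for n
    unfolding \<mu>_def by (intro compose_in_dual_space point_evaluation_in_dual_space T)
  have norm_\<mu>: "norm (\<mu> n) \<le> norm T" for n
  proof -
    have "norm (\<mu> n) \<le> norm (point_evaluation (x n) :: ('l \<Rightarrow>\<^sub>C 'k) \<Rightarrow>\<^sub>L 'k) * norm T"
      unfolding \<mu>_def by (rule norm_blinfun_compose)
    also have "\<dots> \<le> 1 * norm T"
      by (intro mult_right_mono norm_point_evaluation_le norm_ge_zero)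
    finally show ?thesis by simp
  qed
  have \<mu>_apply: "blinfun_apply (\<mu> n) g = apply_bcontfun (blinfun_apply T g) (x n)" for n g
    by (simp add: \<mu>_def)
  have \<nu>_nonneg: "0 \<le> \<nu> n A" if "clopen A" for n A
    unfolding \<nu>_def by (rule clopen_variation(1)[OF dual that])
  have \<nu>_add: "\<nu> n (A \<union> A') = \<nu> n A + \<nu> n A'" if "clopen A" "clopen A'" "A \<inter> A' = {}" for n A A'
    unfolding \<nu>_def by (rule clopen_variation(2)[OF dual that])
  have \<nu>_bound: "\<nu> n A \<le> norm T" for n A
    unfolding \<nu>_def using clopen_variation(3)[OF dual] norm_\<mu> by (rule order_trans)
  have \<nu>_dom: "norm (apply_bcontfun (blinfun_apply T g) (x n)) \<le> \<nu> n A"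
    if "clopen A" "\<And>z. norm (apply_bcontfun g z) \<le> indicator A z" for g n A
    unfolding \<nu>_def using that
    by (subst \<mu>_apply[symmetric]) (intro norm_le_variation continuous_on_indicator_clopen)
  define A where "A n = closure {z. \<eta> < norm (apply_bcontfun (h n) z)}" for n
  have A_clopen: "clopen (A n)" for n
    unfolding A_def by (intro clopen_closure open_Collect_less) (auto intro!: continuous_intros)
  have on_A: "\<eta> \<le> norm (apply_bcontfun (h n) z)" if "z \<in> A n" for n z
  proof -
    have "A n \<subseteq> {z. \<eta> \<le> norm (apply_bcontfun (h n) z)}"
      unfolding A_def by (intro closure_minimal closed_Collect_le) (auto intro!: continuous_intros)
    with that show ?thesis by blast
  qed
  have off_A: "norm (apply_bcontfun (h n) z) \<le> \<eta>" if "z \<notin> A n" for n z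
  proof (rule ccontr)
    assume "\<not> ?thesis"
    then have "z \<in> {z. \<eta> < norm (apply_bcontfun (h n) z)}" by simp
    then have "z \<in> A n" unfolding A_def by (rule subsetD[OF closure_subset])
    with that show False by contradiction
  qed
  have small: "\<nu> i (A n) \<le> \<delta> * (1/2) ^ Suc n" if "i < n" for i n
  proof -
    note D = positive_functionalD[OF positive_functional_variation[OF dual[of i]]]
    have "\<eta> * \<nu> i (A n) = variation (\<mu> i) (\<lambda>z. \<eta> * indicator (A n) z)"
      unfolding \<nu>_def using \<eta>(1)
      by (intro D(3)[symmetric]) (auto intro: continuous_on_indicator_clopen A_clopen)
    also have "\<dots> \<le> variation (\<mu> i) (\<lambda>z. norm (apply_bcontfun (h n) z))"
      using \<eta>(1) on_A
      by (intro D(2) continuous_intros continuous_on_indicator_clopen A_clopen)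
        (auto simp: indicator_def)
    also have "\<dots> \<le> e n" using hx(3)[OF that] by (simp add: \<mu>_def)
    finally show ?thesis using \<eta>(1) by (simp add: e_def)
  qed
  have large: "c - \<epsilon> / 2 < norm (apply_bcontfun (blinfun_apply T (cut (A n) (h n))) (x n))" for n
  proof -
    have "norm (h n - cut (A n) (h n)) \<le> \<eta>"
      using off_A \<eta>(1) by (intro norm_bound) (auto simp: apply_cut[OF A_clopen])
    then have "norm (blinfun_apply T (h n - cut (A n) (h n))) \<le> norm T * \<eta>"
      by (meson mult_left_mono norm_blinfun norm_ge_zero order_trans)
    then have "norm (apply_bcontfun (blinfun_apply T (h n - cut (A n) (h n))) (x n)) \<le> \<epsilon> / 2"
      using \<eta>(2) norm_bounded[of "blinfun_apply T (h n - cut (A n) (h n))" "x n"] by linarith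
    then show ?thesis
      using hx(2)[of n] norm_triangle_ineq2[of "apply_bcontfun (blinfun_apply T (h n)) (x n)"
          "apply_bcontfun (blinfun_apply T (cut (A n) (h n))) (x n)"]
      by (simp add: blinfun.diff_right)
  qed
  have "\<exists>(m :: nat \<Rightarrow> nat) B. disjoint_family B \<and>
      (\<forall>k. B k \<in> Collect clopen \<and> B k \<subseteq> A (m k) \<and> \<nu> (m k) (A (m k) - B k) \<le> 2 * \<delta>)"
  proof (rule disjoint_refinement[OF algebra_clopen, of \<nu> "norm T" A \<delta>])
    show "0 \<le> \<nu> n S" if "S \<in> Collect clopen" for n S using that by (simp add: \<nu>_nonneg)
    show "\<nu> n (S \<union> S') = \<nu> n S + \<nu> n S'"
      if "S \<in> Collect clopen" "S' \<in> Collect clopen" "S \<inter> S' = {}" for n S S'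
      using that by (simp add: \<nu>_add)
  qed (use A_clopen in \<open>simp_all only: mem_Collect_eq small \<delta> \<nu>_bound\<close>)
  then obtain m :: "nat \<Rightarrow> nat" and B where mB: "\<And>k. B k \<in> Collect clopen" "\<And>k. B k \<subseteq> A (m k)" "disjoint_family B"
    "\<And>k. \<nu> (m k) (A (m k) - B k) \<le> 2 * \<delta>"
    by blast
  have B_clopen: "clopen (B k)" for k using mB(1) by simp
  have B_open: "open (B k)" for k using B_clopen by (simp add: clopen_def)
  define \<beta> where "\<beta> k M = \<nu> (m k) (closure (\<Union>j\<in>M. B j))" for k M
  have B_union: "clopen (closure (\<Union>j\<in>M. B j))" for M
    using B_open by (intro clopen_closure) auto
  obtain M where M: "infinite M" "\<And>k. k \<in> M \<Longrightarrow> \<beta> k (M - {k}) \<le> \<epsilon>"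
  proof (rule rosenthal_subsequence[of \<beta> "norm T" \<epsilon>])
    show "0 \<le> \<beta> k M" for k M unfolding \<beta>_def by (rule \<nu>_nonneg[OF B_union])
    show "\<beta> k UNIV \<le> norm T" for k unfolding \<beta>_def by (rule \<nu>_bound)
    show "\<beta> k (M \<union> N) = \<beta> k M + \<beta> k N" if "M \<inter> N = {}" for k M N
    proof -
      have "B j \<inter> B j' = {}" if "j \<in> M" "j' \<in> N" for j j'
        using disjoint_family_onD[OF mB(3), of j j'] that \<open>M \<inter> N = {}\<close> by auto
      then have "(\<Union>j\<in>M. B j) \<inter> (\<Union>j\<in>N. B j) = {}" by blast
      then have "closure (\<Union>j\<in>M. B j) \<inter> closure (\<Union>j\<in>N. B j) = {}"
        using B_open by (intro disjoint_closures) auto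
      moreover have "closure (\<Union>j\<in>M \<union> N. B j) = closure (\<Union>j\<in>M. B j) \<union> closure (\<Union>j\<in>N. B j)"
        by (simp add: UN_Un closure_Un)
      ultimately show ?thesis unfolding \<beta>_def by (simp add: \<nu>_add B_union)
    qed
  qed (use \<epsilon> in auto)
  define i where "i = enumerate M"
  have i: "i k \<in> M" for k using enumerate_in_set[OF M(1)] by (simp add: i_def)
  have inj: "inj i"
    using strict_mono_enumerate[OF M(1)] strict_mono_imp_inj_on unfolding i_def by blast
  define f where "f k = cut (B (i k)) (h (m (i k)))" for k
  show thesis
  proof (rule that[of "B \<circ> i" f "x \<circ> m \<circ> i"])
    show "clopen ((B \<circ> i) k)" for k using B_clopen by simp
    show "disjoint_family (B \<circ> i)"
      using mB(3) inj unfolding disjoint_family_on_def by (auto dest: injD)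
    show "norm (f k) \<le> 1" for k
    proof (rule norm_bound)
      show "norm (apply_bcontfun (f k) z) \<le> 1" for z
        using norm_bounded[of "h (m (i k))" z] hx(1)[of "m (i k)"]
        by (auto simp: f_def apply_cut[OF B_clopen])
    qed
    show "apply_bcontfun (f k) z = 0" if "z \<notin> (B \<circ> i) k" for k z
      using that by (simp add: f_def apply_cut[OF B_clopen])
    show "c - \<epsilon> < norm (apply_bcontfun (blinfun_apply T (f k)) ((x \<circ> m \<circ> i) k))" for k
    proof -
      let ?n = "m (i k)"
      have "norm (apply_bcontfun (blinfun_apply T (cut (A ?n) (h ?n) - f k)) (x ?n)) \<le> \<nu> ?n (A ?n - B (i k))"
      proof (rule \<nu>_dom)
        show "clopen (A ?n - B (i k))"
          using A_clopen B_clopen by (simp add: clopen_def open_Diff closed_Diff)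
        show "norm (apply_bcontfun (cut (A ?n) (h ?n) - f k) z) \<le> indicator (A ?n - B (i k)) z" for z
          using norm_bounded[of "h ?n" z] hx(1)[of ?n] mB(2)[of "i k"]
          by (auto simp: f_def apply_cut[OF B_clopen] apply_cut[OF A_clopen] indicator_def)
      qed
      also have "\<dots> \<le> \<epsilon> / 2" using mB(4)[of "i k"] by (simp add: \<delta>_def)
      finally show ?thesis
        using large[of ?n] norm_triangle_ineq2[of "apply_bcontfun (blinfun_apply T (cut (A ?n) (h ?n))) (x ?n)"
            "apply_bcontfun (blinfun_apply T (f k)) (x ?n)"]
        by (simp add: blinfun.diff_right)
    qed
    show "\<forall>g. (\<forall>z. norm (apply_bcontfun g z) \<le> indicator (closure (\<Union>j\<in>- {k}. (B \<circ> i) j)) z) \<longrightarrow>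
        norm (apply_bcontfun (blinfun_apply T g) ((x \<circ> m \<circ> i) k)) \<le> \<epsilon>" for k
    proof (intro allI impI)
      fix g :: "'l \<Rightarrow>\<^sub>C 'k"
      assume g: "\<forall>z. norm (apply_bcontfun g z) \<le> indicator (closure (\<Union>j\<in>- {k}. (B \<circ> i) j)) z"
      have "(\<Union>j\<in>- {k}. (B \<circ> i) j) \<subseteq> (\<Union>j\<in>M - {i k}. B j)"
        using i inj by (auto dest: injD)
      then have "closure (\<Union>j\<in>- {k}. (B \<circ> i) j) \<subseteq> closure (\<Union>j\<in>M - {i k}. B j)"
        by (rule closure_mono)
      then have "indicator (closure (\<Union>j\<in>- {k}. (B \<circ> i) j)) z \<le>
          (indicator (closure (\<Union>j\<in>M - {i k}. B j)) z :: real)" for z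
        by (auto split: split_indicator)
      then have "norm (apply_bcontfun g z) \<le> indicator (closure (\<Union>j\<in>M - {i k}. B j)) z" for z
        using spec[OF g, of z] order_trans by blast
      then have "norm (apply_bcontfun (blinfun_apply T g) (x (m (i k)))) \<le> \<beta> (i k) (M - {i k})"
        unfolding \<beta>_def by (intro \<nu>_dom B_union)
      then show "norm (apply_bcontfun (blinfun_apply T g) ((x \<circ> m \<circ> i) k)) \<le> \<epsilon>"
        using M(2)[OF i[of k]] by simp
    qed
  qed
qed

end

section \<open>Almost factoring an idempotent through an operator\<close>

lemma continuous_on_clopen_If:
  fixes f g :: "'l::topological_space \<Rightarrow> 'b::topological_space"
  assumes "clopen A" "continuous_on UNIV f" "continuous_on UNIV g"
  shows "continuous_on UNIV (\<lambda>x. if x \<in> A then f x else g x)"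
  using continuous_on_If[of A "- A" f g "\<lambda>x. x \<in> A"] assms
  by (auto simp: clopen_def closed_Compl intro: continuous_on_subset)

lemma bcontfun_dense_eqI:
  fixes F G :: "'l::topological_space \<Rightarrow>\<^sub>C 'k::real_normed_vector"
  assumes "\<And>x. x \<in> U \<Longrightarrow> apply_bcontfun F x = apply_bcontfun G x"
    and "\<And>x. x \<notin> closure U \<Longrightarrow> apply_bcontfun F x = apply_bcontfun G x"
  shows "F = G"
proof (rule bcontfun_eqI)
  fix x
  have "closed {x. apply_bcontfun F x = apply_bcontfun G x}"
    by (intro closed_Collect_eq) auto
  then have "closure U \<subseteq> {x. apply_bcontfun F x = apply_bcontfun G x}"
    using assms(1) by (intro closure_minimal) auto
  then show "apply_bcontfun F x = apply_bcontfun G x" using assms(2)[of x] by auto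
qed

lemma bcontfun_dense_norm_bound:
  fixes F :: "'l::topological_space \<Rightarrow>\<^sub>C 'k::real_normed_vector"
  assumes "\<And>x. x \<in> U \<Longrightarrow> norm (apply_bcontfun F x) \<le> K"
    and "\<And>x. x \<notin> closure U \<Longrightarrow> norm (apply_bcontfun F x) \<le> K"
  shows "norm F \<le> K"
proof (rule norm_bound)
  fix x
  have "closed {x. norm (apply_bcontfun F x) \<le> K}"
    by (intro closed_Collect_le) (auto intro!: continuous_intros)
  then have "closure U \<subseteq> {x. norm (apply_bcontfun F x) \<le> K}"
    using assms(1) by (intro closure_minimal) auto
  then show "norm (apply_bcontfun F x) \<le> K" using assms(2)[of x] by auto
qed

context stonean
begin

text \<open>
  The patched function is the least upper bound of the functions equal to \<open>g k\<close> on \<open>B k\<close> and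
  to \<open>- M\<close> elsewhere. On \<open>B k\<close> it cannot exceed \<open>g k\<close>, because the function equal to \<open>g k\<close>
  there and to \<open>M\<close> elsewhere is also an upper bound.
\<close>

lemma real_patching:
  fixes g :: "nat \<Rightarrow> 'l \<Rightarrow> real"
  assumes B: "\<And>k. clopen (B k)" "disjoint_family B"
    and cont: "\<And>k. continuous_on UNIV (g k)" and bound: "\<And>k x. \<bar>g k x\<bar> \<le> M"
  shows "\<exists>G. continuous_on UNIV G \<and> (\<forall>k. \<forall>x\<in>B k. G x = g k x) \<and>
    (\<forall>x. x \<notin> closure (\<Union>k. B k) \<longrightarrow> G x = 0)"
proof -
  have bound': "- M \<le> g k x" "g k x \<le> M" for k x using bound[of k x] by auto
  have M: "- M \<le> M" using bound'[of 0 undefined] by linarith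
  have disj: "j = k" if "x \<in> B j" "x \<in> B k" for j k x
    using B(2) that unfolding disjoint_family_on_def by blast
  define low where "low k x = (if x \<in> B k then g k x else - M)" for k x
  define up where "up k x = (if x \<in> B k then g k x else M)" for k x
  have cont_low: "continuous_on UNIV (low k)" for k
    unfolding low_def by (intro continuous_on_clopen_If B cont) auto
  have cont_up: "continuous_on UNIV (up k)" for k
    unfolding up_def by (intro continuous_on_clopen_If B cont) auto
  have low_M: "low j x \<le> M" for j x using bound'[of j x] M by (auto simp: low_def)
  define F where "F = range low"
  have "F \<noteq> {}" by (simp add: F_def)
  moreover have "continuous_on UNIV f" if "f \<in> F" for f using that cont_low by (auto simp: F_def)
  moreover have "f x \<le> M" if "f \<in> F" for f x using that low_M by (auto simp: F_def)
  ultimately obtain s where s: "continuous_on UNIV s" "\<And>f x. f \<in> F \<Longrightarrow> f x \<le> s x"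
    "\<And>u x. continuous_on UNIV u \<Longrightarrow> (\<And>f y. f \<in> F \<Longrightarrow> f y \<le> u y) \<Longrightarrow> s x \<le> u x"
    using least_upper_bound_exists[of F M] by metis
  have s_eq: "s x = g k x" if x: "x \<in> B k" for k x
  proof (rule antisym)
    have "low j y \<le> up k y" for j y
      using disj[of y j k] bound'[of j y] bound'[of k y] M by (auto simp: low_def up_def)
    then have "s x \<le> up k x" by (intro s(3) cont_up) (auto simp: F_def)
    then show "s x \<le> g k x" using x by (simp add: up_def)
    show "g k x \<le> s x" using s(2)[of "low k" x] x by (simp add: low_def F_def)
  qed
  have U: "clopen (closure (\<Union>k. B k))"
    using B(1) by (intro clopen_closure) (auto simp: clopen_def)
  show ?thesis
  proof (intro exI conjI allI ballI impI)
    show "continuous_on UNIV (\<lambda>x. if x \<in> closure (\<Union>k. B k) then s x else 0)"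
      by (intro continuous_on_clopen_If U s) auto
    show "(if x \<in> closure (\<Union>k. B k) then s x else 0) = g k x" if "x \<in> B k" for k x
    proof -
      have "x \<in> closure (\<Union>k. B k)" by (rule subsetD[OF closure_subset]) (use that in blast)
      then show ?thesis using s_eq[OF that] by simp
    qed
  qed auto
qed

lemma patching:
  fixes g :: "nat \<Rightarrow> 'l \<Rightarrow>\<^sub>C 'k::euclidean_space"
  assumes B: "\<And>k. clopen (B k)" "disjoint_family B" and bound: "\<And>k. norm (g k) \<le> M"
  shows "\<exists>G :: 'l \<Rightarrow>\<^sub>C 'k. norm G \<le> M \<and>
    (\<forall>k. \<forall>x\<in>B k. apply_bcontfun G x = apply_bcontfun (g k) x) \<and>
    (\<forall>x. x \<notin> closure (\<Union>k. B k) \<longrightarrow> apply_bcontfun G x = 0)"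
proof -
  have "\<exists>G. continuous_on UNIV G \<and> (\<forall>k. \<forall>x\<in>B k. G x = apply_bcontfun (g k) x \<bullet> b) \<and>
      (\<forall>x. x \<notin> closure (\<Union>k. B k) \<longrightarrow> G x = 0)" if b: "b \<in> Basis" for b
  proof -
    have bnd: "\<bar>apply_bcontfun (g k) x \<bullet> b\<bar> \<le> M" for k x
      using Basis_le_norm[OF b, of "apply_bcontfun (g k) x"] norm_bounded[of "g k" x] bound[of k] by linarith
    have cont: "continuous_on UNIV (\<lambda>x. apply_bcontfun (g k) x \<bullet> b)" for k
      by (intro continuous_intros) auto
    show ?thesis by (rule real_patching[OF B cont bnd])
  qed
  then obtain G where G: "\<And>b. b \<in> Basis \<Longrightarrow> continuous_on UNIV (G b)"
    "\<And>b k x. b \<in> Basis \<Longrightarrow> x \<in> B k \<Longrightarrow> G b x = apply_bcontfun (g k) x \<bullet> b"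
    "\<And>b x. b \<in> Basis \<Longrightarrow> x \<notin> closure (\<Union>k. B k) \<Longrightarrow> G b x = 0"
    by metis
  define H where "H = Bcontfun (\<lambda>x. \<Sum>b\<in>Basis. G b x *\<^sub>R b)"
  have H: "apply_bcontfun H x = (\<Sum>b\<in>Basis. G b x *\<^sub>R b)" for x
    unfolding H_def by (subst apply_Bcontfun) (auto intro!: continuous_intros G(1))
  have on: "apply_bcontfun H x = apply_bcontfun (g k) x" if "x \<in> B k" for k x
    using that by (simp add: H G(2) euclidean_representation)
  have off: "apply_bcontfun H x = 0" if "x \<notin> closure (\<Union>k. B k)" for x
    using that by (simp add: H G(3))
  have "norm H \<le> M"
  proof (rule bcontfun_dense_norm_bound)
    show "norm (apply_bcontfun H x) \<le> M" if "x \<in> (\<Union>k. B k)" for x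
      using that on norm_bounded bound by (metis (no_types, lifting) UN_E order_trans)
    show "norm (apply_bcontfun H x) \<le> M" if "x \<notin> closure (\<Union>k. B k)" for x
      using off[OF that] order_trans[OF norm_ge_zero bound[of 0]] by simp
  qed
  with on off show ?thesis by (intro exI[of _ H]) simp
qed

text \<open>
  The operator \<open>g \<mapsto> (d k * g (z k))\<^sub>k\<close> into \<open>\<ell>\<^sub>\<infinity>\<close>, followed by the embedding of \<open>\<ell>\<^sub>\<infinity>\<close> into
  \<open>C(L)\<close> that patches the multiples of the \<open>f k\<close>.
\<close>

lemma sampling_operator:
  fixes f :: "nat \<Rightarrow> 'l \<Rightarrow>\<^sub>C 'k::{real_normed_field, euclidean_space}" and z :: "nat \<Rightarrow> 'l"
  assumes B: "\<And>k. clopen (B k)" "disjoint_family B"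
    and f: "\<And>k. norm (f k) \<le> 1" and d: "\<And>k. norm (d k) \<le> D"
  shows "\<exists>J\<in>(bounded_operators :: ('l, 'k) operator set). norm J \<le> D \<and>
    (\<forall>g k. \<forall>x\<in>B k.
      apply_bcontfun (blinfun_apply J g) x = d k * apply_bcontfun g (z k) * apply_bcontfun (f k) x) \<and>
    (\<forall>g x. x \<notin> closure (\<Union>k. B k) \<longrightarrow> apply_bcontfun (blinfun_apply J g) x = 0)"
proof -
  have D: "D \<ge> 0" using d[of 0] norm_ge_zero order_trans by blast
  have "\<exists>G. norm G \<le> D * norm g \<and> (\<forall>k. \<forall>x\<in>B k. apply_bcontfun G x = d k * apply_bcontfun g (z k) * apply_bcontfun (f k) x) \<and>
      (\<forall>x. x \<notin> closure (\<Union>k. B k) \<longrightarrow> apply_bcontfun G x = 0)" for g :: "'l \<Rightarrow>\<^sub>C 'k"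
  proof -
    have "norm (scale_bcontfun (d k * apply_bcontfun g (z k)) (f k)) \<le> D * norm g" for k
    proof -
      have "norm (scale_bcontfun (d k * apply_bcontfun g (z k)) (f k)) \<le>
          norm (d k * apply_bcontfun g (z k)) * norm (f k)"
        by (rule norm_scale_bcontfun_le)
      also have "\<dots> \<le> (D * norm g) * 1"
        unfolding norm_mult using d D f by (intro mult_mono norm_bounded) auto
      finally show ?thesis by simp
    qed
    from patching[where g = "\<lambda>k. scale_bcontfun (d k * apply_bcontfun g (z k)) (f k)", OF B this]
    show ?thesis by (simp only: apply_scale_bcontfun)
  qed
  then obtain w where w: "\<And>g. norm (w g) \<le> D * norm g"
    "\<And>g k x. x \<in> B k \<Longrightarrow> apply_bcontfun (w g) x = d k * apply_bcontfun g (z k) * apply_bcontfun (f k) x"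
    "\<And>g x. x \<notin> closure (\<Union>k. B k) \<Longrightarrow> apply_bcontfun (w g) x = 0"
    by metis
  have add: "w (g + h) = w g + w h" for g h
    by (rule bcontfun_dense_eqI[of "\<Union>k. B k"]) (auto simp: w(2,3) algebra_simps)
  have scale: "w (scale_bcontfun c g) = scale_bcontfun c (w g)" for c g
    by (rule bcontfun_dense_eqI[of "\<Union>k. B k"]) (auto simp: w(2,3) algebra_simps)
  note J = bounded_operatorI[of w, OF add scale w(1)]
  have "norm (Blinfun w) \<le> D"
    using D w(1) by (intro norm_blinfun_bound) (auto simp: J(1))
  then show ?thesis
    using J w(2,3) by (intro bexI[of _ "Blinfun w"]) auto
qed

text \<open>
  The partial sums \<open>\<sigma> n\<close> of the \<open>f k\<close> stay in the unit ball and are fixed by \<open>P\<close>. A weak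
  cluster point \<open>g\<close> of theirs would have modulus one at every \<open>y k\<close>, hence also at an
  accumulation point \<open>y'\<close> of the \<open>y k\<close>, whereas all \<open>\<sigma> n\<close> vanish at \<open>y'\<close>.
\<close>

lemma not_weakly_compact_if_fixes_disjoint_sequence:
  fixes P :: "('l, 'k::real_normed_field) operator" and f :: "nat \<Rightarrow> 'l \<Rightarrow>\<^sub>C 'k"
  assumes B: "disjoint_family B"
    and f: "\<And>k. norm (f k) \<le> 1" "\<And>k x. x \<notin> B k \<Longrightarrow> apply_bcontfun (f k) x = 0"
    and y: "\<And>k. norm (apply_bcontfun (f k) (y k)) = 1"
    and P: "\<And>k. blinfun_apply P (f k) = f k"
  shows "P \<notin> weakly_compact_operators"
proof
  assume "P \<in> weakly_compact_operators"
  then obtain K where K: "compactin weak_topology K" "blinfun_apply P ` cball 0 1 \<subseteq> K"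
    unfolding weakly_compact_operators_iff by blast
  have yB: "y k \<in> B k" for k
    using f(2)[of "y k" k] y[of k] by (cases "y k \<in> B k") simp_all
  have disj: "j = k" if "x \<in> B j" "x \<in> B k" for j k x
    using B that unfolding disjoint_family_on_def by blast
  have f_y: "apply_bcontfun (f j) x = 0" if "x \<in> B k" "j \<noteq> k" for j k x
    using f(2)[of x j] disj[of x j k] that by blast
  define \<sigma> where "\<sigma> n = (\<Sum>j<n. f j)" for n
  have \<sigma>: "apply_bcontfun (\<sigma> n) x = (\<Sum>j<n. apply_bcontfun (f j) x)" for n x
    by (induction n) (simp_all add: \<sigma>_def)
  have \<sigma>_on: "apply_bcontfun (\<sigma> n) x = (if k < n then apply_bcontfun (f k) x else 0)" if "x \<in> B k" for n k x
  proof -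
    have "(\<Sum>j<n. apply_bcontfun (f j) x) = (\<Sum>j<n. if j = k then apply_bcontfun (f k) x else 0)"
      using f_y[OF that] by (intro sum.cong) auto
    then show ?thesis by (simp add: \<sigma>)
  qed
  have "norm (\<sigma> n) \<le> 1" for n
  proof (rule norm_bound)
    fix x show "norm (apply_bcontfun (\<sigma> n) x) \<le> 1"
    proof (cases "\<exists>k. x \<in> B k")
      case True
      then obtain k where "x \<in> B k" ..
      then show ?thesis using \<sigma>_on[of x k n] norm_bounded[of "f k" x] f(1)[of k] by auto
    next
      case False
      then show ?thesis using f(2) by (simp add: \<sigma>)
    qed
  qed
  moreover have "blinfun_apply P (\<sigma> n) = \<sigma> n" for n
    by (simp add: \<sigma>_def blinfun.sum_right P)
  ultimately have \<sigma>_K: "\<sigma> n \<in> K" for n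
    using K(2) by (metis image_subset_iff mem_cball_0)
  have "inj y" using yB disj by (metis injI)
  then have "infinite (range y)" by (rule range_inj_infinite)
  then obtain y' where y': "y' islimpt range y"
    using Heine_Borel_imp_Bolzano_Weierstrass[OF compact_UNIV _ subset_UNIV] by blast
  have \<sigma>_y': "apply_bcontfun (\<sigma> n) y' = 0" for n
  proof -
    have "range y = y ` {..<n} \<union> y ` {n..}" by (auto simp: image_Un[symmetric])
    then have "y' islimpt y ` {n..}" using y' by (simp add: islimpt_Un_finite)
    moreover have "y ` {n..} \<subseteq> {x. apply_bcontfun (\<sigma> n) x = 0}" using \<sigma>_on[OF yB] by auto
    ultimately have "y' islimpt {x. apply_bcontfun (\<sigma> n) x = 0}" by (rule islimpt_subset)
    moreover have "closed {x. apply_bcontfun (\<sigma> n) x = 0}" by (intro closed_Collect_eq) auto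
    ultimately show ?thesis by (auto simp: closed_limpt)
  qed
  have closed_eval: "closedin weak_topology {g. apply_bcontfun g x = c}" for x and c :: 'k
    using closedin_continuous_map_preimage[OF continuous_map_weak_topology[OF point_evaluation_in_dual_space[of x]],
        of "{c}"] by simp
  \<comment> \<open>Weakly closed sets, any finitely many of which contain \<open>\<sigma> m\<close> for large \<open>m\<close>.\<close>
  define \<C> where "\<C> = insert {g. apply_bcontfun g y' = 0}
      (range (\<lambda>n. {g. apply_bcontfun g (y n) = apply_bcontfun (f n) (y n)}))"
  have fip: "K \<inter> \<Inter>\<F> \<noteq> {}" if "finite \<F>" "\<F> \<subseteq> \<C>" for \<F>
  proof -
    have "finite (\<F> - {{g. apply_bcontfun g y' = 0}})"
      "\<F> - {{g. apply_bcontfun g y' = 0}} \<subseteq> range (\<lambda>n. {g. apply_bcontfun g (y n) = apply_bcontfun (f n) (y n)})"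
      using that by (auto simp: \<C>_def)
    then obtain N where N: "finite N"
      "\<F> - {{g. apply_bcontfun g y' = 0}} = (\<lambda>n. {g. apply_bcontfun g (y n) = apply_bcontfun (f n) (y n)}) ` N"
      by (meson finite_subset_image)
    obtain m where m: "\<And>n. n \<in> N \<Longrightarrow> n < m" using N(1) finite_nat_set_iff_bounded by auto
    have "\<sigma> m \<in> C" if C: "C \<in> \<F>" for C
    proof (cases "C = {g. apply_bcontfun g y' = 0}")
      case True
      then show ?thesis using \<sigma>_y' by simp
    next
      case False
      then obtain n where "n \<in> N" "C = {g. apply_bcontfun g (y n) = apply_bcontfun (f n) (y n)}"
        using N(2) C by blast
      then show ?thesis using \<sigma>_on[OF yB, of m n] m by simp
    qed
    with \<sigma>_K show ?thesis by blast
  qed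
  have "\<forall>C\<in>\<C>. closedin weak_topology C" using closed_eval by (auto simp: \<C>_def)
  with fip K(1) have "K \<inter> \<Inter>\<C> \<noteq> {}" unfolding compactin_fip by blast
  then obtain g where g: "apply_bcontfun g y' = 0" "\<And>n. apply_bcontfun g (y n) = apply_bcontfun (f n) (y n)"
    by (auto simp: \<C>_def)
  have "range y \<subseteq> {x. norm (apply_bcontfun g x) = 1}" using g(2) y by auto
  then have "y' islimpt {x. norm (apply_bcontfun g x) = 1}" using y' islimpt_subset by blast
  moreover have "closed {x. norm (apply_bcontfun g x) = 1}"
    by (intro closed_Collect_eq) (auto intro!: continuous_intros)
  ultimately have "norm (apply_bcontfun g y') = 1" by (auto simp: closed_limpt)
  then show False using g(1) by simp
qed

text \<open>
  With \<open>\<bar>f k\<bar>\<close> attaining its norm one at \<open>y k\<close>, let \<open>P\<close> sample at \<open>y k\<close> with weight \<open>1 / f k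
  (y k)\<close> and let \<open>V\<close> sample at \<open>x k\<close> with weight \<open>1 / T (f k) (x k)\<close>. On \<open>B k\<close> the function \<open>P
  g\<close> is a multiple \<open>b f k\<close>; \<open>V T\<close> reproduces this multiple up to the contribution of the rest
  of \<open>P g\<close>, which lives on the closure of the other \<open>B j\<close> and is almost invisible at \<open>x k\<close>.
\<close>

theorem almost_factorization:
  fixes T :: "('l, 'k::{real_normed_field, euclidean_space}) operator"
  assumes dec: "dominated_decompositions TYPE('k)" and T: "T \<in> bounded_operators"
    and far: "\<forall>W\<in>weakly_compact_operators. c < norm (T - W)"
    and \<epsilon>: "0 < \<epsilon>" "\<epsilon> < c"
  obtains P V :: "('l, 'k) operator" where "P \<in> bounded_operators" "V \<in> bounded_operators"
    "P \<notin> weakly_compact_operators" "P o\<^sub>L P = P" "norm P \<le> 1" "norm V \<le> 1 / (c - \<epsilon>)"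
    "norm (P - (V o\<^sub>L (T o\<^sub>L P))) \<le> \<epsilon> / (c - \<epsilon>)"
proof -
  have c: "0 \<le> c" "0 < c - \<epsilon>" using \<epsilon> by auto
  obtain B :: "nat \<Rightarrow> 'l set" and f0 :: "nat \<Rightarrow> 'l \<Rightarrow>\<^sub>C 'k" and x :: "nat \<Rightarrow> 'l"
    where B: "\<And>k. clopen (B k)" "disjoint_family B" and f0: "\<And>k. norm (f0 k) \<le> 1"
    "\<And>k z. z \<notin> B k \<Longrightarrow> apply_bcontfun (f0 k) z = 0"
    "\<And>k. c - \<epsilon> < norm (apply_bcontfun (blinfun_apply T (f0 k)) (x k))"
    and offdiag: "\<And>k. \<forall>g. (\<forall>z. norm (apply_bcontfun g z) \<le> indicator (closure (\<Union>j\<in>- {k}. B j)) z) \<longrightarrow>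
      norm (apply_bcontfun (blinfun_apply T g) (x k)) \<le> \<epsilon>"
    using almost_diagonal_sequence[OF dec T c(1) far \<epsilon>(1)] by metis
  have nz: "norm (f0 k) > 0" for k
    using f0(3)[of k] c(2) by (auto simp: blinfun.zero_right)
  define f where "f k = (1 / norm (f0 k)) *\<^sub>R f0 k" for k
  have f: "norm (f k) = 1" "z \<notin> B k \<Longrightarrow> apply_bcontfun (f k) z = 0" for k z
    using nz[of k] f0(2) by (auto simp: f_def)
  have Tf: "c - \<epsilon> \<le> norm (apply_bcontfun (blinfun_apply T (f k)) (x k))" for k
  proof -
    have "norm (f0 k) * (c - \<epsilon>) \<le> 1 * (c - \<epsilon>)"
      using f0(1) c(2) by (intro mult_right_mono) auto
    then have "norm (f0 k) * (c - \<epsilon>) \<le> norm (apply_bcontfun (blinfun_apply T (f0 k)) (x k))"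
      using f0(3)[of k] by simp
    then show ?thesis using nz[of k] by (simp add: f_def blinfun.scaleR_right field_simps)
  qed
  have "\<exists>y. norm (apply_bcontfun (f k) y) = 1" for k
  proof -
    obtain y where y: "\<And>z. norm (apply_bcontfun (f k) z) \<le> norm (apply_bcontfun (f k) y)"
      using continuous_attains_sup[OF compact_UNIV, of "\<lambda>z. norm (apply_bcontfun (f k) z)"]
      by (auto intro!: continuous_intros)
    then have "norm (f k) \<le> norm (apply_bcontfun (f k) y)" by (rule norm_bound)
    then show ?thesis using norm_bounded[of "f k" y] f(1)[of k] by (intro exI[of _ y]) simp
  qed
  then obtain y where y: "\<And>k. norm (apply_bcontfun (f k) (y k)) = 1" by metis
  have fy: "apply_bcontfun (f k) (y k) \<noteq> 0" for k using y[of k] by auto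
  have yB: "y k \<in> B k" for k using f(2)[of "y k" k] fy[of k] by blast
  have Tf_nz: "apply_bcontfun (blinfun_apply T (f k)) (x k) \<noteq> 0" for k
    using Tf[of k] c(2) by auto
  have Tf_inverse: "norm (inverse (apply_bcontfun (blinfun_apply T (f k)) (x k))) \<le> 1 / (c - \<epsilon>)" for k
    using le_imp_inverse_le[OF Tf[of k] c(2)] by (simp add: norm_inverse divide_inverse)
  obtain P :: "('l, 'k) operator" where P: "P \<in> bounded_operators" "norm P \<le> 1"
    "\<And>g k z. z \<in> B k \<Longrightarrow> apply_bcontfun (blinfun_apply P g) z =
      inverse (apply_bcontfun (f k) (y k)) * apply_bcontfun g (y k) * apply_bcontfun (f k) z"
    "\<And>g z. z \<notin> closure (\<Union>k. B k) \<Longrightarrow> apply_bcontfun (blinfun_apply P g) z = 0"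
  proof -
    have "norm (f k) \<le> 1" "norm (inverse (apply_bcontfun (f k) (y k))) \<le> 1" for k
      using f(1) y by (simp_all add: norm_inverse)
    from sampling_operator[where B = B and f = f and z = y
        and d = "\<lambda>k. inverse (apply_bcontfun (f k) (y k))", OF B this] show thesis using that by blast
  qed
  obtain V :: "('l, 'k) operator" where V: "V \<in> bounded_operators" "norm V \<le> 1 / (c - \<epsilon>)"
    "\<And>g k z. z \<in> B k \<Longrightarrow> apply_bcontfun (blinfun_apply V g) z =
      inverse (apply_bcontfun (blinfun_apply T (f k)) (x k)) * apply_bcontfun g (x k) * apply_bcontfun (f k) z"
    "\<And>g z. z \<notin> closure (\<Union>k. B k) \<Longrightarrow> apply_bcontfun (blinfun_apply V g) z = 0"
  proof -
    have "norm (f k) \<le> 1" "norm (inverse (apply_bcontfun (blinfun_apply T (f k)) (x k))) \<le> 1 / (c - \<epsilon>)" for k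
      using f(1) Tf_inverse by simp_all
    from sampling_operator[where B = B and f = f and z = x
        and d = "\<lambda>k. inverse (apply_bcontfun (blinfun_apply T (f k)) (x k))", OF B this] show thesis using that by blast
  qed
  \<comment> \<open>Only the \<open>k\<close>-th sample of \<open>f k\<close> is nonzero.\<close>
  have P_f: "blinfun_apply P (f k) = f k" for k
  proof (rule bcontfun_dense_eqI[of "\<Union>k. B k"])
    fix z assume "z \<in> (\<Union>k. B k)"
    then obtain j where j: "z \<in> B j" by blast
    show "apply_bcontfun (blinfun_apply P (f k)) z = apply_bcontfun (f k) z"
    proof (cases "j = k")
      case True
      then show ?thesis using P(3)[OF j, of "f k"] fy[of k] by simp
    next
      case False
      then have "z \<notin> B k" "y j \<notin> B k"
        using j yB[of j] B(2) unfolding disjoint_family_on_def by blast+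
      then show ?thesis using P(3)[OF j, of "f k"] f(2) by simp
    qed
  next
    fix z assume z: "z \<notin> closure (\<Union>k. B k)"
    then have "z \<notin> B k" using closure_subset[of "\<Union>k. B k"] by auto
    with z show "apply_bcontfun (blinfun_apply P (f k)) z = apply_bcontfun (f k) z"
      using P(4) f(2) by simp
  qed
  have "P o\<^sub>L P = P"
  proof (rule blinfun_eqI)
    fix g
    have "blinfun_apply P (blinfun_apply P g) = blinfun_apply P g"
    proof (rule bcontfun_dense_eqI[of "\<Union>k. B k"])
      fix z assume "z \<in> (\<Union>k. B k)"
      then obtain k where k: "z \<in> B k" by blast
      have "apply_bcontfun (blinfun_apply P g) (y k) = apply_bcontfun g (y k)"
        using P(3)[OF yB, of g k] fy[of k] by simp
      then show "apply_bcontfun (blinfun_apply P (blinfun_apply P g)) z = apply_bcontfun (blinfun_apply P g) z"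
        by (simp add: P(3)[OF k])
    qed (simp add: P(4))
    then show "blinfun_apply (P o\<^sub>L P) g = blinfun_apply P g" by simp
  qed
  moreover have "P \<notin> weakly_compact_operators"
    by (rule not_weakly_compact_if_fixes_disjoint_sequence[OF B(2) _ f(2) y P_f]) (simp_all add: f(1))
  moreover have "norm (P - (V o\<^sub>L (T o\<^sub>L P))) \<le> \<epsilon> / (c - \<epsilon>)"
  proof (rule norm_blinfun_bound)
    show "0 \<le> \<epsilon> / (c - \<epsilon>)" using \<epsilon> by simp
    fix g :: "'l \<Rightarrow>\<^sub>C 'k"
    have "norm (blinfun_apply P g - blinfun_apply V (blinfun_apply T (blinfun_apply P g))) \<le> \<epsilon> / (c - \<epsilon>) * norm g"
    proof (rule bcontfun_dense_norm_bound[of "\<Union>k. B k"])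
      fix z assume "z \<in> (\<Union>k. B k)"
      then obtain k where k: "z \<in> B k" by blast
      define b where "b = inverse (apply_bcontfun (f k) (y k)) * apply_bcontfun g (y k)"
      define r where "r = blinfun_apply P g - scale_bcontfun b (f k)"
      let ?t = "apply_bcontfun (blinfun_apply T (f k)) (x k)"
      have Pg: "norm (blinfun_apply P g) \<le> norm g"
        using norm_blinfun[of P g] mult_right_mono[OF P(2) norm_ge_zero[of g]] by simp
      have r_le: "norm (apply_bcontfun r u) \<le> norm g * indicator (closure (\<Union>j\<in>- {k}. B j)) u" for u
      proof (cases "u \<in> closure (\<Union>j\<in>- {k}. B j)")
        case True
        have "B k \<inter> closure (\<Union>j\<in>- {k}. B j) = {}"
        proof -
          have "closure (\<Union>j\<in>- {k}. B j) \<subseteq> - B k"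
          proof (rule closure_minimal)
            show "(\<Union>j\<in>- {k}. B j) \<subseteq> - B k"
              using B(2) unfolding disjoint_family_on_def by blast
            show "closed (- B k)" using B(1)[of k] by (simp add: clopen_def closed_Compl)
          qed
          then show ?thesis by blast
        qed
        then have "u \<notin> B k" using True by blast
        then have "apply_bcontfun r u = apply_bcontfun (blinfun_apply P g) u"
          by (simp add: r_def f(2))
        then show ?thesis using True Pg norm_bounded[of "blinfun_apply P g" u] by simp
      next
        case False
        show ?thesis
        proof (cases "u \<in> B k")
          case True
          then show ?thesis by (simp add: r_def P(3)[OF True] b_def)
        next
          case False': False
          have "(\<Union>j. B j) = (\<Union>j\<in>- {k}. B j) \<union> B k" by auto
          then have "closure (\<Union>j. B j) = closure (\<Union>j\<in>- {k}. B j) \<union> B k"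
            using B(1)[of k] by (simp add: clopen_def closure_Un closure_closed)
          then have "u \<notin> closure (\<Union>j. B j)" using False False' by simp
          then show ?thesis using False' by (simp add: r_def P(4) f(2))
        qed
      qed
      have Tr: "norm (apply_bcontfun (blinfun_apply T r) (x k)) \<le> \<epsilon> * norm g"
      proof (cases "g = 0")
        case True
        then have "r = 0" using r_le by (intro bcontfun_eqI) simp
        then show ?thesis using True by simp
      next
        case False
        then have g: "norm g > 0" by simp
        have "norm (apply_bcontfun ((1 / norm g) *\<^sub>R r) u) \<le> indicator (closure (\<Union>j\<in>- {k}. B j)) u" for u
          using r_le[of u] g by (simp add: field_simps)
        with offdiag[of k] have "norm (apply_bcontfun (blinfun_apply T ((1 / norm g) *\<^sub>R r)) (x k)) \<le> \<epsilon>"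
          by blast
        then show ?thesis
          using g by (simp add: blinfun.scaleR_right field_simps)
      qed
      have "blinfun_apply T (blinfun_apply P g) = scale_bcontfun b (blinfun_apply T (f k)) + blinfun_apply T r"
      proof -
        have "blinfun_apply P g = scale_bcontfun b (f k) + r" by (simp add: r_def)
        then show ?thesis using T by (simp add: blinfun.add_right bounded_operators_def)
      qed
      then have "apply_bcontfun (blinfun_apply V (blinfun_apply T (blinfun_apply P g))) z =
          inverse ?t * (b * ?t + apply_bcontfun (blinfun_apply T r) (x k)) * apply_bcontfun (f k) z"
        by (simp add: V(3)[OF k])
      also have "\<dots> = b * apply_bcontfun (f k) z +
          inverse ?t * apply_bcontfun (blinfun_apply T r) (x k) * apply_bcontfun (f k) z"
        using Tf_nz[of k] by (simp add: field_simps)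
      finally have "apply_bcontfun (blinfun_apply P g - blinfun_apply V (blinfun_apply T (blinfun_apply P g))) z =
          - (inverse ?t * apply_bcontfun (blinfun_apply T r) (x k) * apply_bcontfun (f k) z)"
        by (simp add: P(3)[OF k] b_def)
      also have "norm \<dots> \<le> (1 / (c - \<epsilon>)) * (\<epsilon> * norm g) * 1"
      proof -
        have "norm (inverse ?t) \<le> 1 / (c - \<epsilon>)"
          by (rule Tf_inverse)
        moreover have "norm (apply_bcontfun (f k) z) \<le> 1" using norm_bounded[of "f k" z] f(1)[of k] by simp
        ultimately show ?thesis
          unfolding norm_minus_cancel norm_mult using c(2) \<epsilon> Tr by (intro mult_mono) auto
      qed
      finally show "norm (apply_bcontfun (blinfun_apply P g - blinfun_apply V (blinfun_apply T (blinfun_apply P g))) z)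
          \<le> \<epsilon> / (c - \<epsilon>) * norm g" by simp
    next
      fix z assume "z \<notin> closure (\<Union>k. B k)"
      then show "norm (apply_bcontfun (blinfun_apply P g - blinfun_apply V (blinfun_apply T (blinfun_apply P g))) z)
          \<le> \<epsilon> / (c - \<epsilon>) * norm g"
        using \<epsilon> by (simp add: P(4) V(4))
    qed
    then show "norm (blinfun_apply (P - (V o\<^sub>L (T o\<^sub>L P))) g) \<le> \<epsilon> / (c - \<epsilon>) * norm g"
      by (simp add: blinfun.diff_left)
  qed
  ultimately show thesis using P V by (intro that[of P V]) auto
qed

end

section \<open>Minimality of the weak essential norm\<close>

abbreviation calkin_class ::
    "('l::topological_space, 'k::real_normed_field) operator \<Rightarrow> ('l, 'k) operator set"
  where "calkin_class T \<equiv> weakly_compact_operators +>\<^bsub>operator_algebra\<^esub> T"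

text \<open>
  The quotient operations can be computed on representatives because the weakly compact
  operators form an ideal.
\<close>

lemma calkin_class_operations:
  fixes S T :: "('l::topological_space, 'k::real_normed_field) operator"
  assumes "S \<in> bounded_operators" "T \<in> bounded_operators"
  shows "calkin_class S \<otimes>\<^bsub>weak_calkin\<^esub> calkin_class T = calkin_class (S o\<^sub>L T)"
    and "calkin_class S \<oplus>\<^bsub>weak_calkin\<^esub> calkin_class T = calkin_class (S + T)"
    and "calkin_class T = \<zero>\<^bsub>weak_calkin\<^esub> \<Longrightarrow> T \<in> weakly_compact_operators"
    and "T \<in> calkin_class T"
proof -
  interpret ideal weakly_compact_operators "operator_algebra :: ('k, ('l, 'k) operator) module"
    by (rule ideal_weakly_compact_operators)
  have carrier: "S \<in> carrier operator_algebra" "T \<in> carrier operator_algebra"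
    using assms by (simp_all add: operator_algebra_def)
  note defs = weak_calkin_def ring.extend_def module.fields_def FactRing_def
  show "calkin_class S \<otimes>\<^bsub>weak_calkin\<^esub> calkin_class T = calkin_class (S o\<^sub>L T)"
    using rcoset_mult_add[OF carrier] by (simp add: defs) (simp add: operator_algebra_def)
  show "calkin_class S \<oplus>\<^bsub>weak_calkin\<^esub> calkin_class T = calkin_class (S + T)"
    using a_rcos_sum[OF carrier] by (simp add: defs) (simp add: operator_algebra_def)
  show self: "T \<in> calkin_class T" by (rule a_rcos_self[OF carrier(2)])
  show "T \<in> weakly_compact_operators" if "calkin_class T = \<zero>\<^bsub>weak_calkin\<^esub>"
    using self that by (simp add: defs)
qed

lemma weak_essential_norm_le: "T \<in> bounded_operators \<Longrightarrow> weak_essential_norm (calkin_class T) \<le> norm T"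
  unfolding weak_essential_norm_def
  by (rule cINF_lower) (auto intro: bdd_belowI[of _ 0] calkin_class_operations(4))

text \<open>
  If \<open>q\<close> were smaller at the class of \<open>T\<close>, there would be \<open>c\<close> strictly between the two norms;
  the approximate factorization of \<open>P\<close> through \<open>T\<close> contradicts \<open>q(P) \<ge> 1\<close>, where \<open>r\<close> below is
  \<open>q\<close> evaluated at the class of an operator.
\<close>

lemma (in stonean) weak_essential_norm_minimal:
  assumes dec: "dominated_decompositions TYPE('k::{real_normed_field, euclidean_space})"
  shows "bonsall_minimality (weak_calkin :: ('k, ('l, 'k) operator set) module) weak_essential_norm"
  unfolding bonsall_minimality_def
proof (intro allI impI ballI, elim conjE)
  fix q and X :: "('l, 'k) operator set"
  assume "algebra_norm (weak_calkin :: ('k, ('l, 'k) operator set) module) q"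
    and le: "\<forall>X\<in>carrier (weak_calkin :: ('k, ('l, 'k) operator set) module). q X \<le> weak_essential_norm X"
    and "X \<in> carrier weak_calkin"
  then obtain T where T: "T \<in> bounded_operators" "X = calkin_class T"
    by (auto simp: carrier_weak_calkin)
  have carrier: "calkin_class S \<in> carrier weak_calkin" if "S \<in> bounded_operators" for S :: "('l, 'k) operator"
    using that by (auto simp: carrier_weak_calkin)
  define r where "r S = q (calkin_class S)" for S
  note q = \<open>algebra_norm weak_calkin q\<close>[unfolded algebra_norm_def]
  have r_nonneg: "0 \<le> r S" if "S \<in> bounded_operators" for S
    unfolding r_def using q carrier[OF that] by blast
  have r_zero: "S \<in> weakly_compact_operators" if "S \<in> bounded_operators" "r S = 0" for S
    using q carrier[OF that(1)] that calkin_class_operations(3)[of S S] unfolding r_def by blast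
  have r_add: "r (S + S') \<le> r S + r S'" if "S \<in> bounded_operators" "S' \<in> bounded_operators" for S S'
    unfolding r_def calkin_class_operations(2)[OF that, symmetric] using q carrier that by blast
  have r_mult: "r (S o\<^sub>L S') \<le> r S * r S'" if "S \<in> bounded_operators" "S' \<in> bounded_operators" for S S'
    unfolding r_def calkin_class_operations(1)[OF that, symmetric] using q carrier that by blast
  have r_le: "r S \<le> norm S" if "S \<in> bounded_operators" for S
    unfolding r_def using le carrier[OF that] weak_essential_norm_le[OF that] by (meson order_trans)
  have "\<not> q X < weak_essential_norm X"
  proof
    assume "q X < weak_essential_norm X"
    then obtain c where c: "r T < c" "c < weak_essential_norm X"
      using dense unfolding r_def T(2) by blast
    \<comment> \<open>A third of the gap leaves room for the two losses of size \<open>\<epsilon>\<close> in \<open>1 \<le> (\<epsilon> + r T) / (c - \<epsilon>)\<close>.\<close>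
    define \<epsilon> where "\<epsilon> = (c - r T) / 3"
    have \<epsilon>: "0 < \<epsilon>" "\<epsilon> < c" "r T + \<epsilon> < c - \<epsilon>"
      using c(1) r_nonneg[OF T(1)] by (simp_all add: \<epsilon>_def field_simps)
    have far: "\<forall>W\<in>weakly_compact_operators. c < norm (T - W)"
    proof
      fix W :: "('l, 'k) operator" assume "W \<in> weakly_compact_operators"
      then have "(INF W\<in>weakly_compact_operators. norm (T - W)) \<le> norm (T - W)"
        by (intro cINF_lower) (auto intro: bdd_belowI[of _ 0])
      then show "c < norm (T - W)"
        using c(2) by (simp add: T(2) weak_essential_norm_coset)
    qed
    obtain P V :: "('l, 'k) operator" where PV: "P \<in> bounded_operators" "V \<in> bounded_operators"
      "P \<notin> weakly_compact_operators" "P o\<^sub>L P = P" "norm P \<le> 1" "norm V \<le> 1 / (c - \<epsilon>)"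
      "norm (P - (V o\<^sub>L (T o\<^sub>L P))) \<le> \<epsilon> / (c - \<epsilon>)"
      using almost_factorization[OF dec T(1) far \<epsilon>(1,2)] by blast
    have "r P > 0" using r_nonneg[OF PV(1)] r_zero[OF PV(1)] PV(3) by fastforce
    moreover have "r P \<le> r P * r P" using r_mult[OF PV(1,1)] PV(4) by simp
    ultimately have "1 \<le> r P" by simp
    have mem: "V o\<^sub>L (T o\<^sub>L P) \<in> bounded_operators" "P - (V o\<^sub>L (T o\<^sub>L P)) \<in> bounded_operators"
      using PV(1,2) T(1) by (auto intro!: bounded_operators_closed)
    have "r P = r ((P - (V o\<^sub>L (T o\<^sub>L P))) + (V o\<^sub>L (T o\<^sub>L P)))" by simp
    also have "\<dots> \<le> r (P - (V o\<^sub>L (T o\<^sub>L P))) + r (V o\<^sub>L (T o\<^sub>L P))"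
      by (rule r_add[OF mem(2,1)])
    also have "r (P - (V o\<^sub>L (T o\<^sub>L P))) \<le> \<epsilon> / (c - \<epsilon>)"
      using r_le[OF mem(2)] PV(7) by simp
    also have "r (V o\<^sub>L (T o\<^sub>L P)) \<le> 1 / (c - \<epsilon>) * (r T * 1)"
    proof -
      have "r (V o\<^sub>L (T o\<^sub>L P)) \<le> r V * r (T o\<^sub>L P)"
        using PV(1,2) T(1) by (intro r_mult bounded_operators_closed)
      also have "\<dots> \<le> r V * (r T * r P)"
        using PV(1,2) T(1) by (intro mult_left_mono r_mult r_nonneg)
      also have "\<dots> \<le> 1 / (c - \<epsilon>) * (r T * 1)"
      proof (intro mult_mono)
        show "r V \<le> 1 / (c - \<epsilon>)" using r_le[OF PV(2)] PV(6) by simp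
        show "r P \<le> 1" using r_le[OF PV(1)] PV(5) by simp
      qed (use PV(1,2) T(1) r_nonneg \<epsilon> in auto)
      finally show ?thesis .
    qed
    finally have "1 \<le> (\<epsilon> + r T) / (c - \<epsilon>)"
      using \<open>1 \<le> r P\<close> by (simp add: add_divide_distrib)
    then show False using \<epsilon> by (simp add: field_simps)
  qed
  moreover have "q X \<le> weak_essential_norm X" using le carrier[OF T(1)] T(2) by blast
  ultimately show "q X = weak_essential_norm X" by simp
qed

theorem corollary1p12:
  assumes "compact (UNIV :: 'l::t2_space set)"
    and "\<And>U :: 'l set. open U \<Longrightarrow> open (closure U)"
  shows "bonsall_minimality
           (weak_calkin :: (real, ('l, real) operator set) module) weak_essential_norm
         \<and> bonsall_minimality
           (weak_calkin :: (complex, ('l, complex) operator set) module) weak_essential_norm"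
proof -
  interpret stonean "TYPE('l)"
    using assms by unfold_locales
  show ?thesis
    by (intro conjI weak_essential_norm_minimal dominated_decompositions_real
        dominated_decompositions_complex)
qed

end
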